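(* Let $D\subset\mathbb{C}$ be a finitely connected bounded domain without isolated boundary points. Then $$\lim_{\substack{w\to\partial D\\ z\ne w}}\frac{c_D(z,w)}{l_D(z,w)}=1\quad\text{uniformly in } z\in D;$$ that is, for every $\varepsilon>0$ there is $\delta>0$ such that $\left|\frac{c_D(z,w)}{l_D(z,w)}-1\right|<\varepsilon$ for all $z,w\in D$ with $z\neq w$ and $\mathrm{dist}(w,\partial D)<\delta$.
   Context: $\mathbb{D}$ is the open unit disc in $\mathbb{C}$; $\mathcal{O}(X,Y)$ is the set of holomorphic maps $X\to Y$. Finitely connected means that the complement of $D$ in the Riemann sphere has finitely many connected components. The Carathéodory distance is $c_D(z,w)=\sup\{\tanh^{-1}|f(w)|: f\in\mathcal{O}(D,\mathbb{D}),\ f(z)=0\}$. The Lempert function is $l_D(z,w)=\inf\{\tanh^{-1}|\alpha|:\exists\varphi\in\mathcal{O}(\mathbb{D},D)\text{ with }\varphi(0)=z,\ \varphi(\alpha)=w\}$. *)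

theory Defs
  imports "HOL-Complex_Analysis.Complex_Analysis"
begin

(* The point at infinity is None; finite points are of the form Some z. *)
definition riemann_sphere :: "complex option topology" where
  "riemann_sphere = Alexandroff_compactification euclidean"

definition finitely_connected :: "complex set \<Rightarrow> bool" where
  "finitely_connected D \<longleftrightarrow>
     finite (connected_components_of (subtopology riemann_sphere (- Some ` D)))"

definition holo_maps :: "complex set \<Rightarrow> complex set \<Rightarrow> (complex \<Rightarrow> complex) set" where
  "holo_maps X Y = {f. f holomorphic_on X \<and> f ` X \<subseteq> Y}"

(* The supremum and infimum below are taken in the reals. For a domain D and z, w in D both sets
   are nonempty and the first one is bounded above: some holomorphic map from the disc into D
   passes through z and w, and by the Schwarz lemma every such map yields an upper bound of the first set. *)
definition caratheodory_dist :: "complex set \<Rightarrow> complex \<Rightarrow> complex \<Rightarrow> real" where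
  "caratheodory_dist D z w =
     Sup {artanh (cmod (f w)) | f. f \<in> holo_maps D (ball 0 1) \<and> f z = 0}"

definition lempert_function :: "complex set \<Rightarrow> complex \<Rightarrow> complex \<Rightarrow> real" where
  "lempert_function D z w =
     Inf {artanh (cmod \<alpha>) | \<alpha>. \<alpha> \<in> ball 0 1 \<and>
            (\<exists>\<phi> \<in> holo_maps (ball 0 1) D. \<phi> 0 = z \<and> \<phi> \<alpha> = w)}"

end

(*
For every component C of the complement of D, the Riemann map psi of the exterior of C in the sphere
identifies D near C with a ring {r < |zeta| < 1}; call this a chart at C.  By the Schwarz lemma
c_D <= l_D, so it suffices to find, for w close to the boundary, a map f from D to the disc and a disc
in D through z and w which come within a factor 1 - e of each other.  Arguing by contradiction with
sequences, w tends to a component C0 with chart psi0, and z tends to a point q of the closure of D.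

If q lies in D or in another component C1, both quantities are compared with
ln (1 / (1 - |psi0 w|)) / 2, plus ln (1 / (1 - |psi1 z|)) / 2 in the second case.  The upper bound, up
to an additive constant, is the Hopf lemma for the Riemann map of a simply connected subdomain of D
that contains half discs touching the boundary.  The lower bound comes from psi0 if q is in D, and
otherwise, up to the factor 1 - e and an additive constant, from a quotient of powers of peak functions.

If z and w tend to the same component, then psi0 supplies f, and the covering of the ring by a strip
supplies the disc.  The two pseudohyperbolic distances are then compared explicitly.
*)
theory Submission
  imports Defs
begin

section \<open>The ratio of the two invariants\<close>

text \<open>At an isolated boundary point the statement fails: bounded holomorphic functions extend
  over it, so \<open>c_D\<close> stays bounded there while \<open>l_D\<close> blows up. Without such
  points each component of the complement has more than one point, as the Riemann map requires. The
  components may still be wild, and the Riemann maps need not extend to them, so boundary behaviour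
  is expressed by \<open>|\<psi>|\<close> tending to 1. Additive errors are harmless as long as the
  distance itself tends to infinity. They are fatal only when \<open>\<psi> z\<close> and
  \<open>\<psi> w\<close> tend to the same point of the circle in one chart; the distance may then
  tend to 0, and the explicit covering of the ring gives the sharp constants. The topological
  obstacle is the simply connected subdomain, which must contain half discs in chart coordinates. It
  is found as a component of the complement of a connected closed set containing the complement of
  \<open>D\<close>; sectors are opened in that set without disconnecting it. The peak functions
  carry an exponent below 1 because their quotient stays in the half plane only if there is angular
  room; this causes the loss of the factor 1 - e.\<close>

lemma one_minus_Moebius_norm_square:
  assumes "cmod a < 1" "cmod b < 1"
  shows "1 - (cmod (Moebius_function 0 a b))\<^sup>2
       = (1 - (cmod a)\<^sup>2) * (1 - (cmod b)\<^sup>2) / (cmod (1 - cnj a * b))\<^sup>2"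
proof -
  have "cmod (cnj a * b) < 1"
    using assms norm_mult_less[of "cnj a" 1 b 1] by simp
  then have nz: "1 - cnj a * b \<noteq> 0"
    by auto
  then have nz2: "(cmod (1 - cnj a * b))\<^sup>2 \<noteq> 0"
    by simp
  have "(cmod (1 - cnj a * b))\<^sup>2 - (cmod (b - a))\<^sup>2 = (1 - (cmod a)\<^sup>2) * (1 - (cmod b)\<^sup>2)"
    unfolding cmod_power2 by (simp add: algebra_simps power2_eq_square)
  then show ?thesis
    unfolding Moebius_function_simple norm_divide power_divide
    using nz2 by (simp add: field_simps)
qed

text \<open>\<open>(1 + t) / (1 - t)\<close> equals
  \<open>(1 + t)\<^sup>2 / (1 - t\<^sup>2)\<close>, whose numerator lies between 1 and 4. With
  \<open>artanh_le_half_ln\<close> this determines \<open>artanh t\<close> up to an additive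
  constant.\<close>

lemma artanh_ge_half_ln:
  assumes "0 \<le> t" "t < (1::real)"
  shows "ln (1 / (1 - t\<^sup>2)) / 2 \<le> artanh t"
proof -
  have "1 / (1 - t\<^sup>2) \<le> (1 + t) / (1 - t)"
  proof -
    have "1 - t\<^sup>2 = (1 - t) * (1 + t)"
      by (simp add: power2_eq_square algebra_simps)
    moreover have "1 \<le> (1 + t) * (1 + t)"
      using assms mult_mono[of 1 "1 + t" 1 "1 + t"] by simp
    ultimately show ?thesis
      using assms by (simp add: divide_simps)
  qed
  moreover have "0 < 1 / (1 - t\<^sup>2)"
    using assms by (simp add: power_less_one_iff)
  ultimately show ?thesis
    unfolding artanh_def using ln_mono by fastforce
qed

lemma artanh_le_half_ln:
  assumes "0 \<le> t" "t < (1::real)"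
  shows "artanh t \<le> ln (4 / (1 - t\<^sup>2)) / 2"
proof -
  have "1 - t\<^sup>2 = (1 - t) * (1 + t)"
    by (simp add: power2_eq_square algebra_simps)
  moreover have "(1 + t) * (1 + t) \<le> 2 * 2"
    using assms by (intro mult_mono) auto
  ultimately have "(1 + t) / (1 - t) \<le> 4 / (1 - t\<^sup>2)" "0 < (1 + t) / (1 - t)"
    using assms by (simp_all add: divide_simps)
  then show ?thesis
    unfolding artanh_def using ln_mono by fastforce
qed

text \<open>The bound \<open>\<eta>\<close> expresses that \<open>a\<close> and \<open>b\<close> do
  not approach a common point of the unit circle, so the denominator in
  \<open>one_minus_Moebius_norm_square\<close> costs only a constant. The 4 comes from
  \<open>1 - x\<^sup>2 \<le> 2 * (1 - x)\<close>, used for both points.\<close>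

lemma artanh_Moebius_ge:
  assumes ab: "cmod a < 1" "cmod b < 1" and \<eta>: "0 < \<eta>" "\<eta> \<le> cmod (1 - cnj a * b)"
  shows "ln (1 / ((1 - cmod a) * (1 - cmod b))) / 2 - ln (4 / \<eta>\<^sup>2) / 2 \<le> artanh (cmod (Moebius_function 0 a b))"
proof -
  define d where "d = (1 - cmod a) * (1 - cmod b)"
  have d: "0 < d"
    using ab by (simp add: d_def)
  define t where "t = cmod (Moebius_function 0 a b)"
  have t1: "0 \<le> t" "t < 1"
    using Moebius_function_norm_lt_1[OF ab] by (auto simp: t_def)
  have sq2: "1 - x\<^sup>2 \<le> 2 * (1 - x)" if "0 \<le> x" "x < 1" for x :: real
  proof -
    have "1 - x\<^sup>2 = (1 + x) * (1 - x)"
      by (simp add: power2_eq_square algebra_simps)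
    also have "\<dots> \<le> 2 * (1 - x)"
      using that by (intro mult_right_mono) auto
    finally show ?thesis .
  qed
  have "1 - t\<^sup>2 = (1 - (cmod a)\<^sup>2) * (1 - (cmod b)\<^sup>2) / (cmod (1 - cnj a * b))\<^sup>2"
    using one_minus_Moebius_norm_square[OF ab] by (simp add: t_def)
  also have "\<dots> \<le> 4 * d / \<eta>\<^sup>2"
  proof (rule frac_le)
    have "(1 - (cmod a)\<^sup>2) * (1 - (cmod b)\<^sup>2) \<le> (2 * (1 - cmod a)) * (2 * (1 - cmod b))"
      using ab sq2 by (intro mult_mono) (auto simp: power_le_one)
    also have "\<dots> = 4 * d"
      by (simp add: d_def algebra_simps)
    finally show "(1 - (cmod a)\<^sup>2) * (1 - (cmod b)\<^sup>2) \<le> 4 * d" .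
    show "\<eta>\<^sup>2 \<le> (cmod (1 - cnj a * b))\<^sup>2"
      using \<eta> by (intro power_mono) auto
  qed (use \<eta>(1) d in auto)
  finally have le: "1 - t\<^sup>2 \<le> 4 * d / \<eta>\<^sup>2" .
  have pos: "0 < 1 - t\<^sup>2"
    using t1 by (simp add: power_less_one_iff)
  have "1 / (4 * d / \<eta>\<^sup>2) \<le> 1 / (1 - t\<^sup>2)"
    using le pos \<eta>(1) d by (intro divide_left_mono) auto
  moreover have "0 < 1 / (4 * d / \<eta>\<^sup>2)"
    using \<eta>(1) d by simp
  ultimately have l: "ln (1 / (4 * d / \<eta>\<^sup>2)) \<le> ln (1 / (1 - t\<^sup>2))"
    by (intro ln_mono)
  have eq: "1 / (4 * d / \<eta>\<^sup>2) = (1 / d) / (4 / \<eta>\<^sup>2)"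
    by simp
  have "ln ((1 / d) / (4 / \<eta>\<^sup>2)) = ln (1 / d) - ln (4 / \<eta>\<^sup>2)"
    using \<eta>(1) d by (intro ln_divide_pos) auto
  then have "ln (1 / d) - ln (4 / \<eta>\<^sup>2) \<le> ln (1 / (1 - t\<^sup>2))"
    using l by (simp only: eq)
  then show ?thesis
    using artanh_ge_half_ln[OF t1] by (simp add: d_def t_def)
qed

lemma artanh_mono:
  assumes "0 \<le> s" "s \<le> t" "t < (1::real)"
  shows "artanh s \<le> artanh t"
proof -
  have "(1 + s) / (1 - s) \<le> (1 + t) / (1 - t)" "0 < (1 + s) / (1 - s)"
    using assms by (auto intro: frac_le)
  then show ?thesis
    unfolding artanh_def using ln_mono by fastforce
qed

text \<open>The Hopf lemma for the disc with an explicit constant: a Moebius map moves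
  \<open>f 0\<close> to 0 and the Schwarz lemma applies. Only the bound \<open>A\<close> on
  \<open>|f 0|\<close> enters, so the estimate is uniform in families of maps.\<close>

lemma Schwarz_Pick_boundary_distance:
  assumes "f holomorphic_on ball 0 1" "f ` ball 0 1 \<subseteq> ball 0 1" "cmod (f 0) \<le> A" "A < 1" "cmod t < 1"
  shows "(1 - A) * (1 - cmod t) / 2 \<le> 1 - cmod (f t)"
proof -
  define a where "a = f 0"
  define g where "g = Moebius_function 0 a \<circ> f"
  have a: "cmod a < 1"
    using assms a_def by simp
  have ft: "cmod (f x) < 1" if "cmod x < 1" for x
    using assms(2) that by (auto simp: image_subset_iff)
  have "g holomorphic_on ball 0 1"
    unfolding g_def
    by (rule holomorphic_on_compose_gen[OF assms(1) Moebius_function_holomorphic[OF a] assms(2)])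
  moreover have "cmod (g x) < 1" if "cmod x < 1" for x
    unfolding g_def using Moebius_function_norm_lt_1[OF a ft[OF that]] by simp
  moreover have "g 0 = 0"
    by (simp add: g_def a_def Moebius_function_eq_zero)
  ultimately have g: "cmod (g t) \<le> cmod t"
    using Schwarz_Lemma(1)[of g t] assms by blast
  define s where "s = g t"
  have s: "cmod s < 1"
    using g assms s_def by simp
  have "f t = Moebius_function 0 (- a) s"
    unfolding s_def g_def using Moebius_function_compose[of "- a" a "f t"] a ft[OF assms(5)] by simp
  then have "f t = (s + a) / (1 + cnj a * s)"
    by (simp add: Moebius_function_simple)
  moreover have nz: "1 + cnj a * s \<noteq> 0"
  proof
    assume "1 + cnj a * s = 0"
    then have "cmod (cnj a * s) = 1"
      by (metis add_eq_0_iff norm_minus_cancel norm_one)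
    then show False
      using norm_mult_less[of "cnj a" 1 s 1] a s by simp
  qed
  ultimately have "cmod (f t) * cmod (1 + cnj a * s) = cmod (s + a)"
    by (simp add: norm_divide)
  have P: "cmod (1 + cnj a * s) \<le> 2" "0 < cmod (1 + cnj a * s)"
    using norm_triangle_ineq[of 1 "cnj a * s"] norm_mult_less[of "cnj a" 1 s 1] a s nz by auto
  have sq: "(cmod (1 + cnj a * s))\<^sup>2 - (cmod (s + a))\<^sup>2 = (1 - (cmod a)\<^sup>2) * (1 - (cmod s)\<^sup>2)"
    unfolding cmod_power2 by (simp add: algebra_simps power2_eq_square)
  \<comment> \<open>For given moduli the quotient \<open>(s + a) / (1 + cnj a * s)\<close> is
    largest when \<open>s\<close> and \<open>a\<close> are aligned. In terms of \<open>X\<close>,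
    \<open>Y\<close>, \<open>Z\<close> below this is \<open>(X - Z) / X \<le> (Y - Z) / Y\<close>,
    which follows from \<open>X \<le> Y\<close> and \<open>0 \<le> Z\<close>.\<close>
  have "cmod (s + a) * (1 + cmod a * cmod s) \<le> (cmod s + cmod a) * cmod (1 + cnj a * s)"
  proof (rule power2_le_imp_le)
    have 1: "(cmod (s + a))\<^sup>2 = (cmod (1 + cnj a * s))\<^sup>2 - (1 - (cmod a)\<^sup>2) * (1 - (cmod s)\<^sup>2)"
      using sq by simp
    have 2: "(1 + cmod a * cmod s)\<^sup>2 - (cmod s + cmod a)\<^sup>2 = (1 - (cmod a)\<^sup>2) * (1 - (cmod s)\<^sup>2)"
      by (simp add: algebra_simps power2_eq_square)
    have 3: "cmod (1 + cnj a * s) \<le> 1 + cmod a * cmod s"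
      using norm_triangle_ineq[of 1 "cnj a * s"] by (simp add: norm_mult)
    have 4: "0 \<le> (1 - (cmod a)\<^sup>2) * (1 - (cmod s)\<^sup>2)"
      using a s by (simp add: power_le_one)
    have 5: "(cmod (1 + cnj a * s))\<^sup>2 \<le> (1 + cmod a * cmod s)\<^sup>2"
      using 3 by (intro power_mono) auto
    define X Y Z where "X = (cmod (1 + cnj a * s))\<^sup>2" and "Y = (1 + cmod a * cmod s)\<^sup>2"
      and "Z = (1 - (cmod a)\<^sup>2) * (1 - (cmod s)\<^sup>2)"
    have "(X - Z) * Y \<le> (Y - Z) * X"
      using mult_left_mono[OF 5[folded X_def Y_def] 4[folded Z_def]] by (simp add: algebra_simps)
    moreover have "(cmod (s + a))\<^sup>2 = X - Z" "(cmod s + cmod a)\<^sup>2 = Y - Z"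
      using 1 2 by (simp_all add: X_def Y_def Z_def)
    ultimately show "(cmod (s + a) * (1 + cmod a * cmod s))\<^sup>2 \<le> ((cmod s + cmod a) * cmod (1 + cnj a * s))\<^sup>2"
      unfolding power_mult_distrib X_def[symmetric] Y_def[symmetric] by simp
  qed auto
  then have "cmod (f t) * cmod (1 + cnj a * s) * (1 + cmod a * cmod s) \<le> (cmod s + cmod a) * cmod (1 + cnj a * s)"
    using \<open>cmod (f t) * cmod (1 + cnj a * s) = cmod (s + a)\<close> by simp
  then have "cmod (1 + cnj a * s) * (cmod (f t) * (1 + cmod a * cmod s)) \<le> cmod (1 + cnj a * s) * (cmod s + cmod a)"
    by (simp add: algebra_simps)
  then have "cmod (f t) * (1 + cmod a * cmod s) \<le> cmod s + cmod a"
    using P by (simp only: mult_le_cancel_left_pos)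
  then have "(1 - cmod a) * (1 - cmod s) \<le> (1 - cmod (f t)) * (1 + cmod a * cmod s)"
    by (simp add: algebra_simps)
  also have "\<dots> \<le> (1 - cmod (f t)) * 2"
    using ft[OF assms(5)] a s mult_le_one[of "cmod a" "cmod s"] by (intro mult_left_mono) auto
  finally have "(1 - cmod a) * (1 - cmod s) \<le> 2 * (1 - cmod (f t))"
    by simp
  moreover have "(1 - A) * (1 - cmod t) \<le> (1 - cmod a) * (1 - cmod s)"
    using assms g s_def a_def by (intro mult_mono) auto
  ultimately show ?thesis
    by simp
qed

text \<open>One competitor on each side gives \<open>(1 - e) * l \<le> c \<le> l\<close>. The
  hypothesis \<open>pos\<close> keeps \<open>l\<close> away from 0, where HOL would set the quotient
  to 0.\<close>

lemma ratio_near_one: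
  assumes f: "f \<in> holo_maps D (ball 0 1)" "f z = 0"
    and \<phi>: "\<phi> \<in> holo_maps (ball 0 1) D" "\<phi> 0 = z" "\<phi> \<alpha> = w" "\<alpha> \<in> ball 0 1"
    and pos: "0 < artanh (cmod (f w))"
    and le: "(1 - e) * artanh (cmod \<alpha>) \<le> artanh (cmod (f w))" and e: "0 < e" "e < 1"
  shows "\<bar>caratheodory_dist D z w / lempert_function D z w - 1\<bar> \<le> e"
proof -
  let ?C = "{artanh (cmod (f w)) | f. f \<in> holo_maps D (ball 0 1) \<and> f z = 0}"
  let ?L = "{artanh (cmod \<alpha>) | \<alpha>. \<alpha> \<in> ball 0 1 \<and>
            (\<exists>\<phi> \<in> holo_maps (ball 0 1) D. \<phi> 0 = z \<and> \<phi> \<alpha> = w)}"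
  have inL: "artanh (cmod \<alpha>) \<in> ?L"
    using \<phi> by blast
  have inC: "artanh (cmod (f w)) \<in> ?C"
    using f by blast
  have CL: "x \<le> y" if "x \<in> ?C" "y \<in> ?L" for x y
  proof -
    obtain f where f: "x = artanh (cmod (f w))" "f \<in> holo_maps D (ball 0 1)" "f z = 0"
      using \<open>x \<in> ?C\<close> by blast
    obtain \<phi> \<alpha> where \<phi>: "y = artanh (cmod \<alpha>)" "\<alpha> \<in> ball 0 1" "\<phi> \<in> holo_maps (ball 0 1) D" "\<phi> 0 = z" "\<phi> \<alpha> = w"
      using \<open>y \<in> ?L\<close> by blast
    have "f \<circ> \<phi> holomorphic_on ball 0 1"
      using f \<phi> unfolding holo_maps_def by (auto intro: holomorphic_on_compose_gen)
    moreover have "cmod ((f \<circ> \<phi>) x) < 1" if "cmod x < 1" for x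
      using f \<phi> that unfolding holo_maps_def by (auto simp: image_subset_iff)
    ultimately have "cmod ((f \<circ> \<phi>) \<alpha>) \<le> cmod \<alpha>"
      using Schwarz_Lemma(1)[of "f \<circ> \<phi>" \<alpha>] f \<phi> by auto
    then show ?thesis
      unfolding f(1) \<phi>(1) using \<phi> by (intro artanh_mono) auto
  qed
  \<comment> \<open>The given disc bounds the set under the supremum from above; in the next step
    the given function bounds the set under the infimum from below.\<close>
  have 1: "artanh (cmod (f w)) \<le> caratheodory_dist D z w"
    unfolding caratheodory_dist_def
    by (rule cSup_upper[OF inC bdd_aboveI[of _ "artanh (cmod \<alpha>)"]]) (rule CL[OF _ inL])
  have 2: "lempert_function D z w \<le> artanh (cmod \<alpha>)"
    unfolding lempert_function_def
    by (rule cInf_lower[OF inL bdd_belowI[of _ "artanh (cmod (f w))"]]) (rule CL[OF inC])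
  have 3: "caratheodory_dist D z w \<le> lempert_function D z w"
    unfolding caratheodory_dist_def lempert_function_def
    using inC inL CL by (intro cSup_least cInf_greatest) blast+
  have "(1 - e) * lempert_function D z w \<le> (1 - e) * artanh (cmod \<alpha>)"
    using 2 e by (intro mult_left_mono) auto
  with le 1 have "(1 - e) * lempert_function D z w \<le> caratheodory_dist D z w"
    by linarith
  moreover have "0 < lempert_function D z w"
    using pos 1 3 by linarith
  ultimately have "1 - e \<le> caratheodory_dist D z w / lempert_function D z w"
    "caratheodory_dist D z w / lempert_function D z w \<le> 1"
    using 3 by (auto simp: field_simps)
  then show ?thesis
    by linarith
qed

section \<open>Components of the complement\<close>

text \<open>In a splitting, the connected exterior of a large disc lies on one side, so the other
  side is compact and hence closed in the sphere. The first side together with infinity is closed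
  too, and \<open>S\<close> would be disconnected.\<close>

lemma connected_finite_part:
  assumes S: "connectedin riemann_sphere S" and None: "None \<in> S"
    and R: "- cball 0 R \<subseteq> {z::complex. Some z \<in> S}" and clS: "closed {z. Some z \<in> S}"
  shows "connected {z. Some z \<in> S}"
proof (rule ccontr)
  let ?P = "{z. Some z \<in> S}"
  assume "\<not> connected ?P"
  then obtain A B where AB: "closed A" "closed B" "A \<noteq> {}" "B \<noteq> {}" "A \<union> B = ?P" "A \<inter> B = {}"
    using clS connected_closed_set by metis
  have ext: "connected (- cball (0::complex) R)"
    by (rule connected_complement_bounded_convex) auto
  have impossible: False if AB: "closed A" "closed B" "A \<noteq> {}" "B \<noteq> {}" "A \<union> B = ?P" "A \<inter> B = {}"
    and sub: "- cball 0 R \<subseteq> A" for A B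
  proof -
    have "B \<subseteq> cball 0 R"
      using AB sub by blast
    then have compB: "compact B"
      using AB by (meson bounded_cball bounded_subset compact_eq_bounded_closed)
    have 1: "closedin riemann_sphere (Some ` B)"
      unfolding riemann_sphere_def using compB AB by simp
    have 2: "closedin riemann_sphere (insert None (Some ` A))"
      unfolding riemann_sphere_def closedin_Alexandroff_compactification
      by (rule disjI2, rule exI[of _ "- A"]) (use AB in auto)
    have "S \<subseteq> insert None (Some ` A) \<union> Some ` B"
    proof
      fix s assume s: "s \<in> S"
      show "s \<in> insert None (Some ` A) \<union> Some ` B"
        using s AB(5) by (cases s) auto
    qed
    moreover have "insert None (Some ` A) \<inter> Some ` B \<inter> S = {}"
      using AB by auto
    moreover have "insert None (Some ` A) \<inter> S \<noteq> {}" "Some ` B \<inter> S \<noteq> {}"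
      using None AB by auto
    ultimately show False
      using S 1 2 unfolding connectedin_closedin by blast
  qed
  have "- cball 0 R \<subseteq> A \<or> - cball 0 R \<subseteq> B"
  proof (rule ccontr)
    assume "\<not> (- cball 0 R \<subseteq> A \<or> - cball 0 R \<subseteq> B)"
    then have "A \<inter> - cball 0 R \<noteq> {}" "B \<inter> - cball 0 R \<noteq> {}"
      using R AB by auto
    then show False
      using ext AB R unfolding connected_closed by blast
  qed
  then show False
    using impossible[of A B] impossible[of B A] AB by (metis Un_commute Int_commute)
qed

text \<open>Each component in the plane lies in a component in the sphere. This assignment is
  injective because removing infinity leaves a sphere component connected.\<close>

lemma finite_components_complement:
  assumes "open D" "bounded D" "finitely_connected D"
  shows "finite (components (- D))"
proof -
  let ?X = "subtopology riemann_sphere (- Some ` D)"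
  let ?K = "connected_components_of ?X"
  obtain R where R: "D \<subseteq> cball 0 R"
    using bounded_subset_ballD[OF assms(2), of 0] ball_subset_cball by blast
  have clX: "closedin riemann_sphere (- Some ` D)"
    unfolding riemann_sphere_def closedin_Alexandroff_compactification
    using assms(1) by (intro disjI2 exI[of _ D]) (auto simp: UNIV_option_conv)
  have top: "topspace ?X = - Some ` D"
    unfolding riemann_sphere_def by (auto simp: UNIV_option_conv)
  have conn: "connected {z. Some z \<in> S}" if S: "S \<in> ?K" for S
  proof -
    have cS: "connectedin riemann_sphere S"
      using connectedin_connected_components_of[OF S] connectedin_subtopology by blast
    have "closedin ?X S"
      using closedin_connected_components_of[OF S] .
    then have clS: "closedin riemann_sphere S"
      using clX closedin_closed_subtopology by blast
    have "closedin euclidean {z \<in> topspace euclidean. Some z \<in> S}"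
      using closedin_continuous_map_preimage[OF continuous_map_Some] clS
      unfolding riemann_sphere_def by blast
    then have cl: "closed {z. Some z \<in> S}"
      by simp
    show ?thesis
    proof (cases "None \<in> S")
      case True
      \<comment> \<open>Infinity is a limit of the exterior of the large disc, so its component
        contains this exterior, as \<open>connected_finite_part\<close> requires.\<close>
      have "insert None (Some ` (- cball 0 R)) \<subseteq> S"
      proof (rule connected_components_of_maximal[OF S])
        have ext: "connected (- cball (0::complex) R)"
          by (rule connected_complement_bounded_convex) auto
        have "connectedin riemann_sphere (Some ` (- cball 0 R))"
          using connectedin_continuous_map_image[OF continuous_map_Some] ext
          unfolding riemann_sphere_def by (metis connectedin_iff_connected)
        moreover have "None \<in> riemann_sphere closure_of (Some ` (- cball 0 R))"
          unfolding in_closure_of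
        proof (intro conjI allI impI)
          show "None \<in> topspace riemann_sphere"
            unfolding riemann_sphere_def by simp
          fix T assume "None \<in> T \<and> openin riemann_sphere T"
          then obtain C where C: "compact C" "T = insert None (Some ` (- C))"
            unfolding riemann_sphere_def openin_Alexandroff_compactification by (auto simp: Compl_eq_Diff_UNIV)
          have "\<not> (- cball 0 R \<subseteq> C)"
          proof
            assume "- cball 0 R \<subseteq> C"
            then have "UNIV \<subseteq> C \<union> cball 0 R"
              by blast
            moreover have "bounded (C \<union> cball 0 R)"
              using C compact_imp_bounded by auto
            ultimately show False
              using bounded_subset not_bounded_UNIV by blast
          qed
          then show "\<exists>y. y \<in> Some ` (- cball 0 R) \<and> y \<in> T"
            using C by blast
        qed
        moreover have "Some ` (- cball 0 R) \<subseteq> riemann_sphere closure_of (Some ` (- cball 0 R))"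
          by (rule closure_of_subset) (auto simp: riemann_sphere_def)
        ultimately have "connectedin riemann_sphere (insert None (Some ` (- cball 0 R)))"
          by (meson connectedin_intermediate_closure_of insert_subset subset_insertI)
        then show "connectedin ?X (insert None (Some ` (- cball 0 R)))"
          using R unfolding connectedin_subtopology by auto
        show "\<not> disjnt S (insert None (Some ` (- cball 0 R)))"
          using True by (auto simp: disjnt_def)
      qed
      then show ?thesis
        using connected_finite_part[OF cS True _ cl] by blast
    next
      case False
      then have "S = Some ` {z. Some z \<in> S}"
        by (auto simp: image_iff) (metis option.exhaust)
      then have "connectedin (subtopology riemann_sphere (Some ` UNIV)) (Some ` {z. Some z \<in> S})"
        using cS unfolding connectedin_subtopology by auto
      then have "connectedin euclidean {z. Some z \<in> S}"
        using homeomorphic_map_connectedness_eq[of euclidean "subtopology riemann_sphere (Some ` UNIV)" Some "{z. Some z \<in> S}"]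
          embedding_map_Some[of "euclidean :: complex topology"]
        unfolding embedding_map_def riemann_sphere_def topspace_euclidean by blast
      then show ?thesis
        by simp
    qed
  qed
  have ex: "\<exists>S \<in> ?K. C \<subseteq> {z. Some z \<in> S}" if C: "C \<in> components (- D)" for C
  proof -
    have "connected C" "C \<subseteq> - D" "C \<noteq> {}"
      using C in_components_connected in_components_subset in_components_nonempty by blast+
    then have "connectedin riemann_sphere (Some ` C)"
      using connectedin_continuous_map_image[OF continuous_map_Some]
      unfolding riemann_sphere_def by (metis connectedin_iff_connected)
    then have "connectedin ?X (Some ` C)"
      using \<open>C \<subseteq> - D\<close> unfolding connectedin_subtopology by auto
    moreover have "?X \<noteq> trivial_topology"
    proof
      assume eq: "?X = trivial_topology"
      have "topspace ?X = {}"
        by (simp only: eq topspace_discrete_topology)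
      then have "Some ` C \<subseteq> {}"
        using top \<open>C \<subseteq> - D\<close> by blast
      then show False
        using \<open>C \<noteq> {}\<close> by blast
    qed
    ultimately obtain S where "S \<in> ?K" "Some ` C \<subseteq> S"
      using exists_connected_component_of_superset by blast
    then show ?thesis
      by blast
  qed
  then obtain s where s: "\<And>C. C \<in> components (- D) \<Longrightarrow> s C \<in> ?K \<and> C \<subseteq> {z. Some z \<in> s C}"
    by metis
  have "inj_on s (components (- D))"
  proof (rule inj_onI)
    fix A B assume A: "A \<in> components (- D)" and B: "B \<in> components (- D)" and eq: "s A = s B"
    let ?M = "{z. Some z \<in> s A}"
    have "?M \<subseteq> - D"
      using s[OF A] connected_components_of_subset top by blast
    moreover have "connected ?M"
      using conn s[OF A] by blast
    moreover have "A \<inter> ?M \<noteq> {}" "B \<inter> ?M \<noteq> {}"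
      using s[OF A] s[OF B] eq in_components_nonempty[OF A] in_components_nonempty[OF B] by auto
    ultimately have "?M \<subseteq> A" "?M \<subseteq> B"
      using components_maximal[OF A, of ?M] components_maximal[OF B, of ?M] by auto
    then show "A = B"
      using s[OF A] s[OF B] eq by auto
  qed
  moreover have "s ` components (- D) \<subseteq> ?K"
    using s by blast
  ultimately show ?thesis
    using assms(3) unfolding finitely_connected_def by (meson finite_imageD finite_subset)
qed

text \<open>The finitely many other components have a closed union, so a singleton component has a
  punctured neighbourhood inside \<open>D\<close> and is an isolated boundary point.\<close>

lemma component_not_singleton:
  fixes D :: "complex set"
  assumes D: "open D" and fin: "finite (components (- D))"
    and noiso: "\<forall>x \<in> frontier D. \<not> x isolated_in frontier D"
    and C: "C \<in> components (- D)"
  shows "C \<noteq> {a}"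
proof
  assume Ca: "C = {a}"
  define L where "L = \<Union>(components (- D) - {C})"
  have cl: "closed L"
    unfolding L_def
  proof (rule closed_Union)
    show "\<forall>T \<in> components (- D) - {C}. closed T"
      using closed_components[OF closed_Compl[OF D]] by blast
  qed (use fin in blast)
  have "a \<notin> L"
  proof
    assume "a \<in> L"
    then obtain C' where "C' \<in> components (- D)" "C' \<noteq> C" "a \<in> C'"
      unfolding L_def by blast
    then show False
      using C Ca components_nonoverlap[OF C, of C'] by auto
  qed
  then have "a \<in> - L"
    by simp
  then obtain r where r': "r > 0" "ball a r \<subseteq> - L"
    using openE[OF open_Compl[OF cl]] by metis
  then have r: "r > 0" "ball a r \<inter> L = {}"
    by auto
  have "- D = C \<union> L"
    using C Union_components[of "- D"] unfolding L_def by blast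
  then have sub: "ball a r - {a} \<subseteq> D" and a: "a \<notin> D"
    using r Ca by blast+
  have "a islimpt (ball a r - {a})"
    using islimpt_ball[of a a r] r islimpt_punctured[of a "ball a r"] by simp
  then have "a \<in> closure D"
    using sub islimpt_subset closure_def by blast
  then have af: "a \<in> frontier D"
    using a D by (simp add: frontier_def interior_open)
  have "ball a r \<inter> frontier D = {a}"
    using sub af D r(1) by (auto simp: frontier_def interior_open)
  then have "a isolated_in frontier D"
    unfolding isolated_in_def using af open_ball[of a r] by blast
  then show False
    using noiso af by blast
qed

section \<open>Charts near a boundary component\<close>

text \<open>The image of the exterior of \<open>C\<close> in the sphere under \<open>x \<mapsto> 1 / (x - a)\<close> with \<open>a \<in> C\<close>. A loop in it
  winds around \<open>1 / (c - a)\<close> equally often for all \<open>c \<in> C\<close>, and this number is zero for \<open>c\<close> close to \<open>a\<close>.\<close>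

lemma inverted_exterior:
  fixes C :: "complex set"
  assumes C: "compact C" "connected C" "connected (- C)" and a: "a \<in> C"
  defines "U \<equiv> insert 0 ((\<lambda>x. 1 / (x - a)) ` (- C))"
  shows "open U" "simply_connected U"
proof -
  let ?m = "\<lambda>x. 1 / (x - a)"
  have xa: "x \<noteq> a" if "x \<in> - C" for x
    using that a by auto
  have hol: "?m holomorphic_on - C"
    using xa by (intro holomorphic_intros) auto
  have inj: "inj_on ?m (- C)"
    using xa by (auto simp: inj_on_def)
  have open1: "open (?m ` (- C))"
    using open_mapping_thm3[OF hol _ inj] C compact_imp_closed by blast
  obtain R where R: "R > 0" "C \<subseteq> ball a R"
    using bounded_subset_ballD[OF compact_imp_bounded[OF C(1)], of a] by blast
  \<comment> \<open>Points outside \<open>ball a R\<close> are not in \<open>C\<close>, so the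
    inversion covers a punctured disc around 0.\<close>
  have U: "U = ?m ` (- C) \<union> ball 0 (1 / R)"
  proof -
    have "y \<in> ?m ` (- C)" if y: "y \<in> ball 0 (1 / R)" "y \<noteq> 0" for y
    proof
      show "y = 1 / ((a + 1 / y) - a)"
        using y by simp
      have "dist a (a + 1 / y) \<ge> R"
        using y R by (simp add: dist_norm norm_divide field_simps)
      then show "a + 1 / y \<in> - C"
        using R by auto
    qed
    then have "ball 0 (1 / R) \<subseteq> insert 0 (?m ` (- C))"
      by blast
    moreover have "0 \<in> ball (0::complex) (1 / R)"
      using R by simp
    ultimately show ?thesis
      unfolding U_def by blast
  qed
  show op: "open U"
    unfolding U using open1 by auto
  have conn: "connected U"
  proof -
    have "connected (?m ` (- C))"
      using C hol by (intro connected_continuous_image holomorphic_on_imp_continuous_on)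
    moreover have "?m ` (- C) \<inter> ball 0 (1 / R) \<noteq> {}"
    proof -
      have "1 / (2 * R) \<in> ?m ` (- C)"
      proof
        show "complex_of_real (1 / (2 * R)) = 1 / ((a + 2 * R) - a)"
          by simp
        have "dist a (a + 2 * R) \<ge> R"
          using R by (simp add: dist_norm norm_mult)
        then show "a + 2 * R \<in> - C"
          using R by auto
      qed
      moreover have "complex_of_real (1 / (2 * R)) \<in> ball 0 (1 / R)"
        using R by (simp add: norm_divide norm_mult field_simps)
      ultimately show ?thesis
        by blast
    qed
    ultimately show ?thesis
      unfolding U by (intro connected_Un) auto
  qed
  have "winding_number \<gamma> z = 0"
    if \<gamma>: "path \<gamma>" "path_image \<gamma> \<subseteq> U" "pathfinish \<gamma> = pathstart \<gamma>" and z: "z \<notin> U" for \<gamma> z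
  proof -
    have z0: "z \<noteq> 0"
      using z U_def by auto
    define c where "c = a + 1 / z"
    have ca: "c \<noteq> a" and zc: "z = ?m c"
      using z0 by (auto simp: c_def)
    have cC: "c \<in> C"
      using z zc unfolding U_def by blast
    have notU: "?m c \<notin> path_image \<gamma>" if "c \<in> C" "c \<noteq> a" for c
    proof
      assume "?m c \<in> path_image \<gamma>"
      then have "?m c \<in> U"
        using \<gamma> by blast
      moreover have "?m c \<noteq> 0"
        using that by simp
      ultimately obtain x where "x \<in> - C" "?m c = ?m x"
        unfolding U_def by blast
      then show False
        using that by simp
    qed
    \<comment> \<open>The value at \<open>a\<close> is set by hand: HOL evaluates
      \<open>1 / (a - a)\<close> to 0, which lies in \<open>U\<close> and possibly on the path. The
      value 0 makes \<open>g\<close> continuous, because \<open>1 / (c - a)\<close> leaves every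
      bounded set as \<open>c\<close> tends to \<open>a\<close>.\<close>
    define g where "g c = (if c = a then 0 else winding_number \<gamma> (?m c))" for c
    obtain B where B: "\<And>z. B \<le> norm z \<Longrightarrow> winding_number \<gamma> z = 0"
      using winding_number_zero_at_infinity[OF \<gamma>(1,3)] by blast
    have "continuous (at c within C) g" if c: "c \<in> C" for c
    proof (cases "c = a")
      case True
      show ?thesis
      proof (rule continuous_transform_within[where \<delta> = "1 / (\<bar>B\<bar> + 1)" and f = "\<lambda>_. 0"])
        fix x assume x: "x \<in> C" "dist x c < 1 / (\<bar>B\<bar> + 1)"
        show "0 = g x"
        proof (cases "x = a")
          case False
          then have "\<bar>B\<bar> + 1 \<le> norm (?m x)"
            using x True by (simp add: dist_norm norm_divide field_simps)
          then show ?thesis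
            using False B[of "?m x"] by (simp add: g_def)
        qed (simp add: g_def)
      qed (use True c in auto)
    next
      case False
      have "continuous (at (?m c)) (winding_number \<gamma>)"
        using notU[OF c False] by (intro continuous_at_winding_number \<gamma>) auto
      then have "isCont (winding_number \<gamma> \<circ> ?m) c"
        using False by (intro continuous_at_compose continuous_intros) auto
      then have "continuous (at c within C) (\<lambda>c. winding_number \<gamma> (?m c))"
        unfolding o_def by (rule continuous_at_imp_continuous_at_within)
      then show ?thesis
        by (rule continuous_transform_within[where \<delta> = "dist c a"]) (use False c in \<open>auto simp: g_def dist_commute\<close>)
    qed
    then have "continuous_on C g"
      by (simp add: continuous_on_eq_continuous_within)
    moreover have ints: "g c \<in> \<int>" if "c \<in> C" for c
      using integer_winding_number[OF \<gamma>(1,3)] notU[OF that] by (auto simp: g_def)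
    have "\<exists>e>0. \<forall>y. y \<in> C \<and> g y \<noteq> g x \<longrightarrow> e \<le> cmod (g y - g x)" if "x \<in> C" for x
    proof (intro exI[of _ 1] conjI allI impI)
      fix y assume "y \<in> C \<and> g y \<noteq> g x"
      then show "1 \<le> cmod (g y - g x)"
        using ints[of x] ints[of y] that by (auto simp: Ints_def simp flip: of_int_diff)
    qed auto
    ultimately have "g constant_on C"
      using continuous_discrete_range_constant[OF C(2)] by blast
    then have "g c = g a"
      using cC a by (metis constant_on_def)
    then show ?thesis
      using ca zc by (simp add: g_def)
  qed
  then show "simply_connected U"
    using simply_connected_eq_winding_number_zero[OF op] conn by blast
qed

text \<open>The point \<open>p\<close> is the value of \<open>\<psi>\<close> at infinity
  if \<open>C\<close> is bounded, and a point outside the disc otherwise.\<close>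

lemma exterior_Riemann_map:
  fixes C :: "complex set"
  assumes C: "closed C" "connected C" "connected (- C)" "- C \<noteq> {}"
    and ab: "a \<in> C" "b \<in> C" "a \<noteq> b" and bdd: "bounded C \<or> bounded (- C)"
  obtains \<psi> h p R e where
    "\<psi> holomorphic_on - C" "\<psi> ` (- C) \<subseteq> ball 0 1"
    "h holomorphic_on ball 0 1 - {p}" "h ` (ball 0 1 - {p}) \<subseteq> - C"
    "\<And>\<zeta>. \<zeta> \<in> ball 0 1 - {p} \<Longrightarrow> \<psi> (h \<zeta>) = \<zeta>"
    "\<And>x. x \<in> - C \<Longrightarrow> h (\<psi> x) = x \<and> \<psi> x \<noteq> p"
    "e < 1" "\<And>x. x \<in> - C \<Longrightarrow> R < cmod x \<Longrightarrow> cmod (\<psi> x) \<le> e"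
    "\<And>B. \<exists>\<delta>>0. \<forall>\<zeta> \<in> ball 0 1 - {p}. dist \<zeta> p < \<delta> \<longrightarrow> B < cmod (h \<zeta>)"
proof (cases "bounded C")
  case True
  define U where "U = insert 0 ((\<lambda>x. 1 / (x - a)) ` (- C))"
  have compC: "compact C"
    using True C compact_eq_bounded_closed by blast
  have U: "open U" "simply_connected U"
    unfolding U_def using inverted_exterior[OF compC C(2,3) ab(1)] by auto
  \<comment> \<open>The second point \<open>b\<close> of \<open>C\<close> keeps \<open>U\<close>
    from being the whole plane.\<close>
  have "1 / (b - a) \<notin> U"
    unfolding U_def using ab by auto
  then have "U \<noteq> UNIV"
    by blast
  moreover have "U \<noteq> {}"
    unfolding U_def by blast
  ultimately obtain f g where fg: "f holomorphic_on U" "g holomorphic_on ball 0 1"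
    "\<And>z. z \<in> U \<Longrightarrow> f z \<in> ball 0 1 \<and> g (f z) = z" "\<And>z. z \<in> ball 0 1 \<Longrightarrow> g z \<in> U \<and> f (g z) = z"
    using U Riemann_mapping_theorem[of U] by blast
  have mU: "1 / (x - a) \<in> U" if "x \<in> - C" for x
    using that unfolding U_def by blast
  have xa: "x \<noteq> a" if "x \<in> - C" for x
    using that ab by auto
  have 0: "0 \<in> U"
    by (simp add: U_def)
  define p where "p = f 0"
  have p: "p \<in> ball 0 1" "g p = 0"
    using fg(3)[OF 0] by (auto simp: p_def)
  have g0: "g \<zeta> \<noteq> 0" if "\<zeta> \<in> ball 0 1 - {p}" for \<zeta>
    using fg(4)[of \<zeta>] that by (auto simp: p_def)
  define \<psi> where "\<psi> x = f (1 / (x - a))" for x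
  define h where "h \<zeta> = a + 1 / g \<zeta>" for \<zeta>
  have hg: "h \<zeta> \<in> - C \<and> 1 / (h \<zeta> - a) = g \<zeta>" if "\<zeta> \<in> ball 0 1 - {p}" for \<zeta>
  proof -
    have "g \<zeta> \<in> U" "g \<zeta> \<noteq> 0"
      using fg(4)[of \<zeta>] g0[OF that] that by auto
    then obtain x where x: "x \<in> - C" "g \<zeta> = 1 / (x - a)"
      unfolding U_def by blast
    then show ?thesis
      by (auto simp: h_def)
  qed
  have "isCont f 0"
    using fg(1) U(1) 0 by (metis holomorphic_on_imp_continuous_on continuous_on_eq_continuous_at)
  then obtain d where d: "d > 0" "\<And>y. dist y 0 < d \<Longrightarrow> dist (f y) p < (1 - cmod p) / 2"
    using p unfolding p_def continuous_at_eps_delta by (metis diff_gt_0_iff_gt half_gt_zero mem_ball_0)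
  show ?thesis
  proof
    show "\<psi> holomorphic_on - C"
    proof -
      have "(\<lambda>x. 1 / (x - a)) holomorphic_on - C"
        using xa by (intro holomorphic_intros) auto
      then have "f \<circ> (\<lambda>x. 1 / (x - a)) holomorphic_on - C"
        using holomorphic_on_compose_gen[OF _ fg(1)] mU by blast
      then show ?thesis
        by (simp add: \<psi>_def[abs_def] o_def)
    qed
    show "\<psi> ` (- C) \<subseteq> ball 0 1"
      using fg(3) mU by (auto simp: \<psi>_def)
    have "g holomorphic_on ball 0 1 - {p}"
      using fg(2) holomorphic_on_subset by blast
    then show "h holomorphic_on ball 0 1 - {p}"
      unfolding h_def[abs_def] using g0 by (intro holomorphic_intros) auto
    show "h ` (ball 0 1 - {p}) \<subseteq> - C"
      using hg by blast
    show "\<psi> (h \<zeta>) = \<zeta>" if "\<zeta> \<in> ball 0 1 - {p}" for \<zeta>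
      using hg[OF that] fg(4)[of \<zeta>] that by (simp add: \<psi>_def)
    show "h (\<psi> x) = x \<and> \<psi> x \<noteq> p" if "x \<in> - C" for x
    proof
      show "h (\<psi> x) = x"
        using fg(3)[OF mU[OF that]] xa[OF that] by (simp add: \<psi>_def h_def)
      show "\<psi> x \<noteq> p"
        using fg(3)[OF mU[OF that]] xa[OF that] p by (auto simp: \<psi>_def)
    qed
    \<comment> \<open>Near infinity \<open>\<psi>\<close> is close to \<open>p\<close>, so any
      number between \<open>|p|\<close> and 1 bounds it there; the midpoint is taken.\<close>
    show "(1 + cmod p) / 2 < 1"
      using p by simp
    show "cmod (\<psi> x) \<le> (1 + cmod p) / 2" if x: "x \<in> - C" "cmod a + 1 / d < cmod x" for x
    proof -
      have "1 / d < cmod (x - a)"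
        using x norm_triangle_ineq2[of x a] by linarith
      then have "dist (1 / (x - a)) 0 < d"
        using d xa[OF x(1)] by (simp add: norm_divide field_simps)
      then have "dist (\<psi> x) p < (1 - cmod p) / 2"
        using d by (simp add: \<psi>_def)
      then show ?thesis
        using norm_triangle_ineq2[of "\<psi> x" p] by (simp add: dist_norm field_simps)
    qed
    fix B :: real
    have "isCont g p"
      using fg(2) p by (metis holomorphic_on_imp_continuous_on continuous_on_eq_continuous_at open_ball)
    then obtain d where d: "d > 0" "\<And>y. dist y p < d \<Longrightarrow> dist (g y) 0 < 1 / (cmod a + \<bar>B\<bar> + 1)"
      using p unfolding continuous_at_eps_delta
      by (metis (no_types, lifting) add_nonneg_pos abs_ge_zero add_nonneg_nonneg norm_ge_zero zero_less_divide_1_iff zero_less_one)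
    show "\<exists>\<delta>>0. \<forall>\<zeta> \<in> ball 0 1 - {p}. dist \<zeta> p < \<delta> \<longrightarrow> B < cmod (h \<zeta>)"
    proof (intro exI[of _ d] conjI ballI impI d)
      fix \<zeta> assume \<zeta>: "\<zeta> \<in> ball 0 1 - {p}" "dist \<zeta> p < d"
      have pos: "cmod a + \<bar>B\<bar> + 1 > 0"
        using norm_ge_zero[of a] by linarith
      have "cmod (g \<zeta>) < 1 / (cmod a + \<bar>B\<bar> + 1)"
        using d \<zeta> by simp
      then have "cmod a + \<bar>B\<bar> + 1 < cmod (1 / g \<zeta>)"
        using g0[OF \<zeta>(1)] pos by (simp add: norm_divide field_simps)
      also have "\<dots> \<le> cmod (h \<zeta>) + cmod a"
        using norm_triangle_ineq4[of "h \<zeta>" a] by (simp add: h_def)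
      finally show "B < cmod (h \<zeta>)"
        by linarith
    qed
  qed
next
  case False
  with bdd have b: "bounded (- C)"
    by blast
  have op: "open (- C)"
    using C by blast
  have "simply_connected (- C)"
    using simply_connected_iff_simple[OF op b] C by simp
  moreover have "- C \<noteq> UNIV"
    using ab by auto
  ultimately obtain f g where fg: "f holomorphic_on - C" "g holomorphic_on ball 0 1"
    "\<And>z. z \<in> - C \<Longrightarrow> f z \<in> ball 0 1 \<and> g (f z) = z" "\<And>z. z \<in> ball 0 1 \<Longrightarrow> g z \<in> - C \<and> f (g z) = z"
    using op C(4) Riemann_mapping_theorem[of "- C"] by blast
  obtain R where R: "- C \<subseteq> ball 0 R"
    using bounded_subset_ballD[OF b] by blast
  \<comment> \<open>In this case 2 plays the role of \<open>p\<close>: it has distance at least 1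
    from the disc, so the condition at the pole holds vacuously for radius 1. The bound near
    infinity is vacuous too, as \<open>- C\<close> is bounded.\<close>
  have far: "dist \<zeta> 2 \<ge> 1" if "\<zeta> \<in> ball 0 (1::real)" for \<zeta> :: complex
    using that norm_triangle_ineq2[of 2 \<zeta>] by (simp add: dist_norm norm_minus_commute)
  have eq: "ball 0 1 - {2::complex} = ball 0 1"
    by auto
  show ?thesis
  proof
    show "f holomorphic_on - C" "f ` (- C) \<subseteq> ball 0 1"
      using fg by auto
    show "g holomorphic_on ball 0 1 - {2}" "g ` (ball 0 1 - {2}) \<subseteq> - C"
      using fg unfolding eq by auto
    show "f (g \<zeta>) = \<zeta>" if "\<zeta> \<in> ball 0 1 - {2}" for \<zeta>
      using fg that by auto
    show "g (f x) = x \<and> f x \<noteq> 2" if "x \<in> - C" for x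
      using fg(3)[OF that] by auto
    show "(0::real) < 1"
      by simp
    show "cmod (f x) \<le> 0" if "x \<in> - C" "R < cmod x" for x
      using that R by force
    show "\<exists>\<delta>>0. \<forall>\<zeta> \<in> ball 0 1 - {2}. dist \<zeta> 2 < \<delta> \<longrightarrow> B < cmod (g \<zeta>)" for B
      using far by (intro exI[of _ 1]) force
  qed
qed

definition outer_ring :: "real \<Rightarrow> complex set" where
  "outer_ring r = {\<zeta>. r < cmod \<zeta> \<and> cmod \<zeta> < 1}"

text \<open>The last two assumptions replace boundary values: \<open>|\<psi>|\<close> tends to 1 at
  \<open>C\<close> and stays below \<open>r\<close> near every other boundary point. Limits of
  \<open>\<psi>\<close> and \<open>h\<close> themselves are not assumed, since they may fail to
  exist.\<close>

locale boundary_chart =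
  fixes D C :: "complex set" and \<psi> h :: "complex \<Rightarrow> complex" and r :: real
  assumes open_domain: "open D" and bounded_domain: "bounded D"
    and closed_C: "closed C" and connected_C: "connected C" and C_disjoint: "C \<inter> D = {}"
    and \<psi>_holomorphic: "\<psi> holomorphic_on D" and \<psi>_disc: "x \<in> D \<Longrightarrow> cmod (\<psi> x) < 1"
    and r: "0 < r" "r < 1"
    and h_holomorphic: "h holomorphic_on outer_ring r"
    and h_in: "\<zeta> \<in> outer_ring r \<Longrightarrow> h \<zeta> \<in> D"
    and \<psi>_h: "\<zeta> \<in> outer_ring r \<Longrightarrow> \<psi> (h \<zeta>) = \<zeta>"
    and h_\<psi>: "x \<in> D \<Longrightarrow> r < cmod (\<psi> x) \<Longrightarrow> h (\<psi> x) = x"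
    and near_C: "q \<in> C \<Longrightarrow> e < 1 \<Longrightarrow> \<exists>\<delta>>0. \<forall>x \<in> D \<inter> ball q \<delta>. e < cmod (\<psi> x)"
    and away_from_C: "q \<in> closure D \<Longrightarrow> q \<notin> D \<Longrightarrow> q \<notin> C \<Longrightarrow> \<exists>\<delta>>0. \<forall>x \<in> D \<inter> ball q \<delta>. cmod (\<psi> x) < r"

text \<open>An unbounded component meets the exterior of a large disc, which is connected and misses
  \<open>D\<close>, and therefore contains it.\<close>

lemma bounded_component_or_complement:
  fixes D :: "complex set"
  assumes "bounded D" "C \<in> components (- D)"
  shows "bounded C \<or> bounded (- C)"
proof (cases "bounded C")
  case False
  obtain R where R: "D \<subseteq> cball 0 R"
    using bounded_subset_ballD[OF assms(1), of 0] ball_subset_cball by blast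
  have "connected (- cball (0::complex) R)"
    by (rule connected_complement_bounded_convex) auto
  moreover have "C \<inter> - cball 0 R \<noteq> {}"
  proof
    assume "C \<inter> - cball 0 R = {}"
    then have "C \<subseteq> cball 0 R"
      by blast
    then show False
      using False bounded_subset bounded_cball by blast
  qed
  ultimately have "- cball 0 R \<subseteq> C"
    using components_maximal[OF assms(2)] R by auto
  then have "- C \<subseteq> cball 0 R"
    by blast
  then show ?thesis
    using bounded_subset bounded_cball by blast
qed auto

text \<open>The chart is the Riemann map of the exterior of \<open>C\<close>, used only at levels so
  high that neither the rest of the complement nor the pole of its inverse is met.\<close>

lemma boundary_chart_exists:
  fixes D :: "complex set"
  assumes D: "open D" "connected D" "D \<noteq> {}" "bounded D" and fin: "finite (components (- D))"
    and C: "C \<in> components (- D)" and nonsing: "\<And>a. C \<noteq> {a}"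
  obtains \<psi> h r where "boundary_chart D C \<psi> h r"
proof -
  have clD: "closed (- D)"
    using D by blast
  have clC: "closed C"
    using closed_components[OF clD C] .
  have CD: "C \<subseteq> - D" and "C \<noteq> {}" and connC: "connected C"
    using C in_components_connected in_components_subset in_components_nonempty by blast+
  obtain a where a: "a \<in> C"
    using \<open>C \<noteq> {}\<close> by blast
  obtain b where b: "b \<in> C" "a \<noteq> b"
    using nonsing[of a] a by blast
  have DC: "D \<subseteq> - C"
    using CD by blast
  have connC': "connected (- C)"
    using component_complement_connected[OF D(2) C] .
  have C': "- C \<noteq> {}"
    using DC D(3) by blast
  obtain \<psi> h p R e where H:
    "\<psi> holomorphic_on - C" "\<psi> ` (- C) \<subseteq> ball 0 1"
    "h holomorphic_on ball 0 1 - {p}" "h ` (ball 0 1 - {p}) \<subseteq> - C"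
    "\<And>\<zeta>. \<zeta> \<in> ball 0 1 - {p} \<Longrightarrow> \<psi> (h \<zeta>) = \<zeta>"
    "\<And>x. x \<in> - C \<Longrightarrow> h (\<psi> x) = x \<and> \<psi> x \<noteq> p"
    "e < 1" "\<And>x. x \<in> - C \<Longrightarrow> R < cmod x \<Longrightarrow> cmod (\<psi> x) \<le> e"
    "\<And>B. \<exists>\<delta>>0. \<forall>\<zeta> \<in> ball 0 1 - {p}. dist \<zeta> p < \<delta> \<longrightarrow> B < cmod (h \<zeta>)"
    by (rule exterior_Riemann_map[OF clC connC connC' C' a b bounded_component_or_complement[OF D(4) C]]) blast
  have disc: "cmod (\<psi> x) < 1" if "x \<in> - C" for x
    using H(2) that by auto
  have cont: "continuous_on (- C) \<psi>"
    using H(1) holomorphic_on_imp_continuous_on by blast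
  define L where "L = \<Union>(components (- D) - {C})"
  have clL: "closed L"
    unfolding L_def
  proof (rule closed_Union)
    show "\<forall>T \<in> components (- D) - {C}. closed T"
      using closed_components[OF clD] by blast
  qed (use fin in blast)
  have LC: "L \<subseteq> - C"
    unfolding L_def using components_nonoverlap[OF C] by blast
  have DCL: "- D = C \<union> L"
    using C Union_components[of "- D"] unfolding L_def by blast
  \<comment> \<open>Compactness settles the part of \<open>L\<close> in the large disc; farther out
    \<open>H(8)\<close> bounds \<open>|\<psi>|\<close> by \<open>e\<close>.\<close>
  have "\<exists>s<1. \<forall>x \<in> L \<inter> cball 0 R. cmod (\<psi> x) \<le> s"
  proof (cases "L \<inter> cball 0 R = {}")
    case False
    have "compact (L \<inter> cball 0 R)"
      using clL by (intro closed_Int_compact) auto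
    moreover have "continuous_on (L \<inter> cball 0 R) (\<lambda>x. cmod (\<psi> x))"
      using cont LC by (intro continuous_intros) (meson continuous_on_subset inf.coboundedI1)
    ultimately obtain y where "y \<in> L \<inter> cball 0 R" "\<And>x. x \<in> L \<inter> cball 0 R \<Longrightarrow> cmod (\<psi> x) \<le> cmod (\<psi> y)"
      using continuous_attains_sup[of "L \<inter> cball 0 R" "\<lambda>x. cmod (\<psi> x)"] False by blast
    then show ?thesis
      using disc[of y] LC by blast
  qed (auto intro: exI[of _ 0])
  then obtain s where s: "s < 1" "\<And>x. x \<in> L \<inter> cball 0 R \<Longrightarrow> cmod (\<psi> x) \<le> s"
    by blast
  \<comment> \<open>The inner radius must exceed \<open>s\<close> and \<open>e\<close>, so that the
    ring avoids the image of \<open>L\<close>, and \<open>|p|\<close>, so that it avoids the pole of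
    \<open>h\<close>. The latter counts only if \<open>p\<close> lies in the disc.\<close>
  define t where "t = max (max s e) (max 0 (if cmod p < 1 then cmod p else 0))"
  have "t < 1"
    using s(1) H(7) by (simp add: t_def)
  then obtain r where r: "t < r" "r < 1"
    using dense by blast
  have r0: "0 < r" "s < r" "e < r" "cmod p < 1 \<Longrightarrow> cmod p < r"
  proof -
    have "s \<le> t" "e \<le> t" "0 \<le> t" "cmod p < 1 \<Longrightarrow> cmod p \<le> t"
      by (auto simp: t_def le_max_iff_disj)
    then show "0 < r" "s < r" "e < r" "cmod p < 1 \<Longrightarrow> cmod p < r"
      using r by linarith+
  qed
  have L: "cmod (\<psi> x) < r" if "x \<in> L" for x
  proof (cases "R < cmod x")
    case True
    then show ?thesis
      using H(8)[of x] that LC r0 by force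
  next
    case False
    then show ?thesis
      using s(2)[of x] that r0 by force
  qed
  have ring: "\<zeta> \<in> ball 0 1 - {p}" if "\<zeta> \<in> outer_ring r" for \<zeta>
    using that r0 by (auto simp: outer_ring_def)
  show thesis
  proof (rule that[of \<psi> h r], unfold_locales)
    show "h holomorphic_on outer_ring r"
      using H(3) ring holomorphic_on_subset by blast
    show "h \<zeta> \<in> D" if \<zeta>: "\<zeta> \<in> outer_ring r" for \<zeta>
    proof -
      have "h \<zeta> \<notin> L"
        using L[of "h \<zeta>"] H(5)[OF ring[OF \<zeta>]] \<zeta> by (auto simp: outer_ring_def)
      moreover have "h \<zeta> \<in> - C"
        using H(4) ring[OF \<zeta>] by blast
      ultimately show ?thesis
        using DCL by blast
    qed
    show "\<psi> (h \<zeta>) = \<zeta>" if "\<zeta> \<in> outer_ring r" for \<zeta>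
      using H(5)[OF ring[OF that]] .
    show "\<psi> holomorphic_on D"
      using H(1) DC holomorphic_on_subset by blast
    show "\<exists>\<delta>>0. \<forall>x \<in> D \<inter> ball q \<delta>. cmod (\<psi> x) < r" if q: "q \<in> closure D" "q \<notin> D" "q \<notin> C" for q
    proof -
      have "q \<in> L"
        using q DCL by blast
      have "open (- C \<inter> (\<lambda>x. cmod (\<psi> x)) -` {..<r})"
        using cont clC by (intro continuous_open_preimage continuous_intros) auto
      moreover have "q \<in> - C \<inter> (\<lambda>x. cmod (\<psi> x)) -` {..<r}"
        using L[OF \<open>q \<in> L\<close>] q by auto
      ultimately obtain d where d: "d > 0" "ball q d \<subseteq> - C \<inter> (\<lambda>x. cmod (\<psi> x)) -` {..<r}"
        using openE by blast
      show ?thesis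
        using d by (intro exI[of _ d]) auto
    qed
    \<comment> \<open>Properness: if \<open>\<psi> (x n)\<close> stayed in a smaller disc, it would
      accumulate at some \<open>v\<close>, and along a subsequence
      \<open>x n = h (\<psi> (x n))\<close> would tend to \<open>h v\<close> outside
      \<open>C\<close> or, for \<open>v = p\<close>, to infinity. Both contradict the limit
      \<open>q\<close>.\<close>
    show "\<exists>\<delta>>0. \<forall>x \<in> D \<inter> ball q \<delta>. e' < cmod (\<psi> x)" if q: "q \<in> C" "e' < 1" for q e'
    proof (rule ccontr)
      assume not: "\<not> (\<exists>\<delta>>0. \<forall>x \<in> D \<inter> ball q \<delta>. e' < cmod (\<psi> x))"
      have "\<exists>x. x \<in> D \<and> dist q x < 1 / real (Suc n) \<and> cmod (\<psi> x) \<le> e'" for n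
        using not by (force simp: not_less dest: spec[of _ "1 / real (Suc n)"])
      then obtain x where x: "\<And>n. x n \<in> D" "\<And>n. dist q (x n) < 1 / real (Suc n)" "\<And>n. cmod (\<psi> (x n)) \<le> e'"
        by metis
      have "x \<longlonglongrightarrow> q"
      proof (rule metric_tendsto_imp_tendsto[OF LIMSEQ_Suc[OF lim_1_over_n]])
        show "\<forall>\<^sub>F n in sequentially. dist (x n) q \<le> dist (1 / real (Suc n)) 0"
          using x(2) by (intro always_eventually allI) (simp add: dist_commute less_imp_le)
      qed
      have "seq_compact (cball (0::complex) e')"
        by (simp add: compact_imp_seq_compact)
      then obtain v k where v: "v \<in> cball 0 e'" "strict_mono (k :: nat \<Rightarrow> nat)" "((\<lambda>n. \<psi> (x n)) \<circ> k) \<longlonglongrightarrow> v"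
        using x(3) unfolding seq_compact_def by (metis mem_cball_0)
      have v1: "v \<in> ball 0 1"
        using v q by auto
      have xk: "(x \<circ> k) \<longlonglongrightarrow> q"
        using LIMSEQ_subseq_LIMSEQ[OF \<open>x \<longlonglongrightarrow> q\<close> v(2)] .
      have hx: "h (\<psi> (x n)) = x n" "\<psi> (x n) \<in> ball 0 1 - {p}" for n
        using H(6)[of "x n"] disc[of "x n"] x(1)[of n] DC by auto
      show False
      proof (cases "v = p")
        case False
        have "isCont h v"
          using H(3) v1 False
          by (metis Diff_iff continuous_on_eq_continuous_at empty_iff finite.emptyI finite.insertI finite_imp_closed holomorphic_on_imp_continuous_on insert_iff open_Diff open_ball)
        then have "(\<lambda>n. h (((\<lambda>n. \<psi> (x n)) \<circ> k) n)) \<longlonglongrightarrow> h v"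
          using isCont_tendsto_compose v(3) by blast
        then have "(x \<circ> k) \<longlonglongrightarrow> h v"
          using hx(1) by (simp add: o_def)
        then have "h v = q"
          using xk LIMSEQ_unique by blast
        then show False
          using H(4) v1 False q by blast
      next
        case True
        obtain d where d: "d > 0" "\<And>\<zeta>. \<zeta> \<in> ball 0 1 - {p} \<Longrightarrow> dist \<zeta> p < d \<Longrightarrow> cmod q + 1 < cmod (h \<zeta>)"
          using H(9)[of "cmod q + 1"] by blast
        have "\<forall>\<^sub>F n in sequentially. dist (((\<lambda>n. \<psi> (x n)) \<circ> k) n) p < d"
          using tendstoD[OF v(3)] d(1) True by blast
        moreover have "\<forall>\<^sub>F n in sequentially. dist ((x \<circ> k) n) q < 1"
          using tendstoD[OF xk, of 1] by simp
        ultimately have "\<forall>\<^sub>F n in sequentially. False"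
        proof eventually_elim
          case (elim n)
          have "cmod q + 1 < cmod (x (k n))"
            using d(2)[OF hx(2)[of "k n"]] elim hx(1)[of "k n"] by simp
          moreover have "cmod (x (k n)) \<le> cmod q + cmod (x (k n) - q)"
            using norm_triangle_sub by blast
          ultimately show False
            using elim by (simp add: dist_norm)
        qed
        then show False
          by simp
      qed
    qed
  qed (use D clC connC CD H(6) r0 r DC disc in auto)
qed

section \<open>Simply connected subdomains\<close>

text \<open>Covering the part of \<open>- D\<close> inside a large disc by finitely many closed discs in \<open>- T\<close> and joining these to the
  exterior of the large disc by paths in \<open>- T\<close> makes the complement of \<open>D\<close> connected.\<close>

lemma connected_separator:
  fixes D :: "complex set"
  assumes D: "open D" "bounded D" and T: "compact T" "T \<subseteq> D" "connected (- T)"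
  obtains E where "closed E" "connected E" "- D \<subseteq> E" "E \<inter> T = {}"
proof -
  obtain R where R: "R > 0" "D \<subseteq> ball 0 R"
    using bounded_subset_ballD[OF D(2), of 0] by blast
  define A where "A = - ball (0::complex) R"
  have A: "closed A" "connected A" "A \<subseteq> - T"
    unfolding A_def using T R by (auto intro: connected_complement_bounded_convex)
  have b: "complex_of_real R \<in> A"
    using R by (simp add: A_def)
  have opT: "open (- T)"
    using T(1) compact_imp_closed by blast
  have pc: "path_connected (- T)"
    using connected_open_path_connected[OF opT T(3)] .
  have K: "compact (cball 0 R - D)"
    using D(1) by (intro compact_diff) auto
  have KT: "cball 0 R - D \<subseteq> - T"
    using T by blast
  have "\<exists>e. e > 0 \<and> cball x e \<subseteq> - T" if "x \<in> - T" for x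
    using opT that open_contains_cball by blast
  then obtain e where e: "\<And>x. x \<in> - T \<Longrightarrow> e x > 0 \<and> cball x (e x) \<subseteq> - T"
    by metis
  have "\<exists>g. path g \<and> path_image g \<subseteq> - T \<and> pathstart g = x \<and> pathfinish g = complex_of_real R" if "x \<in> - T" for x
    using pc that b A(3) unfolding path_connected_def by blast
  then obtain g where g: "\<And>x. x \<in> - T \<Longrightarrow> path (g x) \<and> path_image (g x) \<subseteq> - T \<and> pathstart (g x) = x \<and> pathfinish (g x) = complex_of_real R"
    by metis
  have "cball 0 R - D \<subseteq> (\<Union>x \<in> cball 0 R - D. ball x (e x))"
  proof
    fix x assume x: "x \<in> cball 0 R - D"
    then have "x \<in> ball x (e x)"
      using e[of x] KT by auto
    then show "x \<in> (\<Union>x \<in> cball 0 R - D. ball x (e x))"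
      using x by blast
  qed
  then obtain S where S: "S \<subseteq> cball 0 R - D" "finite S" "cball 0 R - D \<subseteq> (\<Union>x \<in> S. ball x (e x))"
    by (rule compactE_image[OF K open_ball])
  define P where "P x = A \<union> (path_image (g x) \<union> cball x (e x))" for x
  have P: "closed (P x)" "connected (P x)" "P x \<subseteq> - T" if "x \<in> S" for x
  proof -
    have x: "x \<in> - T"
      using that S KT by blast
    have "x \<in> path_image (g x)" "complex_of_real R \<in> path_image (g x)"
      using g[OF x] pathstart_in_path_image[of "g x"] pathfinish_in_path_image[of "g x"] by auto
    then have "connected (path_image (g x) \<union> cball x (e x))"
      using g[OF x] e[OF x] by (intro connected_Un) (auto simp: connected_path_image less_imp_le)
    then show "connected (P x)"
      unfolding P_def using A b \<open>complex_of_real R \<in> path_image (g x)\<close>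
      by (intro connected_Un[of A "path_image (g x) \<union> cball x (e x)"]) auto
    show "closed (P x)"
      unfolding P_def using A g[OF x] by (auto intro: closed_path_image)
    show "P x \<subseteq> - T"
      unfolding P_def using A g[OF x] e[OF x] by blast
  qed
  define E where "E = \<Union>(insert A (P ` S))"
  show ?thesis
  proof
    show "closed E"
      unfolding E_def using A P S(2) by (intro closed_Union) auto
    show "connected E"
      unfolding E_def
    proof (rule connected_Union)
      show "connected s" if "s \<in> insert A (P ` S)" for s
        using that A P by auto
      have "complex_of_real R \<in> \<Inter>(insert A (P ` S))"
        using b by (auto simp: P_def)
      then show "\<Inter>(insert A (P ` S)) \<noteq> {}"
        by blast
    qed
    show "- D \<subseteq> E"
    proof
      fix x assume "x \<in> - D"
      show "x \<in> E"
      proof (cases "x \<in> cball 0 R")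
        case True
        then obtain y where y: "y \<in> S" "x \<in> ball y (e y)"
          using S(3) \<open>x \<in> - D\<close> by blast
        then have "x \<in> P y"
          unfolding P_def using ball_subset_cball by blast
        then show ?thesis
          unfolding E_def using y by blast
      next
        case False
        then have "x \<in> A"
          by (simp add: A_def)
        then show ?thesis
          unfolding E_def by blast
      qed
    qed
    show "E \<inter> T = {}"
      unfolding E_def using A P by blast
  qed
qed

text \<open>A component of the complement of a connected set has a connected complement, and for a
  bounded open connected set in the plane this means simple connectedness.\<close>

lemma simply_connected_component_avoiding:
  fixes D :: "complex set"
  assumes D: "bounded D" and E: "closed E" "connected E" "- D \<subseteq> E" and X: "connected X" "X \<inter> E = {}" "x \<in> X"
  obtains G where "open G" "simply_connected G" "X \<subseteq> G" "G \<subseteq> D"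
proof
  define G where "G = connected_component_set (- E) x"
  have xE: "x \<in> - E"
    using X by blast
  have comp: "G \<in> components (- E)"
    unfolding G_def using xE by (rule componentsI)
  show op: "open G"
    unfolding G_def using E by (intro open_connected_component) auto
  show "X \<subseteq> G"
    unfolding G_def using X by (intro connected_component_maximal) auto
  show GD: "G \<subseteq> D"
    using in_components_subset[OF comp] E by blast
  have "connected (- G)"
    using component_complement_connected[OF E(2) comp] .
  then show "simply_connected G"
    using simply_connected_iff_simple[OF op bounded_subset[OF D GD]] in_components_connected[OF comp] by blast
qed

section \<open>Sectors and slit rings in polar coordinates\<close>

definition sector :: "complex \<Rightarrow> real \<Rightarrow> real \<Rightarrow> complex set" where
  "sector u k \<rho> = {\<zeta> \<in> outer_ring \<rho>. k * cmod \<zeta> < Re (\<zeta> * cnj u)}"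

text \<open>\<open>Re (\<zeta> * cnj u) / cmod \<zeta>\<close> is the cosine of the angle between
  \<open>\<zeta>\<close> and \<open>u\<close>, so this is the part of the ring at angles at least
  \<open>arccos k\<close> from \<open>u\<close>. The cosine has no branch cut, which makes open and
  closed conditions immediate; the inner circle is included because the images of slit rings must be
  closed up to \<open>C\<close>.\<close>

definition slit_ring :: "complex \<Rightarrow> real \<Rightarrow> real \<Rightarrow> complex set" where
  "slit_ring u k \<rho> = {\<zeta>. \<rho> \<le> cmod \<zeta> \<and> cmod \<zeta> < 1 \<and> Re (\<zeta> * cnj u) \<le> k * cmod \<zeta>}"

lemma unit_mult_cnj: "cmod u = 1 \<Longrightarrow> u * cnj u = 1"
  using complex_norm_square[of u] by simp

lemma connected_polar_image:
  assumes "convex A" "convex B"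
  shows "connected ((\<lambda>(t, \<theta>). complex_of_real t * u * cis \<theta>) ` (A \<times> B))"
  using assms by (intro connected_continuous_image convex_connected convex_Times) (auto intro!: continuous_intros simp: case_prod_beta)

lemma polar_form:
  assumes "cmod u = 1" "\<zeta> * cnj u = of_real (cmod \<zeta>) * cis \<theta>"
  shows "\<zeta> = of_real (cmod \<zeta>) * u * cis \<theta>" "Re (\<zeta> * cnj u) = cmod \<zeta> * cos \<theta>"
proof -
  have "cnj u * u = 1"
    using unit_mult_cnj[OF assms(1)] by (simp add: mult.commute)
  then have "\<zeta> = \<zeta> * cnj u * u"
    by (simp add: mult.assoc)
  then show "\<zeta> = of_real (cmod \<zeta>) * u * cis \<theta>"
    unfolding assms(2) by (simp add: ac_simps)
  show "Re (\<zeta> * cnj u) = cmod \<zeta> * cos \<theta>"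
    unfolding assms(2) by simp
qed

lemma Re_polar:
  assumes "cmod u = 1"
  shows "Re (of_real t * u * cis \<theta> * cnj u) = t * cos \<theta>"
proof -
  have "of_real t * u * cis \<theta> * cnj u = (u * cnj u) * (of_real t * cis \<theta>)"
    by (simp only: ac_simps)
  then have eq: "of_real t * u * cis \<theta> * cnj u = of_real t * cis \<theta>"
    by (simp only: unit_mult_cnj[OF assms] mult_1)
  show ?thesis
    unfolding eq by simp
qed

lemma connected_sector:
  assumes "cmod u = 1" "\<bar>k\<bar> < 1" "0 < \<rho>"
  shows "connected (sector u k \<rho>)"
proof -
  define s where "s = arccos k"
  have s: "0 < s" "s < pi" "cos s = k"
    using assms(2) arccos_lt_bounded[of k] by (auto simp: s_def)
  have "sector u k \<rho> = (\<lambda>(t, \<theta>). of_real t * u * cis \<theta>) ` ({\<rho><..<1} \<times> {-s<..<s})"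
  proof (intro equalityI subsetI)
    fix \<zeta> assume \<zeta>: "\<zeta> \<in> sector u k \<rho>"
    define \<theta> where "\<theta> = Arg (\<zeta> * cnj u)"
    have "\<zeta> * cnj u = of_real (cmod \<zeta>) * cis \<theta>"
      using Arg_eq[of "\<zeta> * cnj u"] assms(1) norm_eq_zero[of u]
      by (cases "\<zeta> = 0") (auto simp: \<theta>_def norm_mult cis_conv_exp)
    note p = polar_form[OF assms(1) this]
    have "cmod \<zeta> > 0"
      using \<zeta> assms(3) by (auto simp: sector_def outer_ring_def)
    then have "k < cos \<bar>\<theta>\<bar>"
      using \<zeta> p(2) by (simp add: sector_def mult.commute)
    moreover have "\<bar>\<theta>\<bar> \<le> pi"
      unfolding \<theta>_def using mpi_less_Arg[of "\<zeta> * cnj u"] Arg_le_pi[of "\<zeta> * cnj u"] by linarith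
    ultimately have "\<bar>\<theta>\<bar> < s"
      using s cos_monotone_0_pi_le[of s "\<bar>\<theta>\<bar>"] by linarith
    then have "(cmod \<zeta>, \<theta>) \<in> {\<rho><..<1} \<times> {-s<..<s}"
      using \<zeta> by (auto simp: sector_def outer_ring_def)
    then show "\<zeta> \<in> (\<lambda>(t, \<theta>). of_real t * u * cis \<theta>) ` ({\<rho><..<1} \<times> {-s<..<s})"
      using p(1) by (intro rev_image_eqI[of "(cmod \<zeta>, \<theta>)"]) auto
  next
    fix \<zeta> assume "\<zeta> \<in> (\<lambda>(t, \<theta>). of_real t * u * cis \<theta>) ` ({\<rho><..<1} \<times> {-s<..<s})"
    then obtain t \<theta> where t': "\<rho> < t" "t < 1" "- s < \<theta>" "\<theta> < s" "\<zeta> = of_real t * u * cis \<theta>"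
      by auto
    then have t: "\<rho> < t" "t < 1" "\<bar>\<theta>\<bar> < s" "\<zeta> = of_real t * u * cis \<theta>"
      by (auto simp: abs_less_iff)
    have "cos s < cos \<bar>\<theta>\<bar>"
      using t s by (intro cos_monotone_0_pi) auto
    then have "k * t < t * cos \<theta>"
      using t s assms(3) by (simp add: mult.commute)
    then show "\<zeta> \<in> sector u k \<rho>"
      using t assms Re_polar[OF assms(1), of t \<theta>] by (simp add: sector_def outer_ring_def norm_mult)
  qed
  then show ?thesis
    by (simp add: connected_polar_image)
qed

lemma connected_slit_ring:
  assumes "cmod u = 1" "\<bar>k\<bar> < 1" "0 < \<rho>"
  shows "connected (slit_ring u k \<rho>)"
proof -
  define s where "s = arccos k"
  have s: "0 < s" "s < pi" "cos s = k"
    using assms(2) arccos_lt_bounded[of k] by (auto simp: s_def)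
  have cos: "cos \<theta> \<le> k \<longleftrightarrow> s \<le> \<theta> \<and> \<theta> \<le> 2 * pi - s" if "0 \<le> \<theta>" "\<theta> \<le> 2 * pi" for \<theta>
  proof (cases "\<theta> \<le> pi")
    case True
    then show ?thesis
      using cos_mono_le_eq[of \<theta> s] s that by auto
  next
    case False
    have "cos \<theta> = cos (2 * pi - \<theta>)"
      by simp
    then show ?thesis
      using cos_mono_le_eq[of "2 * pi - \<theta>" s] s that False by auto
  qed
  have "slit_ring u k \<rho> = (\<lambda>(t, \<theta>). of_real t * u * cis \<theta>) ` ({\<rho>..<1} \<times> {s..2 * pi - s})"
  proof (intro equalityI subsetI)
    fix \<zeta> assume \<zeta>: "\<zeta> \<in> slit_ring u k \<rho>"
    \<comment> \<open>\<open>Arg2pi\<close> rather than \<open>Arg\<close>: the angles of the slit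
      ring form one interval around pi, which the cut of \<open>Arg\<close> would split.\<close>
    define \<theta> where "\<theta> = Arg2pi (\<zeta> * cnj u)"
    have "\<zeta> * cnj u = of_real (cmod \<zeta>) * cis \<theta>"
      using Arg2pi_eq[of "\<zeta> * cnj u"] assms(1) by (simp add: \<theta>_def norm_mult cis_conv_exp)
    note p = polar_form[OF assms(1) this]
    have "cmod \<zeta> > 0"
      using \<zeta> assms(3) by (auto simp: slit_ring_def)
    then have "cos \<theta> \<le> k"
      using \<zeta> p(2) by (simp add: slit_ring_def mult.commute)
    then have "(cmod \<zeta>, \<theta>) \<in> {\<rho>..<1} \<times> {s..2 * pi - s}"
      using \<zeta> cos[of \<theta>] Arg2pi[of "\<zeta> * cnj u"] by (auto simp: slit_ring_def \<theta>_def)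
    then show "\<zeta> \<in> (\<lambda>(t, \<theta>). of_real t * u * cis \<theta>) ` ({\<rho>..<1} \<times> {s..2 * pi - s})"
      using p(1) by (intro rev_image_eqI[of "(cmod \<zeta>, \<theta>)"]) auto
  next
    fix \<zeta> assume "\<zeta> \<in> (\<lambda>(t, \<theta>). of_real t * u * cis \<theta>) ` ({\<rho>..<1} \<times> {s..2 * pi - s})"
    then obtain t \<theta> where t: "\<rho> \<le> t" "t < 1" "s \<le> \<theta>" "\<theta> \<le> 2 * pi - s" "\<zeta> = of_real t * u * cis \<theta>"
      by auto
    have "cos \<theta> \<le> k"
      using t s cos[of \<theta>] by auto
    then have "t * cos \<theta> \<le> k * t"
      using t assms(3) by (simp add: mult.commute)
    then show "\<zeta> \<in> slit_ring u k \<rho>"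
      using t assms Re_polar[OF assms(1), of t \<theta>] by (simp add: slit_ring_def norm_mult)
  qed
  then show ?thesis
    by (simp add: connected_polar_image)
qed

lemma sector_contains_half_disc:
  assumes "cmod u = 1" "k < 1" "\<rho> < 1"
  obtains \<delta> where "\<delta> > 0" "ball u \<delta> \<inter> ball 0 1 \<subseteq> sector u k \<rho>"
proof -
  have "open {\<zeta>. \<rho> < cmod \<zeta> \<and> k * cmod \<zeta> < Re (\<zeta> * cnj u)}"
    by (intro open_Collect_conj open_Collect_less continuous_intros)
  moreover have "u \<in> {\<zeta>. \<rho> < cmod \<zeta> \<and> k * cmod \<zeta> < Re (\<zeta> * cnj u)}"
    using assms unit_mult_cnj[OF assms(1)] by (simp del: times_complex.sel)
  ultimately obtain \<delta> where "\<delta> > 0" "ball u \<delta> \<subseteq> {\<zeta>. \<rho> < cmod \<zeta> \<and> k * cmod \<zeta> < Re (\<zeta> * cnj u)}"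
    using openE by blast
  then show thesis
    by (intro that[of \<delta>]) (auto simp: sector_def outer_ring_def)
qed

section \<open>Images of sectors and slit rings in the domain\<close>

context boundary_chart
begin

lemma \<psi>_continuous: "continuous_on D \<psi>"
  using \<psi>_holomorphic holomorphic_on_imp_continuous_on by blast

lemma h_continuous: "continuous_on (outer_ring r) h"
  using h_holomorphic holomorphic_on_imp_continuous_on by blast

text \<open>At points of \<open>D\<close> this is continuity. A limit point outside \<open>D\<close>
  lies in \<open>C\<close>, since near all other boundary points \<open>|\<psi>|\<close> is below
  \<open>r\<close>.\<close>

lemma closed_level_part:
  assumes S: "closed S" and \<rho>: "r \<le> \<rho>"
  shows "closed (C \<union> {x \<in> D. \<rho> \<le> cmod (\<psi> x) \<and> \<psi> x \<in> S})"
proof -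
  let ?F = "{x \<in> D. \<rho> \<le> cmod (\<psi> x) \<and> \<psi> x \<in> S}"
  have "closed ({\<zeta>. \<rho> \<le> cmod \<zeta>} \<inter> S)"
    using S by (intro closed_Int closed_Collect_le continuous_intros)
  then have "closedin (top_of_set D) (D \<inter> \<psi> -` ({\<zeta>. \<rho> \<le> cmod \<zeta>} \<inter> S))"
    using continuous_closedin_preimage[OF \<psi>_continuous] by blast
  moreover have "D \<inter> \<psi> -` ({\<zeta>. \<rho> \<le> cmod \<zeta>} \<inter> S) = ?F"
    by auto
  ultimately obtain T where T: "closed T" "?F = D \<inter> T"
    unfolding closedin_closed by auto
  have "q \<in> C \<union> ?F" if q: "q \<in> closure ?F" for q
  proof (cases "q \<in> D")
    case True
    have "closure ?F \<subseteq> T"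
      using T by (intro closure_minimal) auto
    then show ?thesis
      using q True T by blast
  next
    case False
    have qD: "q \<in> closure D"
      using q closure_mono[of ?F D] by blast
    show ?thesis
    proof (rule ccontr)
      assume "q \<notin> C \<union> ?F"
      then obtain \<delta> where \<delta>: "\<delta> > 0" "\<And>x. x \<in> D \<inter> ball q \<delta> \<Longrightarrow> cmod (\<psi> x) < r"
        using away_from_C[OF qD False] by blast
      obtain y where y: "y \<in> ?F" "dist y q < \<delta>"
        using q \<delta>(1) closure_approachable[of q ?F] by blast
      then show False
        using \<delta>(2)[of y] \<rho> by (simp add: dist_commute)
    qed
  qed
  then have "closure ?F \<subseteq> C \<union> ?F"
    by blast
  then have "closure (C \<union> ?F) \<subseteq> C \<union> ?F"
    using closed_C by (simp add: closure_Un closure_closed)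
  then show ?thesis
    using closure_subset_eq by blast
qed

text \<open>A converse of \<open>near_C\<close> along sequences: elsewhere \<open>|\<psi>|\<close>
  stays away from 1, by continuity inside \<open>D\<close> and by \<open>away_from_C\<close> at the
  other components.\<close>

lemma limit_in_C:
  assumes x: "\<And>n. x n \<in> D" "x \<longlonglongrightarrow> q" and lim: "(\<lambda>n. cmod (\<psi> (x n))) \<longlonglongrightarrow> 1"
  shows "q \<in> C"
proof (rule ccontr)
  assume "q \<notin> C"
  have qD: "q \<in> closure D"
    using x closure_sequential by blast
  show False
  proof (cases "q \<in> D")
    case True
    then have "isCont \<psi> q"
      using \<psi>_continuous open_domain continuous_on_eq_continuous_at by blast
    then have "(\<lambda>n. cmod (\<psi> (x n))) \<longlonglongrightarrow> cmod (\<psi> q)"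
      using tendsto_norm[OF isCont_tendsto_compose[OF _ x(2)]] by blast
    then have "cmod (\<psi> q) = 1"
      using lim LIMSEQ_unique by blast
    then show False
      using \<psi>_disc[OF True] by simp
  next
    case False
    then obtain \<delta> where \<delta>: "\<delta> > 0" "\<And>x. x \<in> D \<inter> ball q \<delta> \<Longrightarrow> cmod (\<psi> x) < r"
      using away_from_C[OF qD False \<open>q \<notin> C\<close>] by blast
    have "\<forall>\<^sub>F n in sequentially. dist (x n) q < \<delta>"
      using tendstoD[OF x(2) \<delta>(1)] .
    moreover have "\<forall>\<^sub>F n in sequentially. r < cmod (\<psi> (x n))"
      using order_tendstoD(1)[OF lim r(2)] .
    ultimately have "\<forall>\<^sub>F n in sequentially. False"
    proof eventually_elim
      case (elim n)
      then show False
        using \<delta>(2)[of "x n"] x(1)[of n] by (simp add: dist_commute)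
    qed
    then show False
      by simp
  qed
qed

text \<open>The form as an image yields connectedness, the form as a level set yields closedness
  through \<open>closed_level_part\<close>.\<close>

lemma image_slit_ring:
  assumes "r < \<rho>"
  shows "h ` slit_ring u k \<rho> = {x \<in> D. \<rho> \<le> cmod (\<psi> x) \<and> \<psi> x \<in> {\<zeta>. Re (\<zeta> * cnj u) \<le> k * cmod \<zeta>}}"
proof (intro equalityI subsetI)
  fix x assume "x \<in> h ` slit_ring u k \<rho>"
  then obtain \<zeta> where \<zeta>: "\<zeta> \<in> slit_ring u k \<rho>" "x = h \<zeta>"
    by blast
  then have "\<zeta> \<in> outer_ring r"
    using assms by (auto simp: slit_ring_def outer_ring_def)
  then show "x \<in> {x \<in> D. \<rho> \<le> cmod (\<psi> x) \<and> \<psi> x \<in> {\<zeta>. Re (\<zeta> * cnj u) \<le> k * cmod \<zeta>}}"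
    using h_in \<psi>_h \<zeta> by (simp add: slit_ring_def)
next
  fix x assume x: "x \<in> {x \<in> D. \<rho> \<le> cmod (\<psi> x) \<and> \<psi> x \<in> {\<zeta>. Re (\<zeta> * cnj u) \<le> k * cmod \<zeta>}}"
  then have "x = h (\<psi> x)"
    using h_\<psi> assms by force
  moreover have "\<psi> x \<in> slit_ring u k \<rho>"
    using x \<psi>_disc by (simp add: slit_ring_def)
  ultimately show "x \<in> h ` slit_ring u k \<rho>"
    by blast
qed

lemma image_sector:
  assumes "r \<le> \<rho>"
  shows "h ` sector u k \<rho> = {x \<in> D. \<rho> < cmod (\<psi> x) \<and> k * cmod (\<psi> x) < Re (\<psi> x * cnj u)}"
proof (intro equalityI subsetI)
  fix x assume "x \<in> h ` sector u k \<rho>"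
  then obtain \<zeta> where \<zeta>: "\<zeta> \<in> sector u k \<rho>" "x = h \<zeta>"
    by blast
  then have "\<zeta> \<in> outer_ring r"
    using assms by (auto simp: sector_def outer_ring_def)
  then show "x \<in> {x \<in> D. \<rho> < cmod (\<psi> x) \<and> k * cmod (\<psi> x) < Re (\<psi> x * cnj u)}"
    using h_in \<psi>_h \<zeta> by (simp add: sector_def outer_ring_def)
next
  fix x assume x: "x \<in> {x \<in> D. \<rho> < cmod (\<psi> x) \<and> k * cmod (\<psi> x) < Re (\<psi> x * cnj u)}"
  then have "x = h (\<psi> x)"
    using h_\<psi> assms by force
  moreover have "\<psi> x \<in> sector u k \<rho>"
    using x \<psi>_disc by (simp add: sector_def outer_ring_def)
  ultimately show "x \<in> h ` sector u k \<rho>"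
    by blast
qed

lemma open_image_sector:
  assumes "r \<le> \<rho>"
  shows "open (h ` sector u k \<rho>)"
proof -
  have "open {\<zeta>. \<rho> < cmod \<zeta> \<and> k * cmod \<zeta> < Re (\<zeta> * cnj u)}"
    by (intro open_Collect_conj open_Collect_less continuous_intros)
  then have "open (D \<inter> \<psi> -` {\<zeta>. \<rho> < cmod \<zeta> \<and> k * cmod \<zeta> < Re (\<zeta> * cnj u)})"
    using continuous_open_preimage[OF \<psi>_continuous open_domain] by blast
  moreover have "D \<inter> \<psi> -` {\<zeta>. \<rho> < cmod \<zeta> \<and> k * cmod \<zeta> < Re (\<zeta> * cnj u)} = h ` sector u k \<rho>"
    unfolding image_sector[OF assms] by auto
  ultimately show ?thesis
    by simp
qed

lemma closure_slit_ring_meets_C: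
  assumes u: "cmod u = 1" and k: "\<bar>k\<bar> < 1" and \<rho>: "r < \<rho>" "\<rho> < 1"
  shows "C \<inter> closure (h ` slit_ring u k \<rho>) \<noteq> {}"
proof -
  define t where "t n = 1 - (1 - \<rho>) / real (Suc n)" for n
  have t: "\<rho> \<le> t n" "t n < 1" for n
  proof -
    have "(1 - \<rho>) / real (Suc n) \<le> (1 - \<rho>) / 1"
      using \<rho> by (intro divide_left_mono) auto
    then show "\<rho> \<le> t n"
      by (simp add: t_def)
    have "0 < (1 - \<rho>) / real (Suc n)"
      using \<rho> by (intro divide_pos_pos) auto
    then show "t n < 1"
      by (simp add: t_def)
  qed
  have t1: "t \<longlonglongrightarrow> 1"
  proof -
    have "(\<lambda>n. 1 - (1 - \<rho>) * (1 / real (Suc n))) \<longlonglongrightarrow> 1 - (1 - \<rho>) * 0"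
      by (intro tendsto_intros LIMSEQ_Suc[OF lim_1_over_n])
    then show ?thesis
      by (simp add: t_def[abs_def])
  qed
  \<comment> \<open>The radius opposite to \<open>u\<close> lies in the slit ring because
    \<open>k > -1\<close>, and the image of its end accumulates at \<open>C\<close>.\<close>
  define \<zeta> where "\<zeta> n = - (of_real (t n) * u)" for n
  have tpos: "0 < t n" for n
    using t(1)[of n] \<rho> r by linarith
  have mod: "cmod (\<zeta> n) = t n" for n
    using u tpos[of n] by (simp add: \<zeta>_def norm_mult)
  have slit: "\<zeta> n \<in> slit_ring u k \<rho>" for n
  proof -
    have "\<zeta> n * cnj u = - (of_real (t n) * (u * cnj u))"
      by (simp add: \<zeta>_def)
    then have "Re (\<zeta> n * cnj u) = - t n"
      unfolding unit_mult_cnj[OF u] by simp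
    moreover have "- t n \<le> k * t n"
      using mult_right_mono[of "-1" k "t n"] k tpos[of n] by simp
    ultimately show ?thesis
      using t mod by (simp add: slit_ring_def)
  qed
  have ring: "\<zeta> n \<in> outer_ring r" for n
    using t[of n] \<rho> by (simp add: outer_ring_def mod)
  have inD: "h (\<zeta> n) \<in> D" for n
    using h_in[OF ring] .
  have "compact (closure D)"
    using bounded_domain by simp
  then obtain q s where q: "strict_mono (s :: nat \<Rightarrow> nat)" "((\<lambda>n. h (\<zeta> n)) \<circ> s) \<longlonglongrightarrow> q"
    using inD closure_subset compact_imp_seq_compact unfolding seq_compact_def by (metis (no_types, lifting) subsetD)
  have "(t \<circ> s) \<longlonglongrightarrow> 1"
    using LIMSEQ_subseq_LIMSEQ[OF t1 q(1)] .
  then have "(\<lambda>n. cmod (\<psi> (((\<lambda>n. h (\<zeta> n)) \<circ> s) n))) \<longlonglongrightarrow> 1"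
    using \<psi>_h[OF ring] by (simp add: mod o_def)
  then have "q \<in> C"
    using limit_in_C[OF _ q(2)] inD by simp
  moreover have "q \<in> closure (h ` slit_ring u k \<rho>)"
    unfolding closure_sequential using q(2) slit by (intro exI[of _ "(\<lambda>n. h (\<zeta> n)) \<circ> s"]) auto
  ultimately show ?thesis
    by blast
qed

text \<open>The image of the slit ring accumulates at \<open>C\<close>. Their union is the piece
  that holds a separator together after a sector has been removed.\<close>

lemma connected_C_Un_slit_ring:
  assumes u: "cmod u = 1" and k: "\<bar>k\<bar> < 1" and \<rho>: "r < \<rho>" "\<rho> < 1"
  shows "connected (C \<union> h ` slit_ring u k \<rho>)"
proof -
  let ?F = "h ` slit_ring u k \<rho>"
  have "continuous_on (slit_ring u k \<rho>) h"
    using h_continuous by (rule continuous_on_subset) (use \<rho> in \<open>auto simp: slit_ring_def outer_ring_def\<close>)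
  then have F: "connected ?F"
    using connected_continuous_image connected_slit_ring[OF u k] r \<rho> by fastforce
  obtain q where q: "q \<in> C" "q \<in> closure ?F"
    using closure_slit_ring_meets_C[OF assms] by blast
  have "connected (insert q ?F)"
    using q(2) closure_subset[of ?F] by (intro connected_intermediate_closure[OF F]) auto
  then have "connected (C \<union> insert q ?F)"
    using q connected_C by (intro connected_Un) auto
  moreover have "C \<union> insert q ?F = C \<union> ?F"
    using q by blast
  ultimately show ?thesis
    by simp
qed

text \<open>Opens a sector at \<open>u\<close>, which reaches the boundary, in a connected set \<open>E\<close> that already avoids a radial segment.
  The pieces of \<open>E\<close> that are cut off in this way are reconnected through the rest of the ring.\<close>

lemma open_sector_in_separator:
  assumes E: "closed E" "connected E" "- D \<subseteq> E" and u: "cmod u = 1"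
    and \<rho>: "r < \<rho>1" "\<rho>1 < \<rho>2" "\<rho>2 < \<rho>3" "\<rho>3 < 1"
    and ray: "\<And>t. \<rho>1 \<le> t \<Longrightarrow> t \<le> \<rho>3 \<Longrightarrow> h (of_real t * u) \<notin> E"
  obtains k E' where "\<bar>k\<bar> < 1" "closed E'" "connected E'" "- D \<subseteq> E'"
    "E' \<inter> h ` sector u k \<rho>1 = {}" "E' \<subseteq> E \<union> {x \<in> D. \<rho>2 \<le> cmod (\<psi> x)}"
proof -
  define A where "A = {\<zeta>. \<rho>1 \<le> cmod \<zeta> \<and> cmod \<zeta> \<le> \<rho>3}"
  have Aring: "A \<subseteq> outer_ring r"
    using \<rho> by (auto simp: A_def outer_ring_def)
  have "closed A"
    unfolding A_def by (intro closed_Collect_conj closed_Collect_le continuous_intros)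
  moreover have "bounded A"
    by (rule bounded_subset[OF bounded_cball[of 0 \<rho>3]]) (auto simp: A_def)
  ultimately have compA: "compact A"
    using compact_eq_bounded_closed by blast
  have contA: "continuous_on A h"
    using h_continuous Aring continuous_on_subset by blast
  \<comment> \<open>\<open>Z\<close> is where \<open>E\<close> meets the closed annulus of levels
    \<open>\<rho>1\<close> to \<open>\<rho>3\<close>. It is compact and misses the ray, so its
    angles to \<open>u\<close> are bounded away from 0; \<open>k\<close> is chosen so that the
    sector misses it.\<close>
  define Z where "Z = A \<inter> h -` E"
  have "closed Z"
    unfolding Z_def using continuous_closed_preimage[OF contA \<open>closed A\<close> E(1)] .
  then have compZ: "compact Z"
    unfolding Z_def using compact_Int_closed[OF compA] by (metis Int_absorb1 Int_lower1)
  have nz: "cmod \<zeta> > 0" if "\<zeta> \<in> A" for \<zeta>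
    using that \<rho> r by (auto simp: A_def)
  have Zlt: "Re (\<zeta> * cnj u) / cmod \<zeta> < 1" if \<zeta>: "\<zeta> \<in> Z" for \<zeta>
  proof (rule ccontr)
    assume not: "\<not> ?thesis"
    have \<zeta>A: "\<zeta> \<in> A"
      using \<zeta> Z_def by blast
    have "cmod (\<zeta> * cnj u) = cmod \<zeta>"
      using u by (simp add: norm_mult)
    then have "Re (\<zeta> * cnj u) = cmod (\<zeta> * cnj u)"
      using not complex_Re_le_cmod[of "\<zeta> * cnj u"] nz[OF \<zeta>A] by (auto simp add: field_simps)
    moreover from this have "Im (\<zeta> * cnj u) = 0"
      using cmod_power2[of "\<zeta> * cnj u"] by simp
    ultimately have "\<zeta> * cnj u = of_real (cmod (\<zeta> * cnj u))"
      by (intro complex_eqI) simp_all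
    then have "\<zeta> * cnj u = of_real (cmod \<zeta>)"
      using \<open>cmod (\<zeta> * cnj u) = cmod \<zeta>\<close> by simp
    then have "\<zeta> * (u * cnj u) = of_real (cmod \<zeta>) * u"
      by (metis mult.assoc mult.commute)
    then have "\<zeta> = of_real (cmod \<zeta>) * u"
      unfolding unit_mult_cnj[OF u] by simp
    then show False
      using ray[of "cmod \<zeta>"] \<zeta> by (simp add: Z_def A_def)
  qed
  have "\<exists>m<1. \<forall>\<zeta> \<in> Z. Re (\<zeta> * cnj u) / cmod \<zeta> \<le> m"
  proof (cases "Z = {}")
    case False
    have "continuous_on Z (\<lambda>\<zeta>. Re (\<zeta> * cnj u) / cmod \<zeta>)"
      using nz by (intro continuous_intros) (auto simp: Z_def)
    then obtain y where "y \<in> Z" "\<And>\<zeta>. \<zeta> \<in> Z \<Longrightarrow> Re (\<zeta> * cnj u) / cmod \<zeta> \<le> Re (y * cnj u) / cmod y"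
      using continuous_attains_sup[OF compZ False] by blast
    then show ?thesis
      using Zlt by blast
  qed (auto intro: exI[of _ 0])
  then obtain m where m: "m < 1" "\<And>\<zeta>. \<zeta> \<in> Z \<Longrightarrow> Re (\<zeta> * cnj u) / cmod \<zeta> \<le> m"
    by blast
  obtain k where k: "max m 0 < k" "k < 1"
    using dense[of "max m 0" 1] m(1) by auto
  have k1: "\<bar>k\<bar> < 1"
    using k by auto
  have Z: "Re (\<zeta> * cnj u) < k * cmod \<zeta>" if "\<zeta> \<in> Z" for \<zeta>
  proof -
    have "Re (\<zeta> * cnj u) / cmod \<zeta> < k"
      using m(2)[OF that] k by linarith
    then show ?thesis
      using nz[of \<zeta>] that by (simp add: Z_def field_simps)
  qed
  define F where "F = h ` slit_ring u k \<rho>2"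
  define W where "W = h ` sector u k \<rho>1"
  have r2: "r < \<rho>2" "\<rho>2 < 1" "r \<le> \<rho>1"
    using \<rho> by auto
  have Feq: "F = {x \<in> D. \<rho>2 \<le> cmod (\<psi> x) \<and> \<psi> x \<in> {\<zeta>. Re (\<zeta> * cnj u) \<le> k * cmod \<zeta>}}"
    unfolding F_def using image_slit_ring[OF r2(1)] .
  have Weq: "W = {x \<in> D. \<rho>1 < cmod (\<psi> x) \<and> k * cmod (\<psi> x) < Re (\<psi> x * cnj u)}"
    unfolding W_def using image_sector[OF r2(3)] .
  have clS: "closed {\<zeta>. Re (\<zeta> * cnj u) \<le> k * cmod \<zeta>}" "closed {\<zeta>. k * cmod \<zeta> \<le> Re (\<zeta> * cnj u)}"
    by (intro closed_Collect_le continuous_intros)+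
  have clFC: "closed (C \<union> F)"
    unfolding Feq using closed_level_part[OF clS(1)] r2 by simp
  \<comment> \<open>\<open>V\<close> contains whatever \<open>E\<close> loses: the sector misses
    \<open>Z\<close>, so \<open>E \<inter> W\<close> lies at levels at least
    \<open>\<rho>3\<close>.\<close>
  define V where "V = C \<union> {x \<in> D. \<rho>3 \<le> cmod (\<psi> x) \<and> \<psi> x \<in> {\<zeta>. k * cmod \<zeta> \<le> Re (\<zeta> * cnj u)}}"
  have clV: "closed V"
    unfolding V_def using closed_level_part[OF clS(2)] \<rho> by simp
  have connFC: "connected (C \<union> F)"
    unfolding F_def using connected_C_Un_slit_ring[OF u k1 r2(1,2)] .
  have Cne: "C \<noteq> {}"
    using closure_slit_ring_meets_C[OF u k1 r2(1,2)] by blast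
  have CE: "C \<subseteq> E"
    using C_disjoint E(3) by blast
  have CW: "C \<inter> W = {}"
    using C_disjoint unfolding Weq by blast
  have opW: "open W"
    unfolding W_def using open_image_sector[OF r2(3)] .
  \<comment> \<open>The sector is cut out from level \<open>\<rho>1\<close> on, and the slit ring is
    added from level \<open>\<rho>2\<close> on, so that the cut edges at high levels are joined to
    \<open>C\<close>.\<close>
  define E' where "E' = (E - W) \<union> (C \<union> F)"
  have EW: "E \<inter> W \<subseteq> V"
  proof
    fix x assume x: "x \<in> E \<inter> W"
    then have xD: "x \<in> D" "\<rho>1 < cmod (\<psi> x)" "k * cmod (\<psi> x) < Re (\<psi> x * cnj u)"
      unfolding Weq by auto
    have "h (\<psi> x) = x"
      using h_\<psi> xD r2 by simp
    then have "\<psi> x \<notin> A"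
      using Z[of "\<psi> x"] xD x by (auto simp: Z_def)
    then have "\<rho>3 \<le> cmod (\<psi> x)"
      using xD by (auto simp: A_def)
    then show "x \<in> V"
      using xD by (simp add: V_def)
  qed
  \<comment> \<open>The bounding rays of the sector at levels at least \<open>\<rho>3\<close> belong
    to \<open>F\<close>, because \<open>\<rho>2 < \<rho>3\<close>.\<close>
  have VE': "x \<in> C \<union> F" if "x \<in> V" "x \<in> E'" for x
  proof (rule ccontr)
    assume not: "x \<notin> C \<union> F"
    then have x: "x \<in> D" "\<rho>3 \<le> cmod (\<psi> x)" "k * cmod (\<psi> x) \<le> Re (\<psi> x * cnj u)" "x \<in> E - W"
      using that by (auto simp: V_def E'_def)
    then have "\<not> k * cmod (\<psi> x) < Re (\<psi> x * cnj u)"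
      using \<rho> unfolding Weq by auto
    then have "x \<in> F"
      using x \<rho> unfolding Feq by auto
    then show False
      using not by blast
  qed
  have clE': "closed E'"
    unfolding E'_def by (rule closed_Un[OF closed_Diff[OF E(1) opW] clFC])
  \<comment> \<open>In a splitting of \<open>E'\<close> the connected set
    \<open>C \<union> F\<close> lies on one side. Adding \<open>V\<close> to that side restores the
    lost points and yields a splitting of \<open>E\<close>.\<close>
  have conn: "connected E'"
    unfolding connected_closed
  proof clarify
    fix A B
    assume AB: "closed A" "closed B" "E' \<subseteq> A \<union> B" "A \<inter> B \<inter> E' = {}" "A \<inter> E' \<noteq> {}" "B \<inter> E' \<noteq> {}"
    have imp: False if AB: "closed A" "closed B" "E' \<subseteq> A \<union> B" "A \<inter> B \<inter> E' = {}" "A \<inter> E' \<noteq> {}" "B \<inter> E' \<noteq> {}"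
      and FA: "C \<union> F \<subseteq> A" for A B
    proof -
      let ?A = "A \<inter> E' \<union> V" and ?B = "B \<inter> E'"
      have BFC: "?B \<inter> (C \<union> F) = {}"
        using FA AB(4) unfolding E'_def by blast
      have "closed ?A" "closed ?B"
        using AB clE' clV by auto
      moreover have "E \<subseteq> ?A \<union> ?B"
        using EW AB(3) unfolding E'_def by blast
      moreover have "?A \<inter> ?B \<inter> E = {}"
        using AB(4) VE' BFC by blast
      moreover have "?A \<inter> E \<noteq> {}"
        using Cne CE unfolding V_def by blast
      moreover have "?B \<inter> E \<noteq> {}"
        using AB(6) BFC unfolding E'_def by blast
      ultimately show False
        using E(2) unfolding connected_closed by blast
    qed
    have "C \<union> F \<subseteq> A \<or> C \<union> F \<subseteq> B"
    proof (rule ccontr)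
      assume "\<not> (C \<union> F \<subseteq> A \<or> C \<union> F \<subseteq> B)"
      then have "A \<inter> (C \<union> F) \<noteq> {}" "B \<inter> (C \<union> F) \<noteq> {}"
        using AB(3) unfolding E'_def by blast+
      moreover have "C \<union> F \<subseteq> A \<union> B" "A \<inter> B \<inter> (C \<union> F) = {}"
        using AB(3,4) unfolding E'_def by blast+
      ultimately show False
        using connFC AB(1,2) unfolding connected_closed by blast
    qed
    then show False
    proof
      assume "C \<union> F \<subseteq> A"
      with imp[OF AB] show False .
    next
      assume FB: "C \<union> F \<subseteq> B"
      have "E' \<subseteq> B \<union> A" "B \<inter> A \<inter> E' = {}"
        using AB by blast+
      from imp[OF AB(2,1) this AB(6,5) FB] show False .
    qed
  qed
  show thesis
  proof
    show "closed E'"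
      using clE' .
    show "E' \<inter> h ` sector u k \<rho>1 = {}"
      using CW unfolding E'_def W_def[symmetric] Feq Weq by auto
    show "- D \<subseteq> E'"
      using E(3) unfolding E'_def Weq by blast
    show "E' \<subseteq> E \<union> {x \<in> D. \<rho>2 \<le> cmod (\<psi> x)}"
      using CE unfolding E'_def Feq by blast
  qed (use conn k1 in auto)
qed

end

section \<open>Simply connected regions that reach the boundary\<close>

context boundary_chart
begin

lemma \<psi>_ray:
  assumes "cmod u = 1" "r < t" "t < 1"
  shows "h (of_real t * u) \<in> D" "\<psi> (h (of_real t * u)) = of_real t * u" "cmod (\<psi> (h (of_real t * u))) = t"
proof -
  have "of_real t * u \<in> outer_ring r"
    using assms r by (simp add: outer_ring_def norm_mult)
  then show "h (of_real t * u) \<in> D" "\<psi> (h (of_real t * u)) = of_real t * u"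
    using h_in \<psi>_h by auto
  then show "cmod (\<psi> (h (of_real t * u))) = t"
    using assms r by (simp add: norm_mult)
qed

lemma ray_path:
  assumes u: "cmod u = 1" and ab: "r < a" "a \<le> b" "b < 1"
  obtains g where "path g" "pathstart g = h (of_real b * u)" "pathfinish g = h (of_real a * u)"
    "path_image g = (\<lambda>t. h (of_real t * u)) ` {a..b}"
proof -
  define g where "g = (\<lambda>t. h (of_real t * u)) \<circ> linepath b a"
  have im: "path_image (linepath b a) = {a..b}"
    using ab by (simp add: closed_segment_eq_real_ivl)
  have "continuous_on {a..b} (h \<circ> (\<lambda>t. of_real t * u))"
  proof (intro continuous_on_compose continuous_intros)
    have "(\<lambda>t. of_real t * u) ` {a..b} \<subseteq> outer_ring r"
      using ab u r by (auto simp: outer_ring_def norm_mult)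
    then show "continuous_on ((\<lambda>t. of_real t * u) ` {a..b}) h"
      using h_continuous continuous_on_subset by blast
  qed
  then have "path g"
    unfolding g_def using im by (intro path_continuous_image) (auto simp: o_def)
  then show thesis
  proof (rule that)
    show "path_image g = (\<lambda>t. h (of_real t * u)) ` {a..b}"
      unfolding g_def path_image_compose im ..
  qed (simp_all add: g_def pathstart_compose pathfinish_compose)
qed

lemma level_bound:
  assumes "compact K" "K \<subseteq> D"
  obtains M where "M < 1" "\<And>x. x \<in> K \<Longrightarrow> cmod (\<psi> x) \<le> M"
proof (cases "K = {}")
  case False
  have "continuous_on K (\<lambda>x. cmod (\<psi> x))"
    using \<psi>_continuous assms(2) by (intro continuous_intros) (meson continuous_on_subset)
  then obtain y where "y \<in> K" "\<And>x. x \<in> K \<Longrightarrow> cmod (\<psi> x) \<le> cmod (\<psi> y)"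
    using continuous_attains_sup[OF assms(1) False] by blast
  then show thesis
    using that[of "cmod (\<psi> y)"] \<psi>_disc assms(2) by blast
qed (use that[of 0] in auto)

text \<open>By \<open>level\<close>, \<open>T\<close> enters the boundary zone only along the radius
  through \<open>u\<close>, so a sector around that radius can be opened without touching
  \<open>T\<close>. The inclusion for \<open>E'\<close> confines the change to levels above
  \<open>\<rho>1\<close>, which allows a second application at another component.\<close>

lemma widen_separator:
  assumes E: "closed E" "connected E" "- D \<subseteq> E" and u: "cmod u = 1"
    and T: "connected T" "T \<subseteq> D" "T \<inter> E = {}"
    and \<rho>: "r < \<rho>1" "\<rho>1 < \<rho>3" "\<rho>3 < 1"
    and ends: "h (of_real \<rho>3 * u) \<in> T" "q \<in> T" "cmod (\<psi> q) < \<rho>1"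
    and level: "\<And>x. x \<in> T \<Longrightarrow> \<rho>1 \<le> cmod (\<psi> x) \<Longrightarrow> \<exists>t \<in> {\<rho>1..\<rho>3}. x = h (of_real t * u)"
  obtains \<delta> X E' where "closed E'" "connected E'" "- D \<subseteq> E'" "E' \<subseteq> E \<union> {x \<in> D. \<rho>1 < cmod (\<psi> x)}"
    "E' \<inter> (T \<union> X) = {}" "connected (T \<union> X)" "X \<subseteq> {x \<in> D. \<rho>1 < cmod (\<psi> x)}"
    "\<delta> > 0" "ball u \<delta> \<inter> ball 0 1 \<subseteq> outer_ring r" "h ` (ball u \<delta> \<inter> ball 0 1) \<subseteq> X"
proof -
  \<comment> \<open>On the connected set \<open>T\<close> the level takes all values from below
    \<open>\<rho>1\<close> to \<open>\<rho>3\<close>, so \<open>T\<close> contains the whole segment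
    and \<open>E\<close> misses it.\<close>
  have rayT: "h (of_real t * u) \<in> T" if t: "\<rho>1 \<le> t" "t \<le> \<rho>3" for t
  proof -
    have "continuous_on T (\<lambda>x. cmod (\<psi> x))"
      using \<psi>_continuous T(2) by (intro continuous_intros) (meson continuous_on_subset)
    then have "connected ((\<lambda>x. cmod (\<psi> x)) ` T)"
      using T(1) connected_continuous_image by blast
    moreover have "\<rho>3 \<in> (\<lambda>x. cmod (\<psi> x)) ` T"
      using ends(1) \<psi>_ray(3)[OF u, of \<rho>3] \<rho> by force
    moreover have "cmod (\<psi> q) \<in> (\<lambda>x. cmod (\<psi> x)) ` T"
      using ends(2) by blast
    ultimately have "{cmod (\<psi> q)..\<rho>3} \<subseteq> (\<lambda>x. cmod (\<psi> x)) ` T"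
      by (intro connected_contains_Icc)
    then have "t \<in> (\<lambda>x. cmod (\<psi> x)) ` T"
      using t ends(3) by force
    then obtain x where x: "x \<in> T" "cmod (\<psi> x) = t"
      by blast
    then obtain s where s: "s \<in> {\<rho>1..\<rho>3}" "x = h (of_real s * u)"
      using level t by blast
    then have "s = t"
      using \<psi>_ray(3)[OF u, of s] x \<rho> by auto
    then show ?thesis
      using x s by blast
  qed
  obtain \<rho>2 where \<rho>2: "\<rho>1 < \<rho>2" "\<rho>2 < \<rho>3"
    using dense \<rho> by blast
  obtain k E' where E': "\<bar>k\<bar> < 1" "closed E'" "connected E'" "- D \<subseteq> E'"
    "E' \<inter> h ` sector u k \<rho>1 = {}" "E' \<subseteq> E \<union> {x \<in> D. \<rho>2 \<le> cmod (\<psi> x)}"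
    using open_sector_in_separator[OF E u \<rho>(1) \<rho>2 \<rho>(3)] rayT T(3) by blast
  have in_sector: "of_real t * u \<in> sector u k \<rho>1" if t: "\<rho>1 < t" "t < 1" for t
  proof -
    have t0: "t > 0"
      using t \<rho> r by linarith
    have eq: "of_real t * u * cnj u = of_real t"
      using unit_mult_cnj[OF u] by (simp add: mult.assoc)
    have "Re (of_real t * u * cnj u) = t"
      unfolding eq by simp
    moreover have "k * t < t"
      using E'(1) t0 by simp
    moreover have "cmod (of_real t * u) = t"
      using t0 u by (simp add: norm_mult)
    ultimately show ?thesis
      using t unfolding sector_def outer_ring_def by simp
  qed
  have r1: "r \<le> \<rho>1" "0 < \<rho>1" "\<rho>1 < 1"
    using \<rho> r by auto
  have Xsub: "h ` sector u k \<rho>1 \<subseteq> {x \<in> D. \<rho>1 < cmod (\<psi> x)}"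
    unfolding image_sector[OF r1(1)] by blast
  \<comment> \<open>What \<open>E'\<close> gained has level at least \<open>\<rho>2\<close>; there
    \<open>T\<close> runs on the radius, inside the open sector that \<open>E'\<close>
    avoids.\<close>
  have TE': "T \<inter> E' = {}"
  proof (rule ccontr)
    assume "T \<inter> E' \<noteq> {}"
    then obtain x where x: "x \<in> T" "x \<in> E'"
      by blast
    then have "\<rho>2 \<le> cmod (\<psi> x)"
      using E'(6) T(3) by blast
    then obtain t where t: "t \<in> {\<rho>1..\<rho>3}" "x = h (of_real t * u)"
      using level[OF x(1)] \<rho>2 by auto
    have "cmod (\<psi> x) = t"
      using \<psi>_ray(3)[OF u, of t] t \<rho> by auto
    then have "of_real t * u \<in> sector u k \<rho>1"
      using in_sector[of t] \<open>\<rho>2 \<le> cmod (\<psi> x)\<close> \<rho>2 t \<rho> by auto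
    then show False
      using E'(5) x t by blast
  qed
  have "continuous_on (sector u k \<rho>1) h"
    using h_continuous by (rule continuous_on_subset) (use \<rho> in \<open>auto simp: sector_def outer_ring_def\<close>)
  then have "connected (h ` sector u k \<rho>1)"
    using connected_continuous_image connected_sector[OF u E'(1) r1(2)] by blast
  moreover have "h (of_real \<rho>3 * u) \<in> T \<inter> h ` sector u k \<rho>1"
    using ends(1) in_sector[of \<rho>3] \<rho> by blast
  ultimately have conn: "connected (T \<union> h ` sector u k \<rho>1)"
    using T(1) by (intro connected_Un) auto
  obtain \<delta> where \<delta>: "\<delta> > 0" "ball u \<delta> \<inter> ball 0 1 \<subseteq> sector u k \<rho>1"
  proof (rule sector_contains_half_disc[OF u _ r1(3)])
    show "k < 1"
      using E'(1) by simp
  qed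
  show thesis
  proof
    show "E' \<subseteq> E \<union> {x \<in> D. \<rho>1 < cmod (\<psi> x)}"
      using E'(6) \<rho>2 by auto
    show "E' \<inter> (T \<union> h ` sector u k \<rho>1) = {}"
      using E'(5) TE' by blast
    show "ball u \<delta> \<inter> ball 0 1 \<subseteq> outer_ring r"
      using \<delta>(2) r1 unfolding sector_def outer_ring_def by auto
    show "h ` (ball u \<delta> \<inter> ball 0 1) \<subseteq> h ` sector u k \<rho>1"
      using \<delta>(2) by blast
  qed (use E' conn Xsub \<delta> in auto)
qed

text \<open>The region grows around an arc from \<open>q\<close> that ends on the radius towards
  \<open>u\<close>: a separator avoiding the arc is opened at that end.\<close>

lemma region_to_boundary_point:
  assumes conn: "connected D" and u: "cmod u = 1" and q: "q \<in> D"
  obtains G \<delta> where "open G" "simply_connected G" "G \<subseteq> D" "q \<in> G"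
    "\<delta> > 0" "ball u \<delta> \<inter> ball 0 1 \<subseteq> outer_ring r" "h ` (ball u \<delta> \<inter> ball 0 1) \<subseteq> G"
proof -
  obtain a where a: "r < a" "a < 1"
    using dense r by blast
  have "path_connected D"
    using connected_open_path_connected[OF open_domain conn] .
  then obtain p where p: "path p" "path_image p \<subseteq> D" "pathstart p = h (of_real a * u)" "pathfinish p = q"
    using \<psi>_ray(1)[OF u a] q unfolding path_connected_def by blast
  obtain M where M: "M < 1" "\<And>x. x \<in> path_image p \<Longrightarrow> cmod (\<psi> x) \<le> M"
    using level_bound[OF compact_path_image[OF p(1)] p(2)] by blast
  \<comment> \<open>Above level \<open>\<rho>1\<close> the path \<open>p\<close> is absent, so only
    the radial part of the curve is left there.\<close>
  obtain \<rho>1 where \<rho>1: "max M a < \<rho>1" "\<rho>1 < 1"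
    using dense[of "max M a" 1] M a by auto
  obtain \<rho>3 where \<rho>3: "\<rho>1 < \<rho>3" "\<rho>3 < 1"
    using dense \<rho>1(2) by blast
  have \<rho>: "r < \<rho>1" "M < \<rho>1" "a < \<rho>1" "a \<le> \<rho>3"
    using \<rho>1 \<rho>3 a by auto
  obtain g where g: "path g" "pathstart g = h (of_real \<rho>3 * u)" "pathfinish g = h (of_real a * u)"
    "path_image g = (\<lambda>t. h (of_real t * u)) ` {a..\<rho>3}"
    using ray_path[OF u a(1) \<rho>(4) \<rho>3(2)] by blast
  have im: "path_image (g +++ p) = (\<lambda>t. h (of_real t * u)) ` {a..\<rho>3} \<union> path_image p"
    using g p by (simp add: path_image_join)
  have qM: "cmod (\<psi> q) \<le> M"
    using M p by (metis pathfinish_in_path_image)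
  have ne: "h (of_real \<rho>3 * u) \<noteq> q"
    using \<psi>_ray(3)[OF u, of \<rho>3] \<rho> \<rho>3 qM by auto
  \<comment> \<open>An arc has a connected complement, which \<open>connected_separator\<close>
    demands; a general path may enclose points.\<close>
  obtain T where T: "arc T" "path_image T \<subseteq> path_image (g +++ p)" "pathstart T = h (of_real \<rho>3 * u)" "pathfinish T = q"
    by (rule path_contains_arc[of "g +++ p" "h (of_real \<rho>3 * u)" q]) (use g p ne in auto)
  define S where "S = path_image T"
  have "S \<subseteq> D"
    using T(2) p(2) \<psi>_ray(1)[OF u] a \<rho>3 unfolding S_def im by fastforce
  have S: "compact S" "connected S" "connected (- S)" "h (of_real \<rho>3 * u) \<in> S" "q \<in> S"
    unfolding S_def using T(1) arc_imp_path[OF T(1)] T(3,4) pathstart_in_path_image[of T] pathfinish_in_path_image[of T]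
    by (auto simp: compact_path_image connected_path_image connected_arc_complement)
  obtain E where E: "closed E" "connected E" "- D \<subseteq> E" "E \<inter> S = {}"
    using connected_separator[OF open_domain bounded_domain S(1) \<open>S \<subseteq> D\<close> S(3)] by blast
  have level: "\<exists>t \<in> {\<rho>1..\<rho>3}. x = h (of_real t * u)" if x: "x \<in> S" "\<rho>1 \<le> cmod (\<psi> x)" for x
  proof -
    have "x \<notin> path_image p"
      using M(2)[of x] x \<rho> by auto
    then obtain t where t: "t \<in> {a..\<rho>3}" "x = h (of_real t * u)"
      using x T(2) unfolding S_def im by blast
    then have "cmod (\<psi> x) = t"
      using \<psi>_ray(3)[OF u, of t] a \<rho>3 by auto
    then show ?thesis
      using x t by auto
  qed
  have qlt: "cmod (\<psi> q) < \<rho>1"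
    using qM \<rho> by linarith
  have SE: "S \<inter> E = {}"
    using E by blast
  obtain \<delta> X E' where X: "closed E'" "connected E'" "- D \<subseteq> E'" "E' \<subseteq> E \<union> {x \<in> D. \<rho>1 < cmod (\<psi> x)}"
    "E' \<inter> (S \<union> X) = {}" "connected (S \<union> X)" "X \<subseteq> {x \<in> D. \<rho>1 < cmod (\<psi> x)}"
    "\<delta> > 0" "ball u \<delta> \<inter> ball 0 1 \<subseteq> outer_ring r" "h ` (ball u \<delta> \<inter> ball 0 1) \<subseteq> X"
    by (rule widen_separator[OF E(1-3) u S(2) \<open>S \<subseteq> D\<close> SE \<rho>(1) \<rho>3 S(4,5) qlt level])
  have "(S \<union> X) \<inter> E' = {}" "q \<in> S \<union> X"
    using X S by blast+
  then obtain G where "open G" "simply_connected G" "S \<union> X \<subseteq> G" "G \<subseteq> D"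
    using simply_connected_component_avoiding[OF bounded_domain X(1-3,6)] by blast
  then show thesis
    using that[of G \<delta>] X S by blast
qed

end

text \<open>Points at which both moduli are close to 1 would accumulate at a common point of
  \<open>C0\<close> and \<open>C1\<close>. One bound for both charts makes the conclusion
  symmetric.\<close>

lemma boundary_charts_disjoint:
  assumes "boundary_chart D C0 \<psi>0 h0 r0" "boundary_chart D C1 \<psi>1 h1 r1" "C0 \<inter> C1 = {}"
  obtains \<rho> where "\<rho> < 1" "\<And>x. x \<in> D \<Longrightarrow> \<rho> < cmod (\<psi>0 x) \<Longrightarrow> cmod (\<psi>1 x) \<le> \<rho>"
proof -
  interpret c0: boundary_chart D C0 \<psi>0 h0 r0 by fact
  interpret c1: boundary_chart D C1 \<psi>1 h1 r1 by fact
  have "\<exists>\<rho><1. \<forall>x\<in>D. \<rho> < cmod (\<psi>0 x) \<longrightarrow> cmod (\<psi>1 x) \<le> \<rho>"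
  proof (rule ccontr)
    assume not: "\<not> ?thesis"
    have "\<exists>x. x \<in> D \<and> 1 - 1 / real (Suc n) < cmod (\<psi>0 x) \<and> 1 - 1 / real (Suc n) < cmod (\<psi>1 x)" for n
    proof -
      have "1 - 1 / real (Suc n) < 1"
        by simp
      then show ?thesis
        using not not_le by blast
    qed
    then obtain x where x: "\<And>n. x n \<in> D" "\<And>n. 1 - 1 / real (Suc n) < cmod (\<psi>0 (x n))"
      "\<And>n. 1 - 1 / real (Suc n) < cmod (\<psi>1 (x n))"
      by metis
    have lim: "(\<lambda>n. 1 - 1 / real (Suc n)) \<longlonglongrightarrow> 1"
      using tendsto_diff[OF tendsto_const LIMSEQ_Suc[OF lim_1_over_n], of 1] by simp
    have l: "(\<lambda>n. cmod (\<psi>0 (x n))) \<longlonglongrightarrow> 1" "(\<lambda>n. cmod (\<psi>1 (x n))) \<longlonglongrightarrow> 1"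
      by (rule tendsto_sandwich[OF _ _ lim tendsto_const]; intro always_eventually allI less_imp_le x c0.\<psi>_disc c1.\<psi>_disc)+
    have "seq_compact (closure D)"
      using c0.bounded_domain by (simp add: compact_imp_seq_compact)
    then obtain q s where q: "strict_mono (s :: nat \<Rightarrow> nat)" "(x \<circ> s) \<longlonglongrightarrow> q"
      using x(1) closure_subset unfolding seq_compact_def by (metis subsetD)
    have "q \<in> C0"
      using c0.limit_in_C[OF _ q(2)] x(1) LIMSEQ_subseq_LIMSEQ[OF l(1) q(1)] by (simp add: o_def)
    moreover have "q \<in> C1"
      using c1.limit_in_C[OF _ q(2)] x(1) LIMSEQ_subseq_LIMSEQ[OF l(2) q(1)] by (simp add: o_def)
    ultimately show False
      using assms(3) by blast
  qed
  then show thesis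
    using that by blast
qed

text \<open>The separator is widened at both ends of an arc joining the two boundary zones. High
  levels of the two charts exclude each other, so the second widening does not close the sector
  opened by the first.\<close>

lemma region_between_boundary_points:
  assumes c0: "boundary_chart D C0 \<psi>0 h0 r0" and c1: "boundary_chart D C1 \<psi>1 h1 r1" and disj: "C0 \<inter> C1 = {}"
    and conn: "connected D" and u: "cmod u0 = 1" "cmod u1 = 1"
  obtains G \<delta> where "open G" "simply_connected G" "G \<subseteq> D" "\<delta> > 0"
    "ball u0 \<delta> \<inter> ball 0 1 \<subseteq> outer_ring r0" "h0 ` (ball u0 \<delta> \<inter> ball 0 1) \<subseteq> G"
    "ball u1 \<delta> \<inter> ball 0 1 \<subseteq> outer_ring r1" "h1 ` (ball u1 \<delta> \<inter> ball 0 1) \<subseteq> G"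
proof -
  interpret c0: boundary_chart D C0 \<psi>0 h0 r0 by fact
  interpret c1: boundary_chart D C1 \<psi>1 h1 r1 by fact
  obtain d where d: "d < 1" "\<And>x. x \<in> D \<Longrightarrow> d < cmod (\<psi>0 x) \<Longrightarrow> cmod (\<psi>1 x) \<le> d"
    using boundary_charts_disjoint[OF c0 c1 disj] by blast
  \<comment> \<open>Beyond level \<open>d\<close> the radial end in one chart stays at level at most
    \<open>d\<close> in the other, as both \<open>level0\<close> and \<open>level1\<close>
    need.\<close>
  obtain a where a: "max d (max r0 r1) < a" "a < 1"
    using dense[of "max d (max r0 r1)" 1] d c0.r c1.r by auto
  have a': "d < a" "r0 < a" "r1 < a"
    using a by auto
  have "path_connected D"
    using connected_open_path_connected[OF c0.open_domain conn] .
  then obtain p where p: "path p" "path_image p \<subseteq> D" "pathstart p = h0 (of_real a * u0)" "pathfinish p = h1 (of_real a * u1)"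
    using c0.\<psi>_ray(1)[OF u(1) a'(2) a(2)] c1.\<psi>_ray(1)[OF u(2) a'(3) a(2)] unfolding path_connected_def by blast
  obtain M0 where M0: "M0 < 1" "\<And>x. x \<in> path_image p \<Longrightarrow> cmod (\<psi>0 x) \<le> M0"
    using c0.level_bound[OF compact_path_image[OF p(1)] p(2)] by blast
  obtain M1 where M1: "M1 < 1" "\<And>x. x \<in> path_image p \<Longrightarrow> cmod (\<psi>1 x) \<le> M1"
    using c1.level_bound[OF compact_path_image[OF p(1)] p(2)] by blast
  obtain \<rho>1 where \<rho>1: "max a (max M0 M1) < \<rho>1" "\<rho>1 < 1"
    using dense[of "max a (max M0 M1)" 1] M0 M1 a by auto
  obtain \<rho>3 where \<rho>3: "\<rho>1 < \<rho>3" "\<rho>3 < 1"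
    using dense \<rho>1(2) by blast
  have \<rho>: "r0 < \<rho>1" "r1 < \<rho>1" "M0 < \<rho>1" "M1 < \<rho>1" "a < \<rho>1" "a \<le> \<rho>3" "d < \<rho>1"
    using \<rho>1 \<rho>3 a by auto
  obtain g0 where g0: "path g0" "pathstart g0 = h0 (of_real \<rho>3 * u0)" "pathfinish g0 = h0 (of_real a * u0)"
    "path_image g0 = (\<lambda>t. h0 (of_real t * u0)) ` {a..\<rho>3}"
    using c0.ray_path[OF u(1) a'(2) \<rho>(6) \<rho>3(2)] by blast
  obtain g1 where g1: "path g1" "pathstart g1 = h1 (of_real \<rho>3 * u1)" "pathfinish g1 = h1 (of_real a * u1)"
    "path_image g1 = (\<lambda>t. h1 (of_real t * u1)) ` {a..\<rho>3}"
    using c1.ray_path[OF u(2) a'(3) \<rho>(6) \<rho>3(2)] by blast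
  have im: "path_image (g0 +++ p +++ reversepath g1) =
      (\<lambda>t. h0 (of_real t * u0)) ` {a..\<rho>3} \<union> path_image p \<union> (\<lambda>t. h1 (of_real t * u1)) ` {a..\<rho>3}"
    using g0 g1 p by (simp add: path_image_join Un_assoc)
  have e0: "h0 (of_real \<rho>3 * u0) \<in> D" "cmod (\<psi>0 (h0 (of_real \<rho>3 * u0))) = \<rho>3"
    using c0.\<psi>_ray[OF u(1), of \<rho>3] \<rho> \<rho>3 by auto
  have e1: "h1 (of_real \<rho>3 * u1) \<in> D" "cmod (\<psi>1 (h1 (of_real \<rho>3 * u1))) = \<rho>3"
    using c1.\<psi>_ray[OF u(2), of \<rho>3] \<rho> \<rho>3 by auto
  have l0: "cmod (\<psi>1 (h0 (of_real \<rho>3 * u0))) < \<rho>1"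
    using d(2)[OF e0(1)] e0(2) \<rho> \<rho>3 by linarith
  have l1: "cmod (\<psi>0 (h1 (of_real \<rho>3 * u1))) < \<rho>1"
    using d(2)[OF e1(1)] e1(2) \<rho> \<rho>3 by linarith
  have ne: "h0 (of_real \<rho>3 * u0) \<noteq> h1 (of_real \<rho>3 * u1)"
    using l0 e1 \<rho>3 by auto
  obtain T where T: "arc T" "path_image T \<subseteq> path_image (g0 +++ p +++ reversepath g1)"
    "pathstart T = h0 (of_real \<rho>3 * u0)" "pathfinish T = h1 (of_real \<rho>3 * u1)"
    by (rule path_contains_arc[of "g0 +++ p +++ reversepath g1" "h0 (of_real \<rho>3 * u0)" "h1 (of_real \<rho>3 * u1)"])
      (use g0 g1 p ne in auto)
  define S where "S = path_image T"
  have ray0: "h0 (of_real t * u0) \<in> D \<and> cmod (\<psi>0 (h0 (of_real t * u0))) = t" if "t \<in> {a..\<rho>3}" for t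
    using c0.\<psi>_ray[OF u(1), of t] that a' \<rho>3 by auto
  have ray1: "h1 (of_real t * u1) \<in> D \<and> cmod (\<psi>1 (h1 (of_real t * u1))) = t" if "t \<in> {a..\<rho>3}" for t
    using c1.\<psi>_ray[OF u(2), of t] that a' \<rho>3 by auto
  have SD: "S \<subseteq> D"
    using T(2) p(2) ray0 ray1 unfolding S_def im by blast
  have S: "compact S" "connected S" "connected (- S)" "h0 (of_real \<rho>3 * u0) \<in> S" "h1 (of_real \<rho>3 * u1) \<in> S"
    unfolding S_def using T(1) arc_imp_path[OF T(1)] T(3,4) pathstart_in_path_image[of T] pathfinish_in_path_image[of T]
    by (auto simp: compact_path_image connected_path_image connected_arc_complement)
  have level0: "\<exists>t \<in> {\<rho>1..\<rho>3}. x = h0 (of_real t * u0)" if x: "x \<in> S" "\<rho>1 \<le> cmod (\<psi>0 x)" for x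
  proof -
    have "x \<notin> path_image p"
      using M0(2)[of x] x \<rho> by auto
    moreover have "x \<notin> (\<lambda>t. h1 (of_real t * u1)) ` {a..\<rho>3}"
    proof
      assume "x \<in> (\<lambda>t. h1 (of_real t * u1)) ` {a..\<rho>3}"
      then have "x \<in> D" "a \<le> cmod (\<psi>1 x)"
        using ray1 by auto
      then show False
        using d(2)[of x] x a' \<rho> by auto
    qed
    ultimately obtain t where t: "t \<in> {a..\<rho>3}" "x = h0 (of_real t * u0)"
      using x T(2) unfolding S_def im by blast
    then show ?thesis
      using x ray0[OF t(1)] by auto
  qed
  have level1: "\<exists>t \<in> {\<rho>1..\<rho>3}. x = h1 (of_real t * u1)" if x: "x \<in> S" "\<rho>1 \<le> cmod (\<psi>1 x)" for x
  proof -
    have "x \<notin> path_image p"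
      using M1(2)[of x] x \<rho> by auto
    moreover have "x \<notin> (\<lambda>t. h0 (of_real t * u0)) ` {a..\<rho>3}"
    proof
      assume "x \<in> (\<lambda>t. h0 (of_real t * u0)) ` {a..\<rho>3}"
      then have "x \<in> D" "a \<le> cmod (\<psi>0 x)"
        using ray0 by auto
      then show False
        using d(2)[of x] x a' \<rho> by auto
    qed
    ultimately obtain t where t: "t \<in> {a..\<rho>3}" "x = h1 (of_real t * u1)"
      using x T(2) unfolding S_def im by blast
    then show ?thesis
      using x ray1[OF t(1)] by auto
  qed
  obtain E where E: "closed E" "connected E" "- D \<subseteq> E" "E \<inter> S = {}"
    using connected_separator[OF c0.open_domain c0.bounded_domain S(1) SD S(3)] by blast
  have SE: "S \<inter> E = {}"
    using E by blast
  obtain \<delta>0 X0 E0 where X0: "closed E0" "connected E0" "- D \<subseteq> E0" "E0 \<subseteq> E \<union> {x \<in> D. \<rho>1 < cmod (\<psi>0 x)}"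
    "E0 \<inter> (S \<union> X0) = {}" "connected (S \<union> X0)"
    "X0 \<subseteq> {x \<in> D. \<rho>1 < cmod (\<psi>0 x)}"
    "\<delta>0 > 0" "ball u0 \<delta>0 \<inter> ball 0 1 \<subseteq> outer_ring r0" "h0 ` (ball u0 \<delta>0 \<inter> ball 0 1) \<subseteq> X0"
    by (rule c0.widen_separator[OF E(1-3) u(1) S(2) SD SE \<rho>(1) \<rho>3 S(4,5) l1 level0])
  have SE0: "S \<inter> E0 = {}"
    using X0 by blast
  obtain \<delta>1 X1 E1 where X1: "closed E1" "connected E1" "- D \<subseteq> E1" "E1 \<subseteq> E0 \<union> {x \<in> D. \<rho>1 < cmod (\<psi>1 x)}"
    "E1 \<inter> (S \<union> X1) = {}" "connected (S \<union> X1)" "X1 \<subseteq> {x \<in> D. \<rho>1 < cmod (\<psi>1 x)}"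
    "\<delta>1 > 0" "ball u1 \<delta>1 \<inter> ball 0 1 \<subseteq> outer_ring r1" "h1 ` (ball u1 \<delta>1 \<inter> ball 0 1) \<subseteq> X1"
    by (rule c1.widen_separator[OF X0(1-3) u(2) S(2) SD SE0 \<rho>(2) \<rho>3 S(5,4) l0 level1])
  \<comment> \<open>What \<open>E1\<close> adds to \<open>E0\<close> lies at high levels of
    \<open>\<psi>1\<close>, hence outside \<open>X0\<close>.\<close>
  have "X0 \<inter> {x \<in> D. \<rho>1 < cmod (\<psi>1 x)} = {}"
    using X0(7) d(2) \<rho> by force
  then have disjX: "(S \<union> X0 \<union> X1) \<inter> E1 = {}"
    using X0(5) X1(4,5) by blast
  have "connected ((S \<union> X0) \<union> (S \<union> X1))"
    using connected_Un[OF X0(6) X1(6)] S(4) by blast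
  moreover have "(S \<union> X0) \<union> (S \<union> X1) = S \<union> X0 \<union> X1"
    by blast
  ultimately have "connected (S \<union> X0 \<union> X1)"
    by simp
  then obtain G where G: "open G" "simply_connected G" "S \<union> X0 \<union> X1 \<subseteq> G" "G \<subseteq> D"
    using simply_connected_component_avoiding[OF c0.bounded_domain X1(1-3) _ disjX] S(4) by blast
  have sub: "ball u0 (min \<delta>0 \<delta>1) \<inter> ball 0 1 \<subseteq> ball u0 \<delta>0 \<inter> ball 0 1"
    "ball u1 (min \<delta>0 \<delta>1) \<inter> ball 0 1 \<subseteq> ball u1 \<delta>1 \<inter> ball 0 1"
    by auto
  show thesis
  proof (rule that[of G "min \<delta>0 \<delta>1"])
    show "0 < min \<delta>0 \<delta>1"
      using X0(8) X1(8) by simp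
    show "ball u0 (min \<delta>0 \<delta>1) \<inter> ball 0 1 \<subseteq> outer_ring r0"
      using sub(1) X0(9) by (rule subset_trans)
    show "ball u1 (min \<delta>0 \<delta>1) \<inter> ball 0 1 \<subseteq> outer_ring r1"
      using sub(2) X1(9) by (rule subset_trans)
    show "h0 ` (ball u0 (min \<delta>0 \<delta>1) \<inter> ball 0 1) \<subseteq> G"
      using image_mono[OF sub(1), of h0] X0(10) G(3) by blast
    show "h1 ` (ball u1 (min \<delta>0 \<delta>1) \<inter> ball 0 1) \<subseteq> G"
      using image_mono[OF sub(2), of h1] X1(10) G(3) by blast
  qed (fact G)+
qed

section \<open>Bounds from simply connected subdomains and peak functions\<close>

text \<open>A disc of fixed radius \<open>s\<close> touches the unit circle from inside in the
  direction of \<open>\<psi> (x n)\<close>, and Schwarz-Pick on it gives the linear bound. Its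
  centres converge to a point of the half disc, so one constant serves for all large n.\<close>

lemma (in boundary_chart) Hopf_estimate:
  assumes G: "open G" "k holomorphic_on G" "k ` G \<subseteq> ball 0 1" and u: "cmod u = 1"
    and \<delta>: "\<delta> > 0" "ball u \<delta> \<inter> ball 0 1 \<subseteq> outer_ring r" "h ` (ball u \<delta> \<inter> ball 0 1) \<subseteq> G"
    and x: "\<And>n. x n \<in> D" and lim: "(\<lambda>n. \<psi> (x n)) \<longlonglongrightarrow> u"
  obtains c where "c > 0"
    "\<forall>\<^sub>F n in sequentially. x n \<in> G \<and> c * (1 - cmod (\<psi> (x n))) \<le> 1 - cmod (k (x n))"
proof -
  \<comment> \<open>\<open>3 * s < \<delta>\<close> keeps the tangent discs in
    \<open>ball u \<delta>\<close>: the touching point is less than \<open>s\<close> from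
    \<open>u\<close>, the centre is \<open>s\<close> from the touching point, and the radius is
    \<open>s\<close>.\<close>
  define s where "s = min (\<delta> / 4) (1 / 2)"
  have s: "0 < s" "s \<le> 1 / 2" "3 * s < \<delta>"
    using \<delta>(1) by (auto simp: s_def)
  define B where "B = ball u \<delta> \<inter> ball 0 1"
  have B: "open B" "B \<subseteq> outer_ring r" "h ` B \<subseteq> G"
    using \<delta> by (auto simp: B_def)
  have hB: "h holomorphic_on B"
    using h_holomorphic B(2) holomorphic_on_subset by blast
  have kh: "(k \<circ> h) holomorphic_on B"
    using holomorphic_on_compose_gen[OF hB G(2)] B(3) by blast
  have khB: "cmod (k (h \<zeta>)) < 1" if "\<zeta> \<in> B" for \<zeta>
  proof -
    have "k (h \<zeta>) \<in> ball 0 1"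
      using that B(3) G(3) by blast
    then show ?thesis
      by simp
  qed
  have inB: "of_real (1 - s) * v + of_real s * l \<in> B" if v: "cmod v = 1" "cmod (v - u) < s" and l: "cmod l < 1" for v l
  proof -
    have sl: "cmod (of_real s * l) < s"
      using s(1) l by (simp add: norm_mult)
    have sv: "cmod (of_real (1 - s) * v) = 1 - s"
      using s v(1) by (simp add: norm_mult del: of_real_diff)
    define y where "y = of_real (1 - s) * v + of_real s * l"
    have "cmod y < 1"
      unfolding y_def using norm_triangle_ineq[of "of_real (1 - s) * v" "of_real s * l"] sl sv by linarith
    moreover have "cmod ((v - u) - of_real s * v + of_real s * l) < 3 * s"
    proof -
      have "cmod (of_real s * v) = s"
        using s v(1) by (simp add: norm_mult)
      then show ?thesis
        using norm_triangle_ineq[of "(v - u) - of_real s * v" "of_real s * l"]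
          norm_triangle_ineq4[of "v - u" "of_real s * v"] sl v(2) by linarith
    qed
    moreover have "(v - u) - of_real s * v + of_real s * l = y - u"
      by (simp add: y_def algebra_simps)
    ultimately have "y \<in> B"
      unfolding B_def using s(3) by (simp add: dist_norm norm_minus_commute)
    then show ?thesis
      by (simp only: y_def)
  qed
  define v where "v n = \<psi> (x n) / of_real (cmod (\<psi> (x n)))" for n
  have m1: "(\<lambda>n. cmod (\<psi> (x n))) \<longlonglongrightarrow> 1"
    using tendsto_norm[OF lim] u by simp
  have "(\<lambda>n. \<psi> (x n) / of_real (cmod (\<psi> (x n)))) \<longlonglongrightarrow> u / of_real 1"
    by (intro tendsto_divide lim tendsto_of_real m1) auto
  then have vu: "v \<longlonglongrightarrow> u"
    by (simp add: v_def[abs_def])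
  define b where "b = of_real (1 - s) * u"
  have bB: "b \<in> B"
    using inB[of u 0] u s by (simp add: b_def)
  have "isCont (k \<circ> h) b"
    using kh B(1) bB by (metis holomorphic_on_imp_continuous_on continuous_on_eq_continuous_at)
  moreover have "(\<lambda>n. of_real (1 - s) * v n) \<longlonglongrightarrow> b"
    unfolding b_def by (intro tendsto_intros vu)
  ultimately have "(\<lambda>n. (k \<circ> h) (of_real (1 - s) * v n)) \<longlonglongrightarrow> (k \<circ> h) b"
    by (rule isCont_tendsto_compose)
  then have khlim: "(\<lambda>n. cmod (k (h (of_real (1 - s) * v n)))) \<longlonglongrightarrow> cmod (k (h b))"
    using tendsto_norm by fastforce
  obtain A where A: "cmod (k (h b)) < A" "A < 1"
    using dense khB[OF bB] by blast
  have ev1: "\<forall>\<^sub>F n in sequentially. cmod (k (h (of_real (1 - s) * v n))) < A"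
    using order_tendstoD(2)[OF khlim A(1)] .
  have ev2: "\<forall>\<^sub>F n in sequentially. cmod (v n - u) < s"
    using tendstoD[OF vu s(1)] by (simp add: dist_norm)
  have "max (1 - s) r < 1"
    using s r by simp
  then have ev3: "\<forall>\<^sub>F n in sequentially. max (1 - s) r < cmod (\<psi> (x n))"
    using order_tendstoD(1)[OF m1] by blast
  show thesis
  proof
    show "0 < (1 - A) / (2 * s)"
      using A s by simp
    show "\<forall>\<^sub>F n in sequentially. x n \<in> G \<and> (1 - A) / (2 * s) * (1 - cmod (\<psi> (x n))) \<le> 1 - cmod (k (x n))"
      using ev1 ev2 ev3
    proof eventually_elim
      case (elim n)
      define m where "m = cmod (\<psi> (x n))"
      have m: "1 - s < m" "r < m" "m < 1" "0 < m"
        using elim(3) \<psi>_disc[OF x, of n] r by (auto simp: m_def)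
      have v1: "cmod (v n) = 1" and mv: "\<psi> (x n) = of_real m * v n"
        using m(4) by (auto simp: v_def m_def norm_divide)
      \<comment> \<open>\<open>t * v n\<close> is the coordinate of \<open>\<psi> (x n)\<close> in
        the tangent disc rescaled to the unit disc; \<open>1 - t\<close> is
        \<open>(1 - m) / s\<close>.\<close>
      define t where "t = (m - (1 - s)) / s"
      have t: "0 < t" "t < 1"
        using m s by (auto simp: t_def field_simps)
      have st: "s * t = m - (1 - s)"
        using s by (simp add: t_def)
      define f where "f l = k (h (of_real (1 - s) * v n + of_real s * l))" for l
      have maps: "(\<lambda>l. of_real (1 - s) * v n + of_real s * l) ` ball 0 1 \<subseteq> B"
        using inB[OF v1 elim(2)] by (auto simp del: of_real_diff)
      have "(\<lambda>l. of_real (1 - s) * v n + of_real s * l) holomorphic_on ball 0 1"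
        by (intro holomorphic_intros)
      then have "f holomorphic_on ball 0 1"
        using holomorphic_on_compose_gen[OF _ kh maps] by (simp add: f_def[abs_def] o_def)
      moreover have "f ` ball 0 1 \<subseteq> ball 0 1"
        using khB maps by (auto simp: f_def image_subset_iff)
      moreover have "cmod (f 0) \<le> A"
        using elim(1) by (simp add: f_def)
      moreover have tv: "cmod (of_real t * v n) = t"
        using t v1 by (simp add: norm_mult)
      ultimately have main: "(1 - A) * (1 - t) / 2 \<le> 1 - cmod (f (of_real t * v n))"
        using Schwarz_Pick_boundary_distance[of f A "of_real t * v n"] A(2) t by simp
      have point: "of_real (1 - s) * v n + of_real s * (of_real t * v n) = \<psi> (x n)"
      proof -
        have "of_real (1 - s) * v n + of_real s * (of_real t * v n) = of_real ((1 - s) + s * t) * v n"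
          by (simp add: algebra_simps)
        then show ?thesis
          unfolding mv st by simp
      qed
      have \<psi>B: "\<psi> (x n) \<in> B"
        using inB[OF v1 elim(2), of "of_real t * v n"] tv t unfolding point by simp
      have hx: "h (\<psi> (x n)) = x n"
        using h_\<psi>[OF x] m by (simp add: m_def)
      have "1 - t = (1 - m) / s"
        using s by (simp add: t_def field_simps)
      then have "(1 - A) / (2 * s) * (1 - m) = (1 - A) * (1 - t) / 2"
        by simp
      then have "(1 - A) / (2 * s) * (1 - m) \<le> 1 - cmod (k (x n))"
        using main hx unfolding f_def point by simp
      moreover have "x n \<in> G"
        using \<psi>B hx B(3) by (metis image_subset_iff)
      ultimately show ?case
        by (simp add: m_def)
    qed
  qed
qed

text \<open>The disc is the inverse Riemann map, recentred so that 0 goes to \<open>z\<close>. In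
  16, one factor 4 is that of \<open>artanh_le_half_ln\<close>, the other comes from
  \<open>|1 - cnj (k z) * k w| \<le> 2\<close>.\<close>

lemma Riemann_map_disc_through:
  assumes kg: "g holomorphic_on ball 0 1" "\<And>x. x \<in> G \<Longrightarrow> k x \<in> ball 0 1 \<and> g (k x) = x" "\<And>x. x \<in> ball 0 1 \<Longrightarrow> g x \<in> G"
    and G: "G \<subseteq> D" and zw: "z \<in> G" "w \<in> G"
  obtains \<phi> \<alpha> where "\<phi> \<in> holo_maps (ball 0 1) D" "\<phi> 0 = z" "\<phi> \<alpha> = w" "\<alpha> \<in> ball 0 1"
    "artanh (cmod \<alpha>) \<le> ln (16 / ((1 - cmod (k z)) * (1 - cmod (k w)))) / 2"
proof -
  have kz: "cmod (k z) < 1" and kw: "cmod (k w) < 1"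
    using kg(2) zw by auto
  define \<alpha> where "\<alpha> = Moebius_function 0 (k z) (k w)"
  define \<phi> where "\<phi> = g \<circ> Moebius_function 0 (- k z)"
  have \<alpha>1: "cmod \<alpha> < 1"
    unfolding \<alpha>_def using Moebius_function_norm_lt_1[OF kz kw] .
  have maps: "Moebius_function 0 (- k z) ` ball 0 1 \<subseteq> ball 0 1"
    using Moebius_function_norm_lt_1[of "- k z"] kz by auto
  have "1 - (cmod \<alpha>)\<^sup>2 = (1 - (cmod (k z))\<^sup>2) * (1 - (cmod (k w))\<^sup>2) / (cmod (1 - cnj (k z) * k w))\<^sup>2"
    unfolding \<alpha>_def using one_minus_Moebius_norm_square[OF kz kw] .
  moreover have "(1 - cmod (k z)) * (1 - cmod (k w)) / 4
      \<le> (1 - (cmod (k z))\<^sup>2) * (1 - (cmod (k w))\<^sup>2) / (cmod (1 - cnj (k z) * k w))\<^sup>2"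
  proof (rule frac_le)
    have sq: "1 - t \<le> 1 - t\<^sup>2" if "0 \<le> t" "t < 1" for t :: real
      using that by (simp add: power2_eq_square mult_left_le)
    show "(1 - cmod (k z)) * (1 - cmod (k w)) \<le> (1 - (cmod (k z))\<^sup>2) * (1 - (cmod (k w))\<^sup>2)"
      using kz kw sq[of "cmod (k z)"] sq[of "cmod (k w)"] by (intro mult_mono) (auto simp: power_le_one)
    show "0 \<le> (1 - (cmod (k z))\<^sup>2) * (1 - (cmod (k w))\<^sup>2)"
      using kz kw by (simp add: power_le_one)
    have lt: "cmod (cnj (k z) * k w) < 1"
      using norm_mult_less[of "cnj (k z)" 1 "k w" 1] kz kw by simp
    have "cmod (1 - cnj (k z) * k w) \<le> 2"
      using norm_triangle_ineq4[of 1 "cnj (k z) * k w"] lt by (simp del: complex_mod_cnj)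
    then show "(cmod (1 - cnj (k z) * k w))\<^sup>2 \<le> 4"
      using power_mono[of "cmod (1 - cnj (k z) * k w)" 2 2] by simp
    have "1 - cnj (k z) * k w \<noteq> 0"
      using lt by auto
    then show "0 < (cmod (1 - cnj (k z) * k w))\<^sup>2"
      by simp
  qed
  ultimately have le: "(1 - cmod (k z)) * (1 - cmod (k w)) / 4 \<le> 1 - (cmod \<alpha>)\<^sup>2"
    by simp
  have pos: "0 < (1 - cmod (k z)) * (1 - cmod (k w))"
    using kz kw by simp
  have "artanh (cmod \<alpha>) \<le> ln (4 / (1 - (cmod \<alpha>)\<^sup>2)) / 2"
    using artanh_le_half_ln \<alpha>1 by simp
  also have "\<dots> \<le> ln (4 / ((1 - cmod (k z)) * (1 - cmod (k w)) / 4)) / 2"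
  proof -
    have "4 / (1 - (cmod \<alpha>)\<^sup>2) \<le> 4 / ((1 - cmod (k z)) * (1 - cmod (k w)) / 4)"
      using le pos by (intro divide_left_mono) auto
    moreover have "0 < 4 / (1 - (cmod \<alpha>)\<^sup>2)"
      using le pos by simp
    ultimately show ?thesis
      using ln_mono by fastforce
  qed
  finally have "artanh (cmod \<alpha>) \<le> ln (16 / ((1 - cmod (k z)) * (1 - cmod (k w)))) / 2"
    by simp
  moreover have "\<phi> \<in> holo_maps (ball 0 1) D"
    unfolding holo_maps_def \<phi>_def
  proof (intro CollectI conjI)
    show "g \<circ> Moebius_function 0 (- k z) holomorphic_on ball 0 1"
      using holomorphic_on_compose_gen[OF Moebius_function_holomorphic kg(1) maps] kz by simp
    show "(g \<circ> Moebius_function 0 (- k z)) ` ball 0 1 \<subseteq> D"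
      using maps kg(3) G by fastforce
  qed
  moreover have "\<phi> 0 = z"
    using kg(2)[OF zw(1)] by (simp add: \<phi>_def Moebius_function_of_zero)
  moreover have "\<phi> \<alpha> = w"
    using Moebius_function_compose[of "- k z" "k z" "k w"] kz kw kg(2)[OF zw(2)] by (simp add: \<phi>_def \<alpha>_def)
  ultimately show thesis
    using that[of \<phi> \<alpha>] \<alpha>1 by simp
qed

text \<open>Compose \<open>F\<close> with the Cayley map that sends \<open>F z\<close> to 0. In the
  half plane, points of moduli \<open>b \<le> a\<close> have distance at least
  \<open>ln (a / b) / 2\<close>, attained on the real axis.\<close>

lemma half_plane_map:
  assumes F: "F holomorphic_on D" "\<And>x. x \<in> D \<Longrightarrow> 0 < Re (F x)" and zw: "z \<in> D" "w \<in> D"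
  obtains f where "f \<in> holo_maps D (ball 0 1)" "f z = 0" "ln (cmod (F w) / cmod (F z)) / 2 \<le> artanh (cmod (f w))"
proof -
  define f where "f x = (F x - F z) / (F x + cnj (F z))" for x
  have nz: "F x + cnj (F z) \<noteq> 0" if "x \<in> D" for x
    using F(2)[OF that] F(2)[OF zw(1)] by (auto simp: complex_eq_iff)
  have lt: "cmod (F x - F z) < cmod (F x + cnj (F z))" if "x \<in> D" for x
  proof (rule power2_less_imp_less)
    have "(cmod (F x + cnj (F z)))\<^sup>2 - (cmod (F x - F z))\<^sup>2 = 4 * (Re (F x) * Re (F z))"
      unfolding cmod_power2 by (simp add: algebra_simps power2_eq_square)
    moreover have "0 < Re (F x) * Re (F z)"
      using F(2)[OF that] F(2)[OF zw(1)] by simp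
    ultimately show "(cmod (F x - F z))\<^sup>2 < (cmod (F x + cnj (F z)))\<^sup>2"
      by linarith
  qed simp
  have f1: "cmod (f x) < 1" if "x \<in> D" for x
    using lt[OF that] nz[OF that] by (simp add: f_def norm_divide)
  have "f holomorphic_on D"
    unfolding f_def[abs_def] using nz by (intro holomorphic_intros F(1))
  then have "f \<in> holo_maps D (ball 0 1)"
    using f1 by (auto simp: holo_maps_def)
  moreover have "ln (cmod (F w) / cmod (F z)) / 2 \<le> artanh (cmod (f w))"
  proof -
    define a b where "a = cmod (F w)" and "b = cmod (F z)"
    have "F w \<noteq> 0" "F z \<noteq> 0"
      using F(2)[OF zw(1)] F(2)[OF zw(2)] by auto
    then have ab: "0 < a" "0 < b"
      by (auto simp: a_def b_def)
    define t where "t = (a - b) / (a + b)"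
    have t1: "t < 1"
      using ab by (simp add: t_def)
    have "(a - b) / (a + b) \<le> cmod (F w - F z) / cmod (F w + cnj (F z))" if "b \<le> a"
    proof (rule frac_le)
      show "a - b \<le> cmod (F w - F z)"
        unfolding a_def b_def by (rule norm_triangle_ineq2)
      show "cmod (F w + cnj (F z)) \<le> a + b"
        unfolding a_def b_def using norm_triangle_ineq[of "F w" "cnj (F z)"] by simp
    qed (use nz[OF zw(2)] that in auto)
    then have le: "t \<le> cmod (f w)" if "b \<le> a"
      using that by (simp add: t_def f_def norm_divide)
    show ?thesis
    proof (cases "b \<le> a")
      case True
      have "1 + t = 2 * a / (a + b)" "1 - t = 2 * b / (a + b)"
        using ab by (simp_all add: t_def field_simps)
      then have "(1 + t) / (1 - t) = a / b"
        using ab by simp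
      then have "ln (a / b) / 2 = artanh t"
        by (simp add: artanh_def)
      also have "\<dots> \<le> artanh (cmod (f w))"
        using artanh_mono[of t "cmod (f w)"] le[OF True] f1[OF zw(2)] True ab by (simp add: t_def)
      finally show ?thesis
        by (simp add: a_def b_def)
    next
      case False
      then have "ln (a / b) \<le> 0"
        using ab by (simp add: field_simps)
      moreover have "0 \<le> artanh (cmod (f w))"
        using artanh_mono[of 0 "cmod (f w)"] f1[OF zw(2)] by simp
      ultimately show ?thesis
        by (simp add: a_def b_def)
    qed
  qed
  ultimately show thesis
    using that[of f] by (simp add: f_def)
qed

text \<open>The power narrows the half plane to a sector of opening \<open>s * pi\<close>, in which
  the real part is comparable to the modulus.\<close>

lemma Re_powr_ge:
  assumes a: "0 < Re a" and s: "0 < s" "s < (1::real)"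
  shows "cmod (a powr of_real s) = cmod a powr s" "cos (s * pi / 2) * cmod (a powr of_real s) \<le> Re (a powr of_real s)"
proof -
  have a0: "a \<noteq> 0"
    using a by auto
  have im: "\<bar>Im (Ln a)\<bar> < pi / 2"
    using a Re_Ln_pos_lt[OF a0] by simp
  have eq: "a powr of_real s = exp (of_real s * Ln a)"
    using a0 by (simp add: powr_def)
  have re: "Re (Ln a) = ln (cmod a)"
    using a0 by simp
  show n: "cmod (a powr of_real s) = cmod a powr s"
    unfolding eq norm_exp_eq_Re using a0 re by (simp add: powr_def)
  have "Re (a powr of_real s) = exp (s * Re (Ln a)) * cos (s * Im (Ln a))"
    unfolding eq Re_exp by simp
  moreover have "cmod (a powr of_real s) = exp (s * Re (Ln a))"
    unfolding eq norm_exp_eq_Re by simp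
  moreover have "cos (s * pi / 2) \<le> cos (s * Im (Ln a))"
  proof -
    have "cos (s * pi / 2) \<le> cos \<bar>s * Im (Ln a)\<bar>"
    proof (rule cos_monotone_0_pi_le)
      show "\<bar>s * Im (Ln a)\<bar> \<le> s * pi / 2"
        using im s by (simp add: abs_mult)
      show "s * pi / 2 \<le> pi"
        using s by simp
    qed simp
    then show ?thesis
      by simp
  qed
  ultimately show "cos (s * pi / 2) * cmod (a powr of_real s) \<le> Re (a powr of_real s)"
    by simp
qed

text \<open>If \<open>Q\<close> is small, the term \<open>(1 + P) * cnj Q\<close> in
  \<open>(1 + P) * cnj (1 + Q)\<close> has modulus at most half of \<open>1 + Re P\<close>, because
  \<open>P\<close> lies in the sector. The case of small \<open>P\<close> follows by
  conjugation.\<close>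

lemma Re_divide_pos:
  assumes k: "0 < k" "k \<le> 1" and P: "k * cmod P \<le> Re P" and Q: "k * cmod Q \<le> Re Q"
    and small: "cmod P \<le> k / 2 \<or> cmod Q \<le> k / 2"
  shows "0 < Re ((1 + P) / (1 + Q))"
proof -
  have main: "0 < Re ((1 + P) * cnj (1 + Q))" if P: "k * cmod P \<le> Re P" and Q: "cmod Q \<le> k / 2" for P Q
  proof -
    have P0: "0 \<le> Re P"
      using P k by (meson less_imp_le mult_nonneg_nonneg norm_ge_zero order_trans)
    have "k * cmod (1 + P) \<le> k * (1 + cmod P)"
      using norm_triangle_ineq[of 1 P] k by (intro mult_left_mono) auto
    also have "\<dots> \<le> 1 + Re P"
      using P k by (simp add: algebra_simps)
    finally have X: "k * cmod (1 + P) \<le> 1 + Re P" .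
    have "cmod ((1 + P) * cnj Q) \<le> cmod (1 + P) * (k / 2)"
      unfolding norm_mult using Q by (intro mult_left_mono) auto
    moreover define Z where "Z = (1 + P) * cnj Q"
    ultimately have "cmod Z \<le> (1 + Re P) / 2"
      using X by (simp add: mult.commute)
    moreover have "- cmod Z \<le> Re Z"
      using abs_Re_le_cmod[of Z] by linarith
    ultimately have "(1 + Re P) / 2 \<le> (1 + Re P) + Re Z"
      by (simp add: field_simps)
    then have "0 < (1 + Re P) + Re Z"
      using P0 by auto
    also have "\<dots> = Re ((1 + P) * cnj (1 + Q))"
      by (simp add: Z_def algebra_simps)
    finally show ?thesis .
  qed
  have "0 < Re ((1 + P) * cnj (1 + Q))"
    using small
  proof
    assume "cmod P \<le> k / 2"
    then have "0 < Re ((1 + Q) * cnj (1 + P))"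
      using main[OF Q] by blast
    then show ?thesis
      by (simp add: algebra_simps)
  next
    assume "cmod Q \<le> k / 2"
    then show ?thesis
      using main[OF P] by blast
  qed
  moreover have "1 + Q \<noteq> 0"
  proof
    assume "1 + Q = 0"
    then have "Re Q = -1"
      by (metis Re_complex_of_real add_eq_0_iff minus_complex.sel(1) of_real_1 one_complex.sel(1) uminus_complex.sel(1))
    then show False
      using Q k by (smt (verit) mult_nonneg_nonneg norm_ge_zero)
  qed
  ultimately show ?thesis
    by (simp add: Re_divide' zero_less_divide_iff Re_complex_div_gt_0)
qed

text \<open>These are the witnesses that \<open>ratio_near_one\<close> asks for. With them the
  arguments on sequences never touch the supremum or the infimum.\<close>

definition almost_extremal :: "complex set \<Rightarrow> real \<Rightarrow> complex \<Rightarrow> complex \<Rightarrow> bool" where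
  "almost_extremal D e z w \<longleftrightarrow> (\<exists>f \<phi> \<alpha>. f \<in> holo_maps D (ball 0 1) \<and> f z = 0 \<and>
     \<phi> \<in> holo_maps (ball 0 1) D \<and> \<phi> 0 = z \<and> \<phi> \<alpha> = w \<and> \<alpha> \<in> ball 0 1 \<and>
     0 < artanh (cmod (f w)) \<and> (1 - e) * artanh (cmod \<alpha>) \<le> artanh (cmod (f w)))"

text \<open>As \<open>Y\<close> tends to infinity the additive constants lose their influence, and
  the ratio of the two bounds tends to \<open>s\<close>, which exceeds \<open>1 - e\<close>.\<close>

lemma eventually_almost_extremal:
  assumes e: "0 < e" "e < 1" "1 - e < s" and Y: "filterlim Y at_top sequentially"
    and up: "\<forall>\<^sub>F n in sequentially. \<exists>\<phi> \<alpha>. \<phi> \<in> holo_maps (ball 0 1) D \<and> \<phi> 0 = z n \<and> \<phi> \<alpha> = w n \<and>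
      \<alpha> \<in> ball 0 1 \<and> artanh (cmod \<alpha>) \<le> Y n + C1"
    and low: "\<forall>\<^sub>F n in sequentially. \<exists>f. f \<in> holo_maps D (ball 0 1) \<and> f (z n) = 0 \<and>
      s * Y n - C2 \<le> artanh (cmod (f (w n)))"
  shows "\<forall>\<^sub>F n in sequentially. almost_extremal D e (z n) (w n)"
proof -
  \<comment> \<open>The first entry ensures \<open>(1 - e) * (Y n + C1) \<le> s * Y n - C2\<close>,
    the second that the lower bound is at least 1.\<close>
  define K where "K = max (((1 - e) * C1 + C2) / (s - (1 - e))) ((C2 + 1) / s)"
  have "\<forall>\<^sub>F n in sequentially. K \<le> Y n"
    using Y filterlim_at_top by blast
  then show ?thesis
    using up low
  proof eventually_elim
    case (elim n)
    obtain \<phi> \<alpha> where \<phi>: "\<phi> \<in> holo_maps (ball 0 1) D" "\<phi> 0 = z n" "\<phi> \<alpha> = w n" "\<alpha> \<in> ball 0 1"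
      "artanh (cmod \<alpha>) \<le> Y n + C1"
      using elim(2) by blast
    obtain f where f: "f \<in> holo_maps D (ball 0 1)" "f (z n) = 0" "s * Y n - C2 \<le> artanh (cmod (f (w n)))"
      using elim(3) by blast
    have s: "0 < s" "0 < s - (1 - e)"
      using e by auto
    have "((1 - e) * C1 + C2) / (s - (1 - e)) \<le> Y n" "(C2 + 1) / s \<le> Y n"
      using elim(1) by (auto simp: K_def)
    then have 1: "(1 - e) * C1 + C2 \<le> Y n * (s - (1 - e))" and 2: "C2 + 1 \<le> Y n * s"
      using s by (simp_all add: pos_divide_le_eq)
    have "(1 - e) * artanh (cmod \<alpha>) \<le> (1 - e) * (Y n + C1)"
      using \<phi>(5) e by (intro mult_left_mono) auto
    also have "\<dots> \<le> s * Y n - C2"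
      using 1 by (simp add: algebra_simps)
    finally have "(1 - e) * artanh (cmod \<alpha>) \<le> artanh (cmod (f (w n)))"
      using f(3) by linarith
    moreover have "0 < artanh (cmod (f (w n)))"
      using 2 f(3) by (simp add: mult.commute)
    ultimately show ?case
      unfolding almost_extremal_def using f \<phi> by blast
  qed
qed

lemma filterlim_half_ln_inverse:
  assumes "d \<longlonglongrightarrow> 0" "\<And>n. 0 < (d n :: real)"
  shows "filterlim (\<lambda>n. ln (1 / d n) / 2) at_top sequentially"
proof -
  have "filterlim d (at_right 0) sequentially"
    using assms by (intro tendsto_imp_filterlim_at_right) auto
  then have "filterlim (\<lambda>n. inverse (d n)) at_top sequentially"
    using filterlim_compose[OF filterlim_inverse_at_top_right] by blast
  then have "filterlim (\<lambda>n. ln (inverse (d n))) at_top sequentially"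
    using filterlim_compose[OF ln_at_top] by blast
  then have "filterlim (\<lambda>n. (1 / 2) * ln (inverse (d n))) at_top sequentially"
    by (intro filterlim_tendsto_pos_mult_at_top[OF tendsto_const]) auto
  then show ?thesis
    by (simp add: inverse_eq_divide)
qed

lemma half_ln_16_le:
  assumes "0 < A" "0 < B" "0 < c" "c * d \<le> A * B" "0 < (d::real)"
  shows "ln (16 / (A * B)) / 2 \<le> ln (1 / d) / 2 + ln (16 / c) / 2"
proof -
  have "16 / (A * B) \<le> 16 / (c * d)"
    using assms by (intro divide_left_mono) auto
  moreover have "0 < 16 / (A * B)"
    using assms by simp
  ultimately have "ln (16 / (A * B)) \<le> ln (16 / (c * d))"
    using ln_mono by fastforce
  also have "16 / (c * d) = (1 / d) * (16 / c)"
    by simp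
  also have "ln ((1 / d) * (16 / c)) = ln (1 / d) + ln (16 / c)"
    using assms by (intro ln_mult_pos) auto
  finally show ?thesis
    by simp
qed

lemma (in boundary_chart) Moebius_competitor:
  assumes "z \<in> D"
  shows "Moebius_function 0 (\<psi> z) \<circ> \<psi> \<in> holo_maps D (ball 0 1)" "(Moebius_function 0 (\<psi> z) \<circ> \<psi>) z = 0"
proof -
  have \<psi>D: "\<psi> ` D \<subseteq> ball 0 1"
    using \<psi>_disc by auto
  have z: "cmod (\<psi> z) < 1"
    using \<psi>_disc assms by blast
  have "Moebius_function 0 (\<psi> z) \<circ> \<psi> holomorphic_on D"
    using holomorphic_on_compose_gen[OF \<psi>_holomorphic Moebius_function_holomorphic[OF z] \<psi>D] .
  then show "Moebius_function 0 (\<psi> z) \<circ> \<psi> \<in> holo_maps D (ball 0 1)"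
    using Moebius_function_norm_lt_1[OF z] \<psi>_disc by (auto simp: holo_maps_def)
  show "(Moebius_function 0 (\<psi> z) \<circ> \<psi>) z = 0"
    by (simp add: Moebius_function_eq_zero)
qed

lemma (in boundary_chart) almost_extremal_interior:
  assumes conn: "connected D" and zw: "\<And>n. z n \<in> D" "\<And>n. w n \<in> D" and q: "z \<longlonglongrightarrow> q" "q \<in> D"
    and u: "(\<lambda>n. \<psi> (w n)) \<longlonglongrightarrow> u" "cmod u = 1" and e: "0 < e" "e < 1"
  shows "\<forall>\<^sub>F n in sequentially. almost_extremal D e (z n) (w n)"
proof -
  obtain G \<delta> where G: "open G" "simply_connected G" "G \<subseteq> D" "q \<in> G"
    and \<delta>: "\<delta> > 0" "ball u \<delta> \<inter> ball 0 1 \<subseteq> outer_ring r" "h ` (ball u \<delta> \<inter> ball 0 1) \<subseteq> G"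
    using region_to_boundary_point[OF conn u(2) q(2)] by blast
  have "G \<noteq> UNIV"
    using bounded_subset[OF bounded_domain G(3)] not_bounded_UNIV by blast
  then obtain k g where kg: "k holomorphic_on G" "g holomorphic_on ball 0 1"
    "\<And>z. z \<in> G \<Longrightarrow> k z \<in> ball 0 1 \<and> g (k z) = z" "\<And>z. z \<in> ball 0 1 \<Longrightarrow> g z \<in> G \<and> k (g z) = z"
    using Riemann_mapping_theorem[of G] G by blast
  have kG: "k ` G \<subseteq> ball 0 1"
    using kg(3) by blast
  obtain c where c: "c > 0" "\<forall>\<^sub>F n in sequentially. w n \<in> G \<and> c * (1 - cmod (\<psi> (w n))) \<le> 1 - cmod (k (w n))"
    using Hopf_estimate[OF G(1) kg(1) kG u(2) \<delta> zw(2) u(1)] by blast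
  have "isCont k q"
    using kg(1) G(1,4) by (metis holomorphic_on_imp_continuous_on continuous_on_eq_continuous_at)
  then have klim: "(\<lambda>n. cmod (k (z n))) \<longlonglongrightarrow> cmod (k q)"
    using tendsto_norm[OF isCont_tendsto_compose[OF _ q(1)]] by blast
  obtain A where A: "cmod (k q) < A" "A < 1"
    using dense[of "cmod (k q)" 1] kg(3)[OF G(4)] by auto
  have evk: "\<forall>\<^sub>F n in sequentially. cmod (k (z n)) < A"
    using order_tendstoD(2)[OF klim A(1)] .
  have evG: "\<forall>\<^sub>F n in sequentially. z n \<in> G"
    using topological_tendstoD[OF q(1) G(1,4)] .
  have "isCont \<psi> q"
    using \<psi>_continuous open_domain q(2) continuous_on_eq_continuous_at by blast
  then have \<psi>lim: "(\<lambda>n. cmod (\<psi> (z n))) \<longlonglongrightarrow> cmod (\<psi> q)"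
    using tendsto_norm[OF isCont_tendsto_compose[OF _ q(1)]] by blast
  obtain B where B: "cmod (\<psi> q) < B" "B < 1"
    using dense[of "cmod (\<psi> q)" 1] \<psi>_disc[OF q(2)] by auto
  have ev\<psi>: "\<forall>\<^sub>F n in sequentially. cmod (\<psi> (z n)) < B"
    using order_tendstoD(2)[OF \<psi>lim B(1)] .
  define d where "d n = 1 - cmod (\<psi> (w n))" for n
  have dpos: "0 < d n" for n
    using \<psi>_disc[OF zw(2)] by (simp add: d_def)
  have "(\<lambda>n. 1 - cmod (\<psi> (w n))) \<longlonglongrightarrow> 1 - cmod u"
    by (intro tendsto_intros u)
  then have d0: "d \<longlonglongrightarrow> 0"
    using u(2) by (simp add: d_def[abs_def])
  define Y where "Y n = ln (1 / d n) / 2" for n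
  have Y: "filterlim Y at_top sequentially"
    unfolding Y_def[abs_def] using filterlim_half_ln_inverse[OF d0 dpos] .
  \<comment> \<open>The slope \<open>s\<close> is 1 here: both bounds agree with \<open>Y\<close> up
    to constants.\<close>
  have e1: "1 - e < 1"
    using e by simp
  show ?thesis
  proof (rule eventually_almost_extremal[OF e e1 Y])
    show "\<forall>\<^sub>F n in sequentially. \<exists>\<phi> \<alpha>. \<phi> \<in> holo_maps (ball 0 1) D \<and> \<phi> 0 = z n \<and> \<phi> \<alpha> = w n \<and>
      \<alpha> \<in> ball 0 1 \<and> artanh (cmod \<alpha>) \<le> Y n + ln (16 / ((1 - A) * c)) / 2"
      using c(2) evk evG
    proof eventually_elim
      case (elim n)
      obtain \<phi> \<alpha> where \<phi>: "\<phi> \<in> holo_maps (ball 0 1) D" "\<phi> 0 = z n" "\<phi> \<alpha> = w n" "\<alpha> \<in> ball 0 1"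
        "artanh (cmod \<alpha>) \<le> ln (16 / ((1 - cmod (k (z n))) * (1 - cmod (k (w n))))) / 2"
        using Riemann_map_disc_through[OF kg(2,3) _ G(3), of "z n" "w n"] kg(4) elim by blast
      have "((1 - A) * c) * d n \<le> (1 - cmod (k (z n))) * (1 - cmod (k (w n)))"
      proof -
        have "(1 - A) * (c * d n) \<le> (1 - cmod (k (z n))) * (1 - cmod (k (w n)))"
          using elim A c(1) dpos[of n] by (intro mult_mono) (auto simp: d_def)
        then show ?thesis
          by (simp add: mult.assoc)
      qed
      moreover have "0 < 1 - cmod (k (z n))" "0 < 1 - cmod (k (w n))"
        using kg(3)[of "z n"] kg(3)[of "w n"] elim by auto
      ultimately have "artanh (cmod \<alpha>) \<le> Y n + ln (16 / ((1 - A) * c)) / 2"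
        using half_ln_16_le[of "1 - cmod (k (z n))" "1 - cmod (k (w n))" "(1 - A) * c" "d n"] A c(1) dpos[of n] \<phi>(5)
        by (simp add: Y_def)
      then show ?case
        using \<phi> by blast
    qed
    show "\<forall>\<^sub>F n in sequentially. \<exists>f. f \<in> holo_maps D (ball 0 1) \<and> f (z n) = 0 \<and>
      1 * Y n - ln (4 / (1 - B)\<^sup>2) / 2 \<le> artanh (cmod (f (w n)))"
      using ev\<psi>
    proof eventually_elim
      case (elim n)
      define a b where "a = \<psi> (z n)" and "b = \<psi> (w n)"
      have ab: "cmod a < 1" "cmod b < 1"
        using \<psi>_disc zw by (auto simp: a_def b_def)
      have "cmod (cnj a * b) \<le> cmod a * 1"
        unfolding norm_mult complex_mod_cnj using ab by (intro mult_left_mono) auto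
      then have "1 - B \<le> cmod (1 - cnj a * b)"
        using norm_triangle_ineq2[of 1 "cnj a * b"] elim by (simp add: a_def)
      then have "ln (1 / ((1 - cmod a) * d n)) / 2 - ln (4 / (1 - B)\<^sup>2) / 2 \<le> artanh (cmod (Moebius_function 0 a b))"
        using artanh_Moebius_ge[OF ab, of "1 - B"] B(2) by (simp add: d_def b_def)
      moreover have "1 / d n \<le> 1 / ((1 - cmod a) * d n)"
        using ab(1) dpos[of n] by (intro divide_left_mono) (auto simp: mult_le_cancel_right1)
      then have "ln (1 / d n) \<le> ln (1 / ((1 - cmod a) * d n))"
        using dpos[of n] by (intro ln_mono) auto
      ultimately have "1 * Y n - ln (4 / (1 - B)\<^sup>2) / 2 \<le> artanh (cmod (Moebius_function 0 a b))"
        unfolding Y_def by linarith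
      then show ?case
        using Moebius_competitor[OF zw(1), of n] by (auto simp: a_def b_def)
    qed
  qed
qed

text \<open>With \<open>A\<close> and \<open>B\<close> the Cayley transforms of \<open>\<psi>0\<close> and \<open>\<psi>1\<close> that have their poles in the directions of \<open>w\<close> and \<open>z\<close>,
  the function \<open>(1 + \<eta> A\<^sup>s) / (1 + \<eta> B\<^sup>s)\<close> maps into the right half plane, because \<open>A\<close> and \<open>B\<close> are never large at the
  same point. It is large at \<open>w\<close> and small at \<open>z\<close>.\<close>

lemma separating_map_to_disc:
  assumes hol: "\<psi>0 holomorphic_on D" "\<psi>1 holomorphic_on D"
    and disc: "\<And>x. x \<in> D \<Longrightarrow> cmod (\<psi>0 x) < 1" "\<And>x. x \<in> D \<Longrightarrow> cmod (\<psi>1 x) < 1"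
    and \<rho>: "0 < \<rho>" "\<rho> < 1" "\<And>x. x \<in> D \<Longrightarrow> \<rho> < cmod (\<psi>0 x) \<Longrightarrow> cmod (\<psi>1 x) \<le> \<rho>" and s: "0 < s" "s < 1"
  obtains C where "\<And>z w. z \<in> D \<Longrightarrow> w \<in> D \<Longrightarrow> \<rho> < cmod (\<psi>1 z) \<Longrightarrow> \<rho> < cmod (\<psi>0 w) \<Longrightarrow>
    \<exists>f. f \<in> holo_maps D (ball 0 1) \<and> f z = 0 \<and>
      s * (ln (1 / ((1 - cmod (\<psi>0 w)) * (1 - cmod (\<psi>1 z)))) / 2) - C \<le> artanh (cmod (f w))"
proof -
  define k where "k = cos (s * pi / 2)"
  have k: "0 < k" "k \<le> 1"
    unfolding k_def using s by (auto intro!: cos_gt_zero_pi simp: field_simps)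
      (smt (verit) mult_nonneg_nonneg pi_gt_zero)
  \<comment> \<open>\<open>M\<close> bounds the Cayley transform on \<open>|y| \<le> \<rho>\<close>,
    and \<open>\<eta>\<close> scales its power there down to \<open>k / 2\<close>, the smallness in
    \<open>Re_divide_pos\<close>. That \<open>k\<close> is positive requires
    \<open>s < 1\<close>.\<close>
  define M where "M = 2 / (1 - \<rho>)"
  have M: "0 < M"
    using \<rho> by (simp add: M_def)
  define \<eta> where "\<eta> = k / (2 * M powr s)"
  have \<eta>: "0 < \<eta>" "\<eta> * M powr s = k / 2"
    using k M by (auto simp: \<eta>_def)
  define cayley where "cayley v y = (v + y) / (v - y)" for v y :: complex
  define P where "P v y = of_real \<eta> * (cayley v y) powr (of_real s)" for v y
  have cayley: "0 < Re (cayley v y)" if "cmod v = 1" "cmod y < 1" for v y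
  proof -
    have "0 < (cmod v)\<^sup>2 - (cmod y)\<^sup>2"
      using that by (simp add: power_less_one_iff)
    also have "\<dots> = Re ((v + y) * cnj (v - y))"
      unfolding cmod_power2 by (simp add: algebra_simps power2_eq_square)
    finally have "0 < Re ((v + y) * cnj (v - y))" .
    then show ?thesis
      unfolding cayley_def Re_complex_div_gt_0 .
  qed
  have P_sector: "k * cmod (P v y) \<le> Re (P v y)" if "cmod v = 1" "cmod y < 1" for v y
  proof -
    have "k * cmod (cayley v y powr of_real s) \<le> Re (cayley v y powr of_real s)"
      unfolding k_def using Re_powr_ge(2)[OF cayley[OF that] s] .
    then have "\<eta> * (k * cmod (cayley v y powr of_real s)) \<le> \<eta> * Re (cayley v y powr of_real s)"
      using \<eta> by (intro mult_left_mono) auto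
    then show ?thesis
      using \<eta> by (simp add: P_def norm_mult ac_simps)
  qed
  have cmodP: "cmod (P v y) = \<eta> * cmod (cayley v y) powr s" if "cmod v = 1" "cmod y < 1" for v y
    using Re_powr_ge(1)[OF cayley[OF that] s] \<eta> by (simp add: P_def norm_mult)
  have P_small: "cmod (P v y) \<le> k / 2" if "cmod v = 1" "cmod y \<le> \<rho>" for v y
  proof -
    have "cmod (cayley v y) \<le> M"
      unfolding cayley_def norm_divide M_def
    proof (rule frac_le)
      show "cmod (v + y) \<le> 2"
        using norm_triangle_ineq[of v y] that \<rho> by linarith
      show "1 - \<rho> \<le> cmod (v - y)"
        using norm_triangle_ineq2[of v y] that by linarith
    qed (use \<rho> in auto)
    then have "\<eta> * cmod (cayley v y) powr s \<le> \<eta> * M powr s"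
      using \<eta> s by (intro mult_left_mono powr_mono2) auto
    then show ?thesis
      using cmodP[of v y] that \<rho> \<eta> by simp
  qed
  \<comment> \<open>On its own ray the Cayley transform is the positive number
    \<open>(1 + cmod y) / (1 - cmod y)\<close>.\<close>
  have P_large: "\<eta> * (1 / (1 - cmod y)) powr s \<le> cmod (P v y)" if y: "cmod y < 1" "0 < cmod y" "v = y / of_real (cmod y)" for v y
  proof -
    have v: "cmod v = 1"
      using y by (simp add: norm_divide)
    have "y = of_real (cmod y) * v"
      using y by auto
    then have "cayley v y = (of_real (1 + cmod y) * v) / (of_real (1 - cmod y) * v)"
      unfolding cayley_def by (simp add: algebra_simps)
    then have "cmod (cayley v y) = (1 + cmod y) / (1 - cmod y)"
      using v y by (simp add: norm_mult norm_divide del: of_real_add of_real_diff)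
    then have "1 / (1 - cmod y) \<le> cmod (cayley v y)"
      using y by (simp add: divide_right_mono)
    then have "\<eta> * (1 / (1 - cmod y)) powr s \<le> \<eta> * cmod (cayley v y) powr s"
      using \<eta> s y by (intro mult_left_mono powr_mono2) auto
    then show ?thesis
      using cmodP[OF v y(1)] by simp
  qed
  have hol_P: "(\<lambda>x. P v (\<psi> x)) holomorphic_on D" if "cmod v = 1" "\<psi> holomorphic_on D" "\<And>x. x \<in> D \<Longrightarrow> cmod (\<psi> x) < 1" for v \<psi>
  proof -
    have "v - \<psi> x \<noteq> 0" if "x \<in> D" for x
      using \<open>cmod v = 1\<close> \<open>\<And>x. x \<in> D \<Longrightarrow> cmod (\<psi> x) < 1\<close>[OF that] by auto
    then have 1: "(\<lambda>x. cayley v (\<psi> x)) holomorphic_on D"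
      unfolding cayley_def using that(2) by (intro holomorphic_intros) auto
    have "cayley v (\<psi> x) \<notin> \<real>\<^sub>\<le>\<^sub>0" if "x \<in> D" for x
      using cayley[OF \<open>cmod v = 1\<close> \<open>\<And>x. x \<in> D \<Longrightarrow> cmod (\<psi> x) < 1\<close>[OF that]] by (auto simp: complex_nonpos_Reals_iff)
    then show ?thesis
      unfolding P_def using 1 by (intro holomorphic_intros) auto
  qed
  have one_plus: "k * cmod Q \<le> cmod (1 + Q)" "1 + Q \<noteq> 0" if "k * cmod Q \<le> Re Q" for Q
  proof -
    have "0 \<le> Re Q"
      using that k by (meson less_imp_le mult_nonneg_nonneg norm_ge_zero order_trans)
    moreover have "1 + Re Q \<le> cmod (1 + Q)"
      using complex_Re_le_cmod[of "1 + Q"] by simp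
    ultimately show "k * cmod Q \<le> cmod (1 + Q)" "1 + Q \<noteq> 0"
      using that by auto
  qed
  \<comment> \<open>Each of \<open>|X w| / |X' w|\<close> and \<open>|X' z| / |X z|\<close> loses a
    factor \<open>k * \<eta> / 2\<close>; the halving in \<open>half_plane_map\<close> turns the two
    losses into one \<open>C\<close>.\<close>
  define C where "C = - ln (k * \<eta> / 2)"
  show thesis
  proof
    fix z w assume zw: "z \<in> D" "w \<in> D" and far: "\<rho> < cmod (\<psi>1 z)" "\<rho> < cmod (\<psi>0 w)"
    define v where "v = \<psi>0 w / of_real (cmod (\<psi>0 w))"
    define v' where "v' = \<psi>1 z / of_real (cmod (\<psi>1 z))"
    have v: "cmod v = 1" "cmod v' = 1"
      using far \<rho> by (auto simp: v_def v'_def norm_divide)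
    define X where "X x = 1 + P v (\<psi>0 x)" for x
    define X' where "X' x = 1 + P v' (\<psi>1 x)" for x
    have sec: "k * cmod (P v (\<psi>0 x)) \<le> Re (P v (\<psi>0 x))" "k * cmod (P v' (\<psi>1 x)) \<le> Re (P v' (\<psi>1 x))" if "x \<in> D" for x
      using P_sector v disc[OF that] by auto
    have X0: "X x \<noteq> 0" "X' x \<noteq> 0" if "x \<in> D" for x
      using one_plus(2) sec[OF that] by (auto simp: X_def X'_def)
    have "(\<lambda>x. X x / X' x) holomorphic_on D"
      unfolding X_def X'_def
      using hol_P[OF v(1) hol(1) disc(1)] hol_P[OF v(2) hol(2) disc(2)] X0(2)
      by (intro holomorphic_intros) (auto simp: X'_def)
    moreover have "0 < Re (X x / X' x)" if "x \<in> D" for x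
      unfolding X_def X'_def
    proof (rule Re_divide_pos[OF k sec[OF that]])
      have "cmod (\<psi>0 x) \<le> \<rho> \<or> cmod (\<psi>1 x) \<le> \<rho>"
        using \<rho>(3)[OF that] by linarith
      then show "cmod (P v (\<psi>0 x)) \<le> k / 2 \<or> cmod (P v' (\<psi>1 x)) \<le> k / 2"
        using P_small v by blast
    qed
    ultimately obtain f where f: "f \<in> holo_maps D (ball 0 1)" "f z = 0"
      "ln (cmod (X w / X' w) / cmod (X z / X' z)) / 2 \<le> artanh (cmod (f w))"
      using half_plane_map[of "\<lambda>x. X x / X' x" D z w] zw by blast
    define a b where "a = 1 - cmod (\<psi>0 w)" and "b = 1 - cmod (\<psi>1 z)"
    have ab: "0 < a" "0 < b"
      using disc zw by (auto simp: a_def b_def)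
    have bound2: "cmod (1 + Q) \<le> 2" if "cmod Q \<le> k / 2" for Q
      using norm_triangle_ineq[of 1 Q] that k by simp
    have "cmod (\<psi>1 w) \<le> \<rho>"
      using \<rho>(3)[OF zw(2)] far by blast
    then have 1: "cmod (X' w) \<le> 2"
      unfolding X'_def using P_small[OF v(2)] bound2 by blast
    have "cmod (\<psi>0 z) \<le> \<rho>"
      using \<rho>(3)[OF zw(1)] far by linarith
    then have 2: "cmod (X z) \<le> 2"
      unfolding X_def using P_small[OF v(1)] bound2 by blast
    have 3: "k * \<eta> * (1 / a) powr s \<le> cmod (X w)"
    proof -
      have "\<eta> * (1 / a) powr s \<le> cmod (P v (\<psi>0 w))"
        unfolding a_def using P_large[OF disc(1)[OF zw(2)] _ v_def] far(2) \<rho>(1) by linarith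
      then have "k * (\<eta> * (1 / a) powr s) \<le> k * cmod (P v (\<psi>0 w))"
        using k by (intro mult_left_mono) auto
      then show ?thesis
        using one_plus(1)[OF sec(1)[OF zw(2)]] by (simp add: X_def mult.assoc)
    qed
    have 4: "k * \<eta> * (1 / b) powr s \<le> cmod (X' z)"
    proof -
      have "\<eta> * (1 / b) powr s \<le> cmod (P v' (\<psi>1 z))"
        unfolding b_def using P_large[OF disc(2)[OF zw(1)] _ v'_def] far(1) \<rho>(1) by linarith
      then have "k * (\<eta> * (1 / b) powr s) \<le> k * cmod (P v' (\<psi>1 z))"
        using k by (intro mult_left_mono) auto
      then show ?thesis
        using one_plus(1)[OF sec(2)[OF zw(1)]] by (simp add: X'_def mult.assoc)
    qed
    have pos: "0 < cmod (X x)" "0 < cmod (X' x)" if "x \<in> D" for x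
      using X0[OF that] by auto
    have ke: "0 < k * \<eta>"
      using k \<eta> by simp
    have q1: "(k * \<eta> / 2) * (1 / a) powr s \<le> cmod (X w) / cmod (X' w)"
    proof -
      have "k * \<eta> * (1 / a) powr s / 2 \<le> cmod (X w) / cmod (X' w)"
        using 3 1 pos[OF zw(2)] ke by (intro frac_le) auto
      then show ?thesis
        by simp
    qed
    have q2: "(k * \<eta> / 2) * (1 / b) powr s \<le> cmod (X' z) / cmod (X z)"
    proof -
      have "k * \<eta> * (1 / b) powr s / 2 \<le> cmod (X' z) / cmod (X z)"
        using 4 2 pos[OF zw(1)] ke by (intro frac_le) auto
      then show ?thesis
        by simp
    qed
    have p: "0 < (k * \<eta> / 2) * (1 / a) powr s" "0 < (k * \<eta> / 2) * (1 / b) powr s"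
      using ke ab by auto
    have l1: "- C + s * ln (1 / a) \<le> ln (cmod (X w) / cmod (X' w))"
    proof -
      have "ln ((k * \<eta> / 2) * (1 / a) powr s) \<le> ln (cmod (X w) / cmod (X' w))"
        using q1 p(1) by (intro ln_mono) auto
      moreover have "ln ((k * \<eta> / 2) * (1 / a) powr s) = - C + s * ln (1 / a)"
        using ke ab by (subst ln_mult_pos) (auto simp: C_def ln_powr)
      ultimately show ?thesis
        by simp
    qed
    have l2: "- C + s * ln (1 / b) \<le> ln (cmod (X' z) / cmod (X z))"
    proof -
      have "ln ((k * \<eta> / 2) * (1 / b) powr s) \<le> ln (cmod (X' z) / cmod (X z))"
        using q2 p(2) by (intro ln_mono) auto
      moreover have "ln ((k * \<eta> / 2) * (1 / b) powr s) = - C + s * ln (1 / b)"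
        using ke ab by (subst ln_mult_pos) (auto simp: C_def ln_powr)
      ultimately show ?thesis
        by simp
    qed
    have "cmod (X w / X' w) / cmod (X z / X' z) = (cmod (X w) / cmod (X' w)) * (cmod (X' z) / cmod (X z))"
      by (simp add: norm_divide)
    moreover have "ln ((cmod (X w) / cmod (X' w)) * (cmod (X' z) / cmod (X z)))
        = ln (cmod (X w) / cmod (X' w)) + ln (cmod (X' z) / cmod (X z))"
      using pos zw by (intro ln_mult_pos) auto
    moreover have "ln (1 / (a * b)) = ln (1 / a) + ln (1 / b)"
      using ab by (simp add: ln_div ln_mult)
    ultimately have "s * (ln (1 / (a * b)) / 2) - C \<le> artanh (cmod (f w))"
      using l1 l2 f(3) by (simp add: algebra_simps)
    then show "\<exists>f. f \<in> holo_maps D (ball 0 1) \<and> f z = 0 \<and>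
      s * (ln (1 / ((1 - cmod (\<psi>0 w)) * (1 - cmod (\<psi>1 z)))) / 2) - C \<le> artanh (cmod (f w))"
      using f by (auto simp: a_def b_def)
  qed
qed

lemma almost_extremal_two_components:
  assumes c0: "boundary_chart D C0 \<psi>0 h0 r0" and c1: "boundary_chart D C1 \<psi>1 h1 r1" and disj: "C0 \<inter> C1 = {}"
    and conn: "connected D" and zw: "\<And>n. z n \<in> D" "\<And>n. w n \<in> D"
    and u0: "(\<lambda>n. \<psi>0 (w n)) \<longlonglongrightarrow> u0" "cmod u0 = 1" and u1: "(\<lambda>n. \<psi>1 (z n)) \<longlonglongrightarrow> u1" "cmod u1 = 1"
    and e: "0 < e" "e < 1"
  shows "\<forall>\<^sub>F n in sequentially. almost_extremal D e (z n) (w n)"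
proof -
  interpret c0: boundary_chart D C0 \<psi>0 h0 r0 by fact
  interpret c1: boundary_chart D C1 \<psi>1 h1 r1 by fact
  obtain G \<delta> where G: "open G" "simply_connected G" "G \<subseteq> D" and \<delta>: "\<delta> > 0"
    and \<delta>0: "ball u0 \<delta> \<inter> ball 0 1 \<subseteq> outer_ring r0" "h0 ` (ball u0 \<delta> \<inter> ball 0 1) \<subseteq> G"
    and \<delta>1: "ball u1 \<delta> \<inter> ball 0 1 \<subseteq> outer_ring r1" "h1 ` (ball u1 \<delta> \<inter> ball 0 1) \<subseteq> G"
    by (rule region_between_boundary_points[OF c0 c1 disj conn u0(2) u1(2)])
  have ne: "ball u \<delta> \<inter> ball 0 1 \<noteq> {}" if "cmod u = 1" for u :: complex
  proof -
    define t where "t = 1 - min \<delta> 1 / 2"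
    have t: "0 < t" "t < 1" "1 - t < \<delta>"
      using \<delta> by (auto simp: t_def)
    have "dist u (of_real t * u) = cmod (of_real (1 - t) * u)"
      by (simp add: dist_norm algebra_simps)
    also have "\<dots> = 1 - t"
      using t that by (simp add: norm_mult del: of_real_diff)
    finally have "of_real t * u \<in> ball u \<delta> \<inter> ball 0 1"
      using t that by (simp add: norm_mult)
    then show ?thesis
      by blast
  qed
  have "G \<noteq> UNIV"
    using bounded_subset[OF c0.bounded_domain G(3)] not_bounded_UNIV by blast
  moreover have "G \<noteq> {}"
    using ne[OF u0(2)] \<delta>0(2) by blast
  ultimately obtain k g where kg: "k holomorphic_on G" "g holomorphic_on ball 0 1"
    "\<And>z. z \<in> G \<Longrightarrow> k z \<in> ball 0 1 \<and> g (k z) = z" "\<And>z. z \<in> ball 0 1 \<Longrightarrow> g z \<in> G \<and> k (g z) = z"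
    using Riemann_mapping_theorem[of G] G by blast
  have kG: "k ` G \<subseteq> ball 0 1"
    using kg(3) by blast
  obtain a where a: "a > 0" "\<forall>\<^sub>F n in sequentially. w n \<in> G \<and> a * (1 - cmod (\<psi>0 (w n))) \<le> 1 - cmod (k (w n))"
    using c0.Hopf_estimate[OF G(1) kg(1) kG u0(2) \<delta> \<delta>0 zw(2) u0(1)] by blast
  obtain b where b: "b > 0" "\<forall>\<^sub>F n in sequentially. z n \<in> G \<and> b * (1 - cmod (\<psi>1 (z n))) \<le> 1 - cmod (k (z n))"
    using c1.Hopf_estimate[OF G(1) kg(1) kG u1(2) \<delta> \<delta>1 zw(1) u1(1)] by blast
  obtain \<rho>' where \<rho>': "\<rho>' < 1" "\<And>x. x \<in> D \<Longrightarrow> \<rho>' < cmod (\<psi>0 x) \<Longrightarrow> cmod (\<psi>1 x) \<le> \<rho>'"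
    using boundary_charts_disjoint[OF c0 c1 disj] by blast
  \<comment> \<open>The maximum with 1/2 makes the bound positive, so that above it
    \<open>\<psi>0 w\<close> and \<open>\<psi>1 z\<close> are nonzero and have directions.\<close>
  define \<rho> where "\<rho> = max \<rho>' (1 / 2)"
  have \<rho>: "0 < \<rho>" "\<rho> < 1" "\<And>x. x \<in> D \<Longrightarrow> \<rho> < cmod (\<psi>0 x) \<Longrightarrow> cmod (\<psi>1 x) \<le> \<rho>"
    using \<rho>'(1) \<rho>'(2) by (fastforce simp: \<rho>_def)+
  \<comment> \<open>The exponent must lie below 1 for the peak functions and above
    \<open>1 - e\<close> for \<open>eventually_almost_extremal\<close>; this is the
    midpoint.\<close>
  define s where "s = 1 - e / 2"
  have s: "0 < s" "s < 1" "1 - e < s"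
    using e by (auto simp: s_def)
  obtain C where C: "\<And>z w. z \<in> D \<Longrightarrow> w \<in> D \<Longrightarrow> \<rho> < cmod (\<psi>1 z) \<Longrightarrow> \<rho> < cmod (\<psi>0 w) \<Longrightarrow>
    \<exists>f. f \<in> holo_maps D (ball 0 1) \<and> f z = 0 \<and>
      s * (ln (1 / ((1 - cmod (\<psi>0 w)) * (1 - cmod (\<psi>1 z)))) / 2) - C \<le> artanh (cmod (f w))"
    using separating_map_to_disc[OF c0.\<psi>_holomorphic c1.\<psi>_holomorphic c0.\<psi>_disc c1.\<psi>_disc \<rho> s(1,2)] by blast
  have m0: "(\<lambda>n. cmod (\<psi>0 (w n))) \<longlonglongrightarrow> 1" and m1: "(\<lambda>n. cmod (\<psi>1 (z n))) \<longlonglongrightarrow> 1"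
    using tendsto_norm[OF u0(1)] tendsto_norm[OF u1(1)] u0(2) u1(2) by auto
  define d where "d n = (1 - cmod (\<psi>0 (w n))) * (1 - cmod (\<psi>1 (z n)))" for n
  have dpos: "0 < d n" for n
    using c0.\<psi>_disc[OF zw(2)] c1.\<psi>_disc[OF zw(1)] by (simp add: d_def)
  have "(\<lambda>n. (1 - cmod (\<psi>0 (w n))) * (1 - cmod (\<psi>1 (z n)))) \<longlonglongrightarrow> (1 - 1) * (1 - 1)"
    by (intro tendsto_intros m0 m1)
  then have d0: "d \<longlonglongrightarrow> 0"
    by (simp add: d_def[abs_def])
  define Y where "Y n = ln (1 / d n) / 2" for n
  have Y: "filterlim Y at_top sequentially"
    unfolding Y_def[abs_def] using filterlim_half_ln_inverse[OF d0 dpos] .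
  show ?thesis
  proof (rule eventually_almost_extremal[OF e s(3) Y])
    show "\<forall>\<^sub>F n in sequentially. \<exists>\<phi> \<alpha>. \<phi> \<in> holo_maps (ball 0 1) D \<and> \<phi> 0 = z n \<and> \<phi> \<alpha> = w n \<and>
      \<alpha> \<in> ball 0 1 \<and> artanh (cmod \<alpha>) \<le> Y n + ln (16 / (b * a)) / 2"
      using a(2) b(2)
    proof eventually_elim
      case (elim n)
      obtain \<phi> \<alpha> where \<phi>: "\<phi> \<in> holo_maps (ball 0 1) D" "\<phi> 0 = z n" "\<phi> \<alpha> = w n" "\<alpha> \<in> ball 0 1"
        "artanh (cmod \<alpha>) \<le> ln (16 / ((1 - cmod (k (z n))) * (1 - cmod (k (w n))))) / 2"
        using Riemann_map_disc_through[OF kg(2,3) _ G(3), of "z n" "w n"] kg(4) elim by blast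
      have "b * (1 - cmod (\<psi>1 (z n))) * (a * (1 - cmod (\<psi>0 (w n)))) \<le> (1 - cmod (k (z n))) * (1 - cmod (k (w n)))"
        using elim kg(3)[of "z n"] a(1) c0.\<psi>_disc[OF zw(2), of n] by (intro mult_mono) auto
      then have "(b * a) * d n \<le> (1 - cmod (k (z n))) * (1 - cmod (k (w n)))"
        by (simp add: d_def ac_simps)
      moreover have "0 < 1 - cmod (k (z n))" "0 < 1 - cmod (k (w n))"
        using kg(3)[of "z n"] kg(3)[of "w n"] elim by auto
      ultimately have "artanh (cmod \<alpha>) \<le> Y n + ln (16 / (b * a)) / 2"
        using half_ln_16_le[of "1 - cmod (k (z n))" "1 - cmod (k (w n))" "b * a" "d n"] a(1) b(1) dpos[of n] \<phi>(5)
        by (simp add: Y_def)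
      then show ?case
        using \<phi> by blast
    qed
    show "\<forall>\<^sub>F n in sequentially. \<exists>f. f \<in> holo_maps D (ball 0 1) \<and> f (z n) = 0 \<and> s * Y n - C \<le> artanh (cmod (f (w n)))"
      using order_tendstoD(1)[OF m0 \<rho>(2)] order_tendstoD(1)[OF m1 \<rho>(2)]
    proof eventually_elim
      case (elim n)
      then show ?case
        using C[OF zw, of n n] by (simp add: Y_def d_def)
    qed
  qed
qed

text \<open>The strip covering of the ring, with the strip replaced by the upper half plane.\<close>

lemma ring_disc_through:
  assumes r: "0 < r" "r < 1" and l: "ln r < Re l1" "Re l1 < 0" "ln r < Re l2" "Re l2 < 0" and v: "cmod v = 1"
  defines "\<tau> \<equiv> \<lambda>l. exp (- \<i> * of_real (pi / - ln r) * l)"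
  obtains \<phi> \<alpha> where "\<phi> \<in> holo_maps (ball 0 1) (outer_ring r)" "\<phi> 0 = v * exp l1" "\<phi> \<alpha> = v * exp l2" "cmod \<alpha> < 1"
    "1 - (cmod \<alpha>)\<^sup>2 = 4 * Im (\<tau> l1) * Im (\<tau> l2) / (cmod (\<tau> l2 - cnj (\<tau> l1)))\<^sup>2"
    "(cmod \<alpha>)\<^sup>2 = (cmod (\<tau> l2 - \<tau> l1))\<^sup>2 / (cmod (\<tau> l2 - cnj (\<tau> l1)))\<^sup>2"
proof -
  define L where "L = - ln r"
  have L: "0 < L"
    using r by (simp add: L_def ln_less_zero)
  \<comment> \<open>\<open>Ln\<close> maps the upper half plane to a strip of width pi. Rescaled,
    turned by a right angle and exponentiated, it covers the ring, and \<open>\<tau> l\<close> is a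
    point over \<open>v * exp l\<close>.\<close>
  define \<Phi> where "\<Phi> t = v * exp (\<i> * of_real (L / pi) * Ln t)" for t
  have \<Phi>_ring: "\<Phi> t \<in> outer_ring r" if "0 < Im t" for t
  proof -
    have im: "0 < Im (Ln t)" "Im (Ln t) < pi"
      using that Im_Ln_pos_lt[of t] Im_Ln_pos_lt_imp by (cases "t = 0"; auto)+
    have "cmod (\<Phi> t) = exp (- (L / pi * Im (Ln t)))"
      using v by (simp add: \<Phi>_def norm_mult)
    moreover have "L / pi * Im (Ln t) < L"
      using im L by (simp add: field_simps)
    moreover have "0 < L / pi * Im (Ln t)"
      using im L by simp
    moreover have "exp (- L) = r"
      using r by (simp add: L_def)
    ultimately show ?thesis
      unfolding outer_ring_def by (smt (verit, best) exp_less_mono mem_Collect_eq one_less_exp_iff exp_zero)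
  qed
  have \<tau>: "0 < Im (\<tau> l) \<and> \<Phi> (\<tau> l) = v * exp l" if l: "ln r < Re l" "Re l < 0" for l
  proof -
    define y where "y = - \<i> * of_real (pi / L) * l"
    have eq: "\<tau> l = exp y"
      by (simp add: \<tau>_def y_def L_def)
    have y: "Im y = pi / L * - Re l"
      by (simp add: y_def)
    have yb: "0 < Im y" "Im y < pi"
    proof -
      show "0 < Im y"
        unfolding y using l L by (intro mult_pos_pos) auto
      have "- Re l < L"
        using l by (simp add: L_def)
      then have "pi / L * - Re l < pi / L * L"
        using L by (intro mult_strict_left_mono) auto
      then show "Im y < pi"
        unfolding y using L by simp
    qed
    have "0 < sin (Im y)"
      using yb by (intro sin_gt_zero)
    then have 1: "0 < Im (\<tau> l)"
      unfolding eq Im_exp by simp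
    have "Ln (\<tau> l) = y"
      unfolding eq using yb by (intro Ln_exp) auto
    then have "\<Phi> (\<tau> l) = v * exp (\<i> * of_real (L / pi) * y)"
      by (simp add: \<Phi>_def)
    also have "\<i> * of_real (L / pi) * y = l"
      using L by (simp add: y_def field_simps)
    finally show ?thesis
      using 1 by blast
  qed
  have hol\<Phi>: "\<Phi> holomorphic_on {t. 0 < Im t}"
    unfolding \<Phi>_def by (intro holomorphic_intros) (auto simp: complex_nonpos_Reals_iff)
  define t1 t2 where "t1 = \<tau> l1" and "t2 = \<tau> l2"
  have t: "0 < Im t1" "0 < Im t2"
    using \<tau>[OF l(1,2)] \<tau>[OF l(3,4)] by (auto simp: t1_def t2_def)
  \<comment> \<open>The inverse Cayley map from the disc to the half plane with
    \<open>K 0 = t1\<close>; below, \<open>\<alpha>\<close> is the point that it sends to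
    \<open>t2\<close>.\<close>
  define K where "K x = (t1 - cnj t1 * x) / (1 - x)" for x
  have K_im: "0 < Im (K x)" if "cmod x < 1" for x
  proof -
    have "Im ((t1 - cnj t1 * x) * cnj (1 - x)) = Im t1 * (1 - (cmod x)\<^sup>2)"
      unfolding cmod_power2 by (simp add: algebra_simps power2_eq_square)
    moreover have "0 < Im t1 * (1 - (cmod x)\<^sup>2)"
      using t that by (simp add: power_less_one_iff)
    ultimately show ?thesis
      unfolding K_def Im_complex_div_gt_0 by simp
  qed
  have holK: "K holomorphic_on ball 0 1"
    unfolding K_def[abs_def] by (intro holomorphic_intros) auto
  define \<alpha> where "\<alpha> = (t2 - t1) / (t2 - cnj t1)"
  have nz: "t2 - cnj t1 \<noteq> 0"
    using t by (auto simp: complex_eq_iff)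
  have nz': "t1 - cnj t1 \<noteq> 0"
    using t by (auto simp: complex_eq_iff)
  have "1 - \<alpha> = (t1 - cnj t1) / (t2 - cnj t1)"
    using nz by (simp add: \<alpha>_def field_simps)
  moreover have "t1 - cnj t1 * \<alpha> = t2 * (t1 - cnj t1) / (t2 - cnj t1)"
    using nz by (simp add: \<alpha>_def field_simps)
  ultimately have K\<alpha>: "K \<alpha> = t2"
    using nz nz' by (simp add: K_def)
  have sq: "(cmod (t2 - cnj t1))\<^sup>2 - (cmod (t2 - t1))\<^sup>2 = 4 * Im t1 * Im t2"
    unfolding cmod_power2 by (simp add: algebra_simps power2_eq_square)
  have \<alpha>sq: "(cmod \<alpha>)\<^sup>2 = (cmod (t2 - t1))\<^sup>2 / (cmod (t2 - cnj t1))\<^sup>2"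
    by (simp add: \<alpha>_def norm_divide power_divide)
  have pos: "0 < (cmod (t2 - cnj t1))\<^sup>2"
    using nz by simp
  have one: "1 - (cmod \<alpha>)\<^sup>2 = 4 * Im t1 * Im t2 / (cmod (t2 - cnj t1))\<^sup>2"
    unfolding \<alpha>sq sq[symmetric] using nz by (simp add: diff_divide_distrib)
  have "0 < 1 - (cmod \<alpha>)\<^sup>2"
    unfolding one using t pos by simp
  then have \<alpha>1: "cmod \<alpha> < 1"
    by (simp add: power_less_one_iff)
  have "\<Phi> \<circ> K \<in> holo_maps (ball 0 1) (outer_ring r)"
    unfolding holo_maps_def
  proof (intro CollectI conjI)
    show "\<Phi> \<circ> K holomorphic_on ball 0 1"
    proof (rule holomorphic_on_compose_gen[OF holK hol\<Phi>])
      show "K ` ball 0 1 \<subseteq> {t. 0 < Im t}"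
        using K_im by auto
    qed
    show "(\<Phi> \<circ> K) ` ball 0 1 \<subseteq> outer_ring r"
      using K_im \<Phi>_ring by auto
  qed
  moreover have "(\<Phi> \<circ> K) 0 = v * exp l1" "(\<Phi> \<circ> K) \<alpha> = v * exp l2"
    using \<tau>[OF l(1,2)] \<tau>[OF l(3,4)] K\<alpha> by (auto simp: K_def t1_def t2_def)
  ultimately show thesis
    using that[of "\<Phi> \<circ> K" \<alpha>] \<alpha>1 one \<alpha>sq by (simp add: t1_def t2_def)
qed

section \<open>Comparison of inverse hyperbolic tangents up to a factor\<close>

lemma sinh_artanh:
  assumes "0 \<le> t" "t < (1::real)"
  shows "sinh (artanh t) = t / sqrt (1 - t\<^sup>2)"
proof -
  define q where "q = (1 + t) / (1 - t)"
  have q: "0 < q"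
    using assms by (simp add: q_def)
  have e: "exp (artanh t) = sqrt q"
    using q by (simp add: artanh_def q_def[symmetric] ln_sqrt[symmetric])
  have "sqrt (1 - t\<^sup>2) = sqrt (1 - t) * sqrt (1 + t)"
    by (simp add: real_sqrt_mult[symmetric] power2_eq_square algebra_simps)
  moreover have "sqrt q = sqrt (1 + t) / sqrt (1 - t)"
    by (simp add: q_def real_sqrt_divide)
  moreover have "sqrt (1 + t) / sqrt (1 - t) - sqrt (1 - t) / sqrt (1 + t)
      = (sqrt (1 + t) * sqrt (1 + t) - sqrt (1 - t) * sqrt (1 - t)) / (sqrt (1 - t) * sqrt (1 + t))"
    using assms by (subst diff_frac_eq) (auto simp: mult.commute)
  moreover have "sqrt (1 + t) * sqrt (1 + t) - sqrt (1 - t) * sqrt (1 - t) = 2 * t"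
    using assms by simp
  ultimately show ?thesis
    unfolding sinh_def exp_minus e by (simp add: inverse_eq_divide)
qed

lemma sinh_scale_le:
  assumes "1 \<le> k" "0 \<le> (p::real)"
  shows "k * sinh p \<le> sinh (k * p)"
proof -
  have "sinh (k * 0) - k * sinh 0 \<le> sinh (k * p) - k * sinh p"
  proof (rule DERIV_nonneg_imp_nondecreasing[OF assms(2)])
    fix x :: real assume x: "0 \<le> x" "x \<le> p"
    have "((\<lambda>x. sinh (k * x) - k * sinh x) has_real_derivative k * cosh (k * x) - k * cosh x) (at x)"
      by (auto intro!: derivative_eq_intros)
    moreover have "cosh x \<le> cosh (k * x)"
      using x assms mult_right_mono[of 1 k x] by (subst cosh_real_nonneg_le_iff) auto
    then have "0 \<le> k * cosh (k * x) - k * cosh x"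
      using assms by simp
    ultimately show "\<exists>y. ((\<lambda>x. sinh (k * x) - k * sinh x) has_real_derivative y) (at x) \<and> 0 \<le> y"
      by blast
  qed
  then show ?thesis
    by simp
qed

text \<open>\<open>s\<^sup>2 / (1 - s\<^sup>2)\<close> is the square of
  \<open>sinh (artanh s)\<close>, and \<open>k * sinh p \<le> sinh (k * p)\<close>. The comparison
  works for small and large distances alike.\<close>

lemma artanh_le_scaled:
  assumes t: "0 \<le> s" "s < 1" "0 \<le> t" "t < (1::real)" and k: "1 \<le> k"
    and le: "s\<^sup>2 / (1 - s\<^sup>2) \<le> k\<^sup>2 * (t\<^sup>2 / (1 - t\<^sup>2))"
  shows "artanh s \<le> k * artanh t"
proof -
  have "sqrt (s\<^sup>2 / (1 - s\<^sup>2)) \<le> sqrt (k\<^sup>2 * (t\<^sup>2 / (1 - t\<^sup>2)))"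
    using le by (rule real_sqrt_le_mono)
  then have "s / sqrt (1 - s\<^sup>2) \<le> k * (t / sqrt (1 - t\<^sup>2))"
    using t k by (simp add: real_sqrt_mult real_sqrt_divide)
  then have "sinh (artanh s) \<le> k * sinh (artanh t)"
    using sinh_artanh t by simp
  also have "\<dots> \<le> sinh (k * artanh t)"
    using artanh_mono[of 0 t] t by (intro sinh_scale_le k) auto
  finally show ?thesis
    by simp
qed

section \<open>Two points near the same boundary component\<close>

text \<open>A point of the upper half plane over \<open>exp l\<close> for the covering map of \<open>ring_disc_through\<close>.\<close>

definition ring_lift :: "real \<Rightarrow> complex \<Rightarrow> complex" where
  "ring_lift r l = exp (- \<i> * of_real (pi / - ln r) * l)"

lemma ring_lift_bounds:
  assumes r: "0 < r" "r < 1"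
  shows "cmod (ring_lift r l) = exp (pi / - ln r * Im l)"
    and "Im (ring_lift r l) = exp (pi / - ln r * Im l) * sin (pi / - ln r * - Re l)"
  by (simp_all add: ring_lift_def Im_exp)

text \<open>For \<open>y = - Re (l n)\<close> tending to 0, \<open>sin (k * y)\<close> is asymptotic
  to \<open>k * y\<close>, while \<open>1 - exp (- 2 * y) \<le> 2 * y\<close>. The factor
  \<open>exp (k * \<theta>) * k\<close> is the modulus of the derivative of the lift at the limit
  point.\<close>

lemma Im_ring_lift_ge:
  assumes r: "0 < r" "r < 1" and l: "l \<longlonglongrightarrow> \<i> * of_real \<theta>" "\<forall>\<^sub>F n in sequentially. Re (l n) < 0" and e: "0 < e" "e < 1"
  shows "\<forall>\<^sub>F n in sequentially. (1 - e) * exp (pi / - ln r * \<theta>) * (pi / - ln r) / 2 * (1 - (cmod (exp (l n)))\<^sup>2) \<le> Im (ring_lift r (l n))"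
proof -
  define k where "k = pi / - ln r"
  have k: "0 < k"
    unfolding k_def by (intro divide_pos_pos) (use r in auto)
  have relim: "(\<lambda>n. - Re (l n)) \<longlonglongrightarrow> 0"
    using tendsto_minus[OF tendsto_Re[OF l(1)]] by simp
  have imlim: "(\<lambda>n. Im (l n)) \<longlonglongrightarrow> \<theta>"
    using tendsto_Im[OF l(1)] by simp
  have "(\<lambda>n. k * - Re (l n)) \<longlonglongrightarrow> k * 0"
    by (intro tendsto_intros relim)
  moreover have "\<forall>\<^sub>F n in sequentially. k * - Re (l n) \<noteq> 0"
    using l(2) by eventually_elim (use k in simp)
  ultimately have "filterlim (\<lambda>n. k * - Re (l n)) (at 0) sequentially"
    by (simp add: filterlim_at)
  moreover have "((\<lambda>x. sin x / x) \<longlongrightarrow> 1) (at (0::real))"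
    using DERIV_sin[of 0] by (simp add: has_field_derivative_iff)
  ultimately have slim: "(\<lambda>n. sin (k * - Re (l n)) / (k * - Re (l n))) \<longlonglongrightarrow> 1"
    using filterlim_compose by blast
  have "(\<lambda>n. exp (k * Im (l n)) * (sin (k * - Re (l n)) / (k * - Re (l n)))) \<longlonglongrightarrow> exp (k * \<theta>) * 1"
    by (intro tendsto_intros slim imlim)
  moreover have "(1 - e) * exp (k * \<theta>) < exp (k * \<theta>) * 1"
    using e by simp
  ultimately have "\<forall>\<^sub>F n in sequentially. (1 - e) * exp (k * \<theta>) < exp (k * Im (l n)) * (sin (k * - Re (l n)) / (k * - Re (l n)))"
    using order_tendstoD(1) by blast
  then show ?thesis
    using l(2)
  proof eventually_elim
    case (elim n)
    define y where "y = - Re (l n)"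
    have y: "0 < y"
      using elim(2) by (simp add: y_def)
    have "1 - (cmod (exp (l n)))\<^sup>2 = 1 - exp (- 2 * y)"
      by (simp add: y_def power2_eq_square exp_add[symmetric])
    also have "\<dots> \<le> 2 * y"
      using exp_ge_add_one_self[of "- 2 * y"] by linarith
    finally have 1: "1 - (cmod (exp (l n)))\<^sup>2 \<le> 2 * y" .
    have "(1 - e) * exp (k * \<theta>) * k / 2 * (1 - (cmod (exp (l n)))\<^sup>2) \<le> (1 - e) * exp (k * \<theta>) * k / 2 * (2 * y)"
      using 1 e k by (intro mult_left_mono) auto
    also have "\<dots> = (1 - e) * exp (k * \<theta>) * (k * y)"
      by simp
    also have "\<dots> \<le> exp (k * Im (l n)) * (sin (k * y) / (k * y)) * (k * y)"
    proof (rule mult_right_mono)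
      show "(1 - e) * exp (k * \<theta>) \<le> exp (k * Im (l n)) * (sin (k * y) / (k * y))"
        using elim(1) by (simp only: y_def less_imp_le)
      show "0 \<le> k * y"
        using k y by simp
    qed
    also have "\<dots> = Im (ring_lift r (l n))"
    proof -
      have "Im (ring_lift r (l n)) = exp (k * Im (l n)) * sin (k * y)"
        by (simp only: ring_lift_bounds(2)[OF r] k_def y_def)
      then show ?thesis
        using k y by simp
    qed
    finally show ?case
      by (simp only: k_def)
  qed
qed

text \<open>At 1 the derivative has modulus \<open>pi / - ln r\<close>, the same factor as in
  \<open>Im_ring_lift_ge\<close> for angle 0. The two cancel when the distance is computed, which
  makes the comparison with the disc sharp.\<close>

lemma ring_lift_Lipschitz:
  assumes r: "0 < r" "r < 1" and e: "0 < e"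
  obtains \<delta> where "0 < \<delta>" "\<And>a b. a \<in> ball 1 \<delta> \<Longrightarrow> b \<in> ball 1 \<delta> \<Longrightarrow>
    cmod (ring_lift r (Ln a) - ring_lift r (Ln b)) \<le> (1 + e) * (pi / - ln r) * cmod (a - b)"
proof -
  define k where "k = pi / - ln r"
  have k: "0 < k"
    unfolding k_def by (intro divide_pos_pos) (use r in auto)
  define S where "S \<zeta> = ring_lift r (Ln \<zeta>)" for \<zeta>
  have Sk: "S \<zeta> = exp (- \<i> * of_real k * Ln \<zeta>)" for \<zeta>
    by (simp only: S_def ring_lift_def k_def)
  define S' where "S' \<zeta> = - \<i> * of_real k * inverse \<zeta> * S \<zeta>" for \<zeta>
  have deriv: "(S has_field_derivative S' \<zeta>) (at \<zeta>)" if "\<zeta> \<notin> \<real>\<^sub>\<le>\<^sub>0" for \<zeta>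
  proof -
    have "((\<lambda>\<zeta>. exp (- \<i> * of_real k * Ln \<zeta>)) has_field_derivative S' \<zeta>) (at \<zeta>)"
      unfolding S'_def Sk using that by (auto intro!: derivative_eq_intros)
    then show ?thesis
      by (simp only: Sk[abs_def])
  qed
  have 1: "(1::complex) \<notin> \<real>\<^sub>\<le>\<^sub>0"
    by simp
  have "isCont S 1"
    using deriv[OF 1] DERIV_isCont by blast
  then have "isCont (\<lambda>\<zeta>. cmod (S' \<zeta>)) 1"
    unfolding S'_def by (intro continuous_intros) auto
  moreover have "cmod (S' 1) = k"
    using k by (simp add: S'_def S_def ring_lift_def norm_mult)
  ultimately have "((\<lambda>\<zeta>. cmod (S' \<zeta>)) \<longlongrightarrow> k) (at 1)"
    unfolding isCont_def by simp
  have lim: "((\<lambda>\<zeta>. cmod (S' \<zeta>)) \<longlongrightarrow> k) (nhds 1)"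
    using \<open>isCont (\<lambda>\<zeta>. cmod (S' \<zeta>)) 1\<close> \<open>cmod (S' 1) = k\<close> by (metis continuous_at_imp_continuous_at_within isCont_def tendsto_at_iff_tendsto_nhds)
  have "k < (1 + e) * k"
    using k e by simp
  then have "\<forall>\<^sub>F \<zeta> in nhds 1. cmod (S' \<zeta>) < (1 + e) * k"
    using order_tendstoD(2)[OF lim] by blast
  then obtain d where d: "0 < d" "\<And>\<zeta>. dist \<zeta> 1 < d \<Longrightarrow> cmod (S' \<zeta>) < (1 + e) * k"
    unfolding eventually_nhds_metric by blast
  define \<delta> where "\<delta> = min d 1"
  show thesis
  proof
    show "0 < \<delta>"
      using d by (simp add: \<delta>_def)
    fix a b :: complex assume ab: "a \<in> ball 1 \<delta>" "b \<in> ball 1 \<delta>"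
    have "cmod (S a - S b) \<le> (1 + e) * k * cmod (a - b)"
    proof (rule field_differentiable_bound[of "ball 1 \<delta>"])
      fix \<zeta> :: complex assume \<zeta>: "\<zeta> \<in> ball 1 \<delta>"
      have "Re (1 - \<zeta>) < 1"
        using \<zeta> complex_Re_le_cmod[of "1 - \<zeta>"] by (simp add: dist_norm \<delta>_def)
      then have "\<zeta> \<notin> \<real>\<^sub>\<le>\<^sub>0"
        by (auto simp: complex_nonpos_Reals_iff)
      then show "(S has_field_derivative S' \<zeta>) (at \<zeta> within ball 1 \<delta>)"
        using deriv has_field_derivative_at_within by blast
      show "cmod (S' \<zeta>) \<le> (1 + e) * k"
        using d(2)[of \<zeta>] \<zeta> by (simp add: \<delta>_def dist_commute less_imp_le)
    qed (use ab in auto)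
    then show "cmod (ring_lift r (Ln a) - ring_lift r (Ln b)) \<le> (1 + e) * (pi / - ln r) * cmod (a - b)"
      by (simp add: S_def k_def)
  qed
qed

lemma Ln_divide_unit:
  assumes "cmod u = 1" "y \<noteq> 0"
  shows "Re (Ln (y / u)) = ln (cmod y)" "u * exp (Ln (y / u)) = y"
proof -
  have "u \<noteq> 0"
    using assms(1) by auto
  then show "Re (Ln (y / u)) = ln (cmod y)" "u * exp (Ln (y / u)) = y"
    using assms by (simp_all add: norm_divide)
qed

context boundary_chart
begin

lemma ln_level:
  assumes "x \<in> D" "r < cmod (\<psi> x)"
  shows "ln (cmod (\<psi> x)) < 0" "ln r < ln (cmod (\<psi> x))"
proof -
  have "0 < cmod (\<psi> x)"
    using assms(2) r by linarith
  then show "ln (cmod (\<psi> x)) < 0" "ln r < ln (cmod (\<psi> x))"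
    using \<psi>_disc[OF assms(1)] assms(2) r by (simp_all only: ln_less_zero ln_less_cancel_iff)
qed

lemma ring_disc_in_domain:
  assumes l: "ln r < Re l1" "Re l1 < 0" "ln r < Re l2" "Re l2 < 0" and v: "cmod v = 1"
    and zw: "z \<in> D" "w \<in> D" "\<psi> z = v * exp l1" "\<psi> w = v * exp l2"
  obtains \<phi> \<alpha> where "\<phi> \<in> holo_maps (ball 0 1) D" "\<phi> 0 = z" "\<phi> \<alpha> = w" "\<alpha> \<in> ball 0 1"
    "1 - (cmod \<alpha>)\<^sup>2 = 4 * Im (ring_lift r l1) * Im (ring_lift r l2) / (cmod (ring_lift r l2 - cnj (ring_lift r l1)))\<^sup>2"
    "(cmod \<alpha>)\<^sup>2 = (cmod (ring_lift r l2 - ring_lift r l1))\<^sup>2 / (cmod (ring_lift r l2 - cnj (ring_lift r l1)))\<^sup>2"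
proof -
  obtain \<phi> \<alpha> where \<phi>: "\<phi> \<in> holo_maps (ball 0 1) (outer_ring r)" "\<phi> 0 = v * exp l1" "\<phi> \<alpha> = v * exp l2" "cmod \<alpha> < 1"
    "1 - (cmod \<alpha>)\<^sup>2 = 4 * Im (ring_lift r l1) * Im (ring_lift r l2) / (cmod (ring_lift r l2 - cnj (ring_lift r l1)))\<^sup>2"
    "(cmod \<alpha>)\<^sup>2 = (cmod (ring_lift r l2 - ring_lift r l1))\<^sup>2 / (cmod (ring_lift r l2 - cnj (ring_lift r l1)))\<^sup>2"
    using ring_disc_through[OF r l v] unfolding ring_lift_def by metis
  have "h \<circ> \<phi> holomorphic_on ball 0 1"
    using holomorphic_on_compose_gen[OF _ h_holomorphic] \<phi>(1) by (simp add: holo_maps_def)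
  moreover have "(h \<circ> \<phi>) ` ball 0 1 \<subseteq> D"
    using \<phi>(1) h_in by (auto simp: holo_maps_def)
  ultimately have "h \<circ> \<phi> \<in> holo_maps (ball 0 1) D"
    by (simp add: holo_maps_def)
  moreover have "\<phi> 0 \<in> outer_ring r" "\<phi> \<alpha> \<in> outer_ring r"
    using \<phi>(1,4) by (auto simp: holo_maps_def image_subset_iff)
  then have "(h \<circ> \<phi>) 0 = z" "(h \<circ> \<phi>) \<alpha> = w"
    using h_\<psi>[OF zw(1)] h_\<psi>[OF zw(2)] zw(3,4) \<phi>(2,3) by (simp_all add: outer_ring_def)
  ultimately show thesis
    using that[of "h \<circ> \<phi>" \<alpha>] \<phi>(4-6) by simp
qed

text \<open>Distinct limits keep \<open>1 - cnj (\<psi> z) * \<psi> w\<close> away from 0, so upper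
  and lower bound both differ from \<open>Y\<close> by constants only.\<close>

lemma almost_extremal_distinct_limits:
  assumes zw: "\<And>n. z n \<in> D" "\<And>n. w n \<in> D" and v: "(\<lambda>n. \<psi> (z n)) \<longlonglongrightarrow> v" "cmod v = 1"
    and u: "(\<lambda>n. \<psi> (w n)) \<longlonglongrightarrow> u" "cmod u = 1" and ne: "u \<noteq> v" and e: "0 < e" "e < 1"
  shows "\<forall>\<^sub>F n in sequentially. almost_extremal D e (z n) (w n)"
proof -
  define k where "k = pi / - ln r"
  have k: "0 < k"
    unfolding k_def by (intro divide_pos_pos) (use r in auto)
  have nz: "u \<noteq> 0" "v \<noteq> 0"
    using u(2) v(2) by auto
  define \<theta> where "\<theta> = Im (Ln (u / v))"
  have "Re (Ln (u / v)) = 0"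
    using nz u(2) v(2) by (simp add: norm_divide)
  then have "Ln (u / v) = \<i> * of_real \<theta>"
    by (simp add: complex_eq_iff \<theta>_def)
  then have uv: "exp (\<i> * of_real \<theta>) = u / v"
    using nz by (metis divide_eq_0_iff exp_Ln)
  define l1 where "l1 n = Ln (\<psi> (z n) / v)" for n
  \<comment> \<open>The logarithm is taken relative to \<open>u\<close> and shifted by the angle
    from \<open>v\<close> to \<open>u\<close>; \<open>Ln (\<psi> (w n) / v)\<close> would approach
    the branch cut if \<open>u = - v\<close>.\<close>
  define l2 where "l2 n = Ln (\<psi> (w n) / u) + \<i> * of_real \<theta>" for n
  have ev0: "\<forall>\<^sub>F n in sequentially. r < cmod (\<psi> (z n))" "\<forall>\<^sub>F n in sequentially. r < cmod (\<psi> (w n))"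
    using order_tendstoD(1)[OF tendsto_norm[OF v(1)], of r] order_tendstoD(1)[OF tendsto_norm[OF u(1)], of r] u(2) v(2) r by auto
  have Re1: "Re (l1 n) = ln (cmod (\<psi> (z n)))" "v * exp (l1 n) = \<psi> (z n)" if "r < cmod (\<psi> (z n))" for n
  proof -
    have "\<psi> (z n) \<noteq> 0"
      using that r by auto
    then show "Re (l1 n) = ln (cmod (\<psi> (z n)))" "v * exp (l1 n) = \<psi> (z n)"
      unfolding l1_def using Ln_divide_unit[OF v(2)] by auto
  qed
  have Re2: "Re (l2 n) = ln (cmod (\<psi> (w n)))" "v * exp (l2 n) = \<psi> (w n)" if "r < cmod (\<psi> (w n))" for n
  proof -
    have "\<psi> (w n) \<noteq> 0"
      using that r by auto
    note L = Ln_divide_unit[OF u(2) this]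
    show "Re (l2 n) = ln (cmod (\<psi> (w n)))"
      using L(1) by (simp add: l2_def)
    have "v * exp (l2 n) = u * exp (Ln (\<psi> (w n) / u))"
      unfolding l2_def exp_add uv using nz by simp
    then show "v * exp (l2 n) = \<psi> (w n)"
      using L(2) by simp
  qed
  have neg1: "\<forall>\<^sub>F n in sequentially. Re (l1 n) < 0"
    using ev0(1) by eventually_elim (use Re1 ln_level[OF zw(1)] in simp)
  have neg2: "\<forall>\<^sub>F n in sequentially. Re (l2 n) < 0"
    using ev0(2) by eventually_elim (use Re2 ln_level[OF zw(2)] in simp)
  have "(\<lambda>n. Ln (\<psi> (z n) / v)) \<longlonglongrightarrow> Ln (v / v)"
    using nz by (intro tendsto_Ln tendsto_intros v) auto
  then have lim1: "l1 \<longlonglongrightarrow> \<i> * of_real 0"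
    using nz by (simp add: l1_def[abs_def])
  have "(\<lambda>n. Ln (\<psi> (w n) / u) + \<i> * of_real \<theta>) \<longlonglongrightarrow> Ln (u / u) + \<i> * of_real \<theta>"
    using nz by (intro tendsto_Ln tendsto_intros u) auto
  then have lim2: "l2 \<longlonglongrightarrow> \<i> * of_real \<theta>"
    using nz by (simp add: l2_def[abs_def])
  \<comment> \<open>Half of the asymptotic height suffices, since the loss is an additive constant
    in the distance.\<close>
  have half: "(0::real) < 1 / 2" "(1 / 2 :: real) < 1"
    by auto
  note im1 = Im_ring_lift_ge[OF r lim1 neg1 half, folded k_def]
  note im2 = Im_ring_lift_ge[OF r lim2 neg2 half, folded k_def]
  define c1 where "c1 = (1 - 1 / 2) * exp (k * 0) * k / 2"
  define c2 where "c2 = (1 - 1 / 2) * exp (k * \<theta>) * k / 2"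
  have c: "0 < c1" "0 < c2"
    using k by (auto simp: c1_def c2_def)
  \<comment> \<open>The moduli of the two lifts tend to the two exponentials, so \<open>N\<close>
    eventually bounds the denominator \<open>|?t2 - cnj ?t1|\<close>.\<close>
  define N where "N = exp (k * 0) + exp (k * \<theta>) + 1"
  have N: "0 < N"
    by (simp add: N_def add_pos_pos)
  have "(\<lambda>n. exp (k * Im (l1 n)) + exp (k * Im (l2 n))) \<longlonglongrightarrow> exp (k * Im (\<i> * of_real 0)) + exp (k * Im (\<i> * of_real \<theta>))"
    by (intro tendsto_intros lim1 lim2)
  then have evN: "\<forall>\<^sub>F n in sequentially. exp (k * Im (l1 n)) + exp (k * Im (l2 n)) < N"
    by (rule order_tendstoD(2)) (simp add: N_def)
  define d where "d n = (1 - cmod (\<psi> (z n))) * (1 - cmod (\<psi> (w n)))" for n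
  have dpos: "0 < d n" for n
    using \<psi>_disc[OF zw(1)] \<psi>_disc[OF zw(2)] by (simp add: d_def)
  have "(\<lambda>n. (1 - cmod (\<psi> (z n))) * (1 - cmod (\<psi> (w n)))) \<longlonglongrightarrow> (1 - cmod v) * (1 - cmod u)"
    by (intro tendsto_intros v u)
  then have d0: "d \<longlonglongrightarrow> 0"
    using u(2) by (simp add: d_def[abs_def])
  define Y where "Y n = ln (1 / d n) / 2" for n
  have Y: "filterlim Y at_top sequentially"
    unfolding Y_def[abs_def] using filterlim_half_ln_inverse[OF d0 dpos] .
  have "(\<lambda>n. cmod (1 - cnj (\<psi> (z n)) * \<psi> (w n))) \<longlonglongrightarrow> cmod (1 - cnj v * u)"
    by (intro tendsto_intros u v)
  moreover have "1 - cnj v * u \<noteq> 0"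
  proof
    assume "1 - cnj v * u = 0"
    then have "v * (cnj v * u) = v"
      by simp
    then have "(v * cnj v) * u = v"
      by (simp add: mult.assoc)
    then show False
      using ne unfolding unit_mult_cnj[OF v(2)] by simp
  qed
  ultimately obtain \<eta> where \<eta>: "0 < \<eta>" "\<forall>\<^sub>F n in sequentially. \<eta> < cmod (1 - cnj (\<psi> (z n)) * \<psi> (w n))"
    using dense[of 0 "cmod (1 - cnj v * u)"] order_tendstoD(1) by (metis zero_less_norm_iff)
  have e1: "1 - e < 1"
    using e by simp
  have sq: "1 - t \<le> 1 - t\<^sup>2" if "0 \<le> t" "t < 1" for t :: real
    using that by (simp add: power2_eq_square mult_left_le)
  show ?thesis
  proof (rule eventually_almost_extremal[OF e e1 Y])
    show "\<forall>\<^sub>F n in sequentially. \<exists>\<phi> \<alpha>. \<phi> \<in> holo_maps (ball 0 1) D \<and> \<phi> 0 = z n \<and> \<phi> \<alpha> = w n \<and>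
      \<alpha> \<in> ball 0 1 \<and> artanh (cmod \<alpha>) \<le> Y n + ln (N\<^sup>2 / (c1 * c2)) / 2"
      using ev0 neg1 neg2 im1 im2 evN
    proof eventually_elim
      case (elim n)
      let ?t1 = "ring_lift r (l1 n)" and ?t2 = "ring_lift r (l2 n)"
      have pos: "0 < cmod (\<psi> (z n))" "0 < cmod (\<psi> (w n))"
        using elim(1,2) r by linarith+
      have lnr: "ln r < Re (l1 n)" "ln r < Re (l2 n)"
        using Re1(1)[OF elim(1)] Re2(1)[OF elim(2)] elim(1,2) r pos by simp_all
      obtain \<phi> \<alpha> where \<phi>: "\<phi> \<in> holo_maps (ball 0 1) D" "\<phi> 0 = z n" "\<phi> \<alpha> = w n" "\<alpha> \<in> ball 0 1"
        "1 - (cmod \<alpha>)\<^sup>2 = 4 * Im ?t1 * Im ?t2 / (cmod (?t2 - cnj ?t1))\<^sup>2"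
        using ring_disc_in_domain[OF lnr(1) elim(3) lnr(2) elim(4) v(2) zw(1,2)[of n] Re1(2)[OF elim(1), symmetric] Re2(2)[OF elim(2), symmetric]]
        by metis
      have m1: "cmod (exp (l1 n)) = cmod (\<psi> (z n))" and m2: "cmod (exp (l2 n)) = cmod (\<psi> (w n))"
        using Re1(1)[OF elim(1)] Re2(1)[OF elim(2)] pos by simp_all
      have i1: "c1 * (1 - cmod (\<psi> (z n))) \<le> Im ?t1"
      proof -
        have "c1 * (1 - cmod (\<psi> (z n))) \<le> c1 * (1 - (cmod (\<psi> (z n)))\<^sup>2)"
          using sq[of "cmod (\<psi> (z n))"] c \<psi>_disc[OF zw(1), of n] by (intro mult_left_mono) auto
        then show ?thesis
          using elim(5) unfolding m1 c1_def by linarith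
      qed
      have i2: "c2 * (1 - cmod (\<psi> (w n))) \<le> Im ?t2"
      proof -
        have "c2 * (1 - cmod (\<psi> (w n))) \<le> c2 * (1 - (cmod (\<psi> (w n)))\<^sup>2)"
          using sq[of "cmod (\<psi> (w n))"] c \<psi>_disc[OF zw(2), of n] by (intro mult_left_mono) auto
        then show ?thesis
          using elim(6) unfolding m2 c2_def by linarith
      qed
      have p: "0 < c1 * (1 - cmod (\<psi> (z n)))" "0 < c2 * (1 - cmod (\<psi> (w n)))"
        using c \<psi>_disc[OF zw(1), of n] \<psi>_disc[OF zw(2), of n] by auto
      have "cmod (?t2 - cnj ?t1) \<le> cmod ?t2 + cmod ?t1"
        using norm_triangle_ineq4[of ?t2 "cnj ?t1"] by simp
      also have "\<dots> = exp (k * Im (l2 n)) + exp (k * Im (l1 n))"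
        by (simp only: ring_lift_bounds(1)[OF r] k_def)
      finally have "(cmod (?t2 - cnj ?t1))\<^sup>2 \<le> N\<^sup>2"
        using elim(7) by (intro power_mono) auto
      moreover have "0 < (cmod (?t2 - cnj ?t1))\<^sup>2"
      proof -
        have "0 < Im (?t2 - cnj ?t1)"
          using i1 i2 p by simp
        then have "?t2 - cnj ?t1 \<noteq> 0"
          by (metis less_irrefl zero_complex.sel(2))
        then show ?thesis
          by simp
      qed
      moreover have "4 * (c1 * c2 * d n) \<le> 4 * Im ?t1 * Im ?t2"
      proof -
        have "(c1 * (1 - cmod (\<psi> (z n)))) * (c2 * (1 - cmod (\<psi> (w n)))) \<le> Im ?t1 * Im ?t2"
          using i1 i2 p by (intro mult_mono) auto
        then show ?thesis
          by (simp add: d_def ac_simps)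
      qed
      moreover have "0 \<le> 4 * Im ?t1 * Im ?t2"
        using i1 i2 p by simp
      ultimately have le: "4 * (c1 * c2 * d n) / N\<^sup>2 \<le> 1 - (cmod \<alpha>)\<^sup>2"
        unfolding \<phi>(5) by (intro frac_le) auto
      have pos': "0 < 4 * (c1 * c2 * d n) / N\<^sup>2"
        using c N dpos[of n] by simp
      have \<alpha>pos: "0 < 1 - (cmod \<alpha>)\<^sup>2"
        using le pos' by linarith
      have "4 / (1 - (cmod \<alpha>)\<^sup>2) \<le> 4 / (4 * (c1 * c2 * d n) / N\<^sup>2)"
        by (rule divide_left_mono[OF le]) (use mult_pos_pos[OF \<alpha>pos pos'] in auto)
      moreover have "0 < 4 / (1 - (cmod \<alpha>)\<^sup>2)"
        using \<alpha>pos by simp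
      ultimately have "ln (4 / (1 - (cmod \<alpha>)\<^sup>2)) \<le> ln (4 / (4 * (c1 * c2 * d n) / N\<^sup>2))"
        by (intro ln_mono)
      also have "4 / (4 * (c1 * c2 * d n) / N\<^sup>2) = (1 / d n) * (N\<^sup>2 / (c1 * c2))"
        by simp
      also have "ln ((1 / d n) * (N\<^sup>2 / (c1 * c2))) = ln (1 / d n) + ln (N\<^sup>2 / (c1 * c2))"
        using c N dpos[of n] by (intro ln_mult_pos) auto
      finally have "artanh (cmod \<alpha>) \<le> Y n + ln (N\<^sup>2 / (c1 * c2)) / 2"
        using artanh_le_half_ln[of "cmod \<alpha>"] \<phi>(4) by (simp add: Y_def)
      then show ?case
        using \<phi> by blast
    qed
    show "\<forall>\<^sub>F n in sequentially. \<exists>f. f \<in> holo_maps D (ball 0 1) \<and> f (z n) = 0 \<and>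
      1 * Y n - ln (4 / \<eta>\<^sup>2) / 2 \<le> artanh (cmod (f (w n)))"
      using \<eta>(2)
    proof eventually_elim
      case (elim n)
      define a b where "a = \<psi> (z n)" and "b = \<psi> (w n)"
      have ab: "cmod a < 1" "cmod b < 1"
        using \<psi>_disc zw by (auto simp: a_def b_def)
      have "1 * Y n - ln (4 / \<eta>\<^sup>2) / 2 \<le> artanh (cmod (Moebius_function 0 a b))"
        using artanh_Moebius_ge[OF ab \<eta>(1)] elim by (simp add: Y_def d_def a_def b_def)
      then show ?case
        using Moebius_competitor[OF zw(1), of n] by (auto simp: a_def b_def)
    qed
  qed
qed

text \<open>In \<open>|\<alpha>|\<^sup>2 / (1 - |\<alpha>|\<^sup>2)\<close>, the square of the sinh
  of the distance, the common denominators cancel. What remains is \<open>|t2 - t1|\<^sup>2\<close>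
  over \<open>4 * Im t1 * Im t2\<close>; Lipschitz bound and heights compare it with the same
  expression for the disc up to \<open>((1 + s) / (1 - s))\<^sup>2\<close>, however close the points
  are.\<close>

lemma almost_extremal_same_limit:
  assumes zw: "\<And>n. z n \<in> D" "\<And>n. w n \<in> D" "\<And>n. z n \<noteq> w n"
    and u: "cmod u = 1" "(\<lambda>n. \<psi> (z n)) \<longlonglongrightarrow> u" "(\<lambda>n. \<psi> (w n)) \<longlonglongrightarrow> u" and e: "0 < e" "e < 1"
  shows "\<forall>\<^sub>F n in sequentially. almost_extremal D e (z n) (w n)"
proof -
  define k where "k = pi / - ln r"
  have k: "0 < k"
    unfolding k_def by (intro divide_pos_pos) (use r in auto)
  have nz: "u \<noteq> 0"
    using u(1) by auto
  \<comment> \<open>Chosen so that \<open>(1 - e) * (1 + s) \<le> 1 - s\<close>; the factor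
    \<open>(1 + s) / (1 - s)\<close> is the total loss.\<close>
  define s where "s = e / 2"
  have s: "0 < s" "s < 1"
    using e by (auto simp: s_def)
  define l where "l x = Ln (\<psi> x / u)" for x
  have ev0: "\<forall>\<^sub>F n in sequentially. r < cmod (\<psi> (x n))" if "(\<lambda>n. \<psi> (x n)) \<longlonglongrightarrow> u" for x :: "nat \<Rightarrow> complex"
    using order_tendstoD(1)[OF tendsto_norm[OF that], of r] u(1) r by simp
  have Re: "Re (l x) = ln (cmod (\<psi> x))" "u * exp (l x) = \<psi> x" if "r < cmod (\<psi> x)" for x
  proof -
    have "\<psi> x \<noteq> 0"
      using that r by auto
    then show "Re (l x) = ln (cmod (\<psi> x))" "u * exp (l x) = \<psi> x"
      unfolding l_def using Ln_divide_unit[OF u(1)] by auto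
  qed
  have neg: "Re (l x) < 0" "ln r < Re (l x)" if "x \<in> D" "r < cmod (\<psi> x)" for x
    using Re(1)[OF that(2)] ln_level[OF that] by simp_all
  have im: "\<forall>\<^sub>F n in sequentially. (1 - s) * k / 2 * (1 - (cmod (\<psi> (x n)))\<^sup>2) \<le> Im (ring_lift r (l (x n)))"
    if "\<And>n. x n \<in> D" and lim: "(\<lambda>n. \<psi> (x n)) \<longlonglongrightarrow> u" for x
  proof -
    have "(\<lambda>n. Ln (\<psi> (x n) / u)) \<longlonglongrightarrow> Ln (u / u)"
      using nz by (intro tendsto_Ln tendsto_intros lim) auto
    then have "(\<lambda>n. l (x n)) \<longlonglongrightarrow> \<i> * of_real 0"
      using nz by (simp add: l_def)
    moreover have "\<forall>\<^sub>F n in sequentially. Re (l (x n)) < 0"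
      using ev0[OF lim] by eventually_elim (use neg that(1) in blast)
    ultimately have "\<forall>\<^sub>F n in sequentially. (1 - s) * exp (k * 0) * k / 2 * (1 - (cmod (exp (l (x n))))\<^sup>2) \<le> Im (ring_lift r (l (x n)))"
      using Im_ring_lift_ge[OF r _ _ s, of "\<lambda>n. l (x n)" 0] by (simp only: k_def)
    then show ?thesis
      using ev0[OF lim]
    proof eventually_elim
      case (elim n)
      have "cmod (exp (l (x n))) = cmod (\<psi> (x n))"
        using arg_cong[OF Re(2)[OF elim(2)], of cmod] u(1) by (simp add: norm_mult)
      then show ?case
        using elim(1) by (simp only: mult_zero_right exp_zero mult_1_right)
    qed
  qed
  obtain \<delta> where \<delta>: "0 < \<delta>" "\<And>a b. a \<in> ball 1 \<delta> \<Longrightarrow> b \<in> ball 1 \<delta> \<Longrightarrow>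
    cmod (ring_lift r (Ln a) - ring_lift r (Ln b)) \<le> (1 + s) * k * cmod (a - b)"
    using ring_lift_Lipschitz[OF r s(1), folded k_def] by blast
  have ball: "\<forall>\<^sub>F n in sequentially. \<psi> (x n) / u \<in> ball 1 \<delta>" if lim: "(\<lambda>n. \<psi> (x n)) \<longlonglongrightarrow> u" for x :: "nat \<Rightarrow> complex"
  proof -
    have "(\<lambda>n. \<psi> (x n) / u) \<longlonglongrightarrow> u / u"
      using nz by (intro tendsto_intros lim) auto
    then have "\<forall>\<^sub>F n in sequentially. dist (\<psi> (x n) / u) 1 < \<delta>"
      using nz \<delta>(1) tendstoD by fastforce
    then show ?thesis
      by eventually_elim (simp add: dist_commute)
  qed
  show ?thesis
    using ev0[OF u(2)] ev0[OF u(3)] im[OF zw(1) u(2)] im[OF zw(2) u(3)] ball[OF u(2)] ball[OF u(3)]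
  proof eventually_elim
    case (elim n)
    define a b where "a = \<psi> (z n)" and "b = \<psi> (w n)"
    let ?t1 = "ring_lift r (l (z n))" and ?t2 = "ring_lift r (l (w n))"
    have ab: "cmod a < 1" "cmod b < 1"
      using \<psi>_disc zw by (auto simp: a_def b_def)
    \<comment> \<open>\<open>h\<close> inverts \<open>\<psi>\<close> at these levels, so the
      hypothesis \<open>z n \<noteq> w n\<close> passes to the chart and makes the lower bound
      positive.\<close>
    have "a \<noteq> b"
      using h_\<psi>[OF zw(1) elim(1)] h_\<psi>[OF zw(2) elim(2)] zw(3)[of n] by (auto simp: a_def b_def)
    obtain \<phi> \<alpha> where \<phi>: "\<phi> \<in> holo_maps (ball 0 1) D" "\<phi> 0 = z n" "\<phi> \<alpha> = w n" "\<alpha> \<in> ball 0 1"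
      "1 - (cmod \<alpha>)\<^sup>2 = 4 * Im ?t1 * Im ?t2 / (cmod (?t2 - cnj ?t1))\<^sup>2"
      "(cmod \<alpha>)\<^sup>2 = (cmod (?t2 - ?t1))\<^sup>2 / (cmod (?t2 - cnj ?t1))\<^sup>2"
      by (rule ring_disc_in_domain[OF neg(2)[OF zw(1) elim(1)] neg(1)[OF zw(1) elim(1)]
          neg(2)[OF zw(2) elim(2)] neg(1)[OF zw(2) elim(2)] u(1) zw(1,2)[of n]
          Re(2)[OF elim(1), symmetric] Re(2)[OF elim(2), symmetric]])
    define p q where "p = 1 - (cmod a)\<^sup>2" and "q = 1 - (cmod b)\<^sup>2"
    have pq: "0 < p" "0 < q"
      using ab by (auto simp: p_def q_def power_less_one_iff)
    define c where "c = (1 - s) * k / 2"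
    have c: "0 < c"
      using s k by (simp add: c_def)
    have i: "c * p \<le> Im ?t1" "c * q \<le> Im ?t2"
      using elim(3,4) by (simp_all add: c_def p_def q_def a_def b_def)
    have ipos: "0 < c * p" "0 < c * q"
      using c pq by auto
    then have im_pos: "0 < Im ?t1" "0 < Im ?t2"
      using i by linarith+
    have den: "0 < (cmod (?t2 - cnj ?t1))\<^sup>2"
    proof -
      have "0 < Im (?t2 - cnj ?t1)"
        using im_pos by simp
      then have "?t2 - cnj ?t1 \<noteq> 0"
        by (metis less_irrefl zero_complex.sel(2))
      then show ?thesis
        by simp
    qed
    have lip: "cmod (?t2 - ?t1) \<le> (1 + s) * k * cmod (a - b)"
    proof -
      have "cmod (?t2 - ?t1) \<le> (1 + s) * k * cmod (\<psi> (w n) / u - \<psi> (z n) / u)"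
        unfolding l_def using \<delta>(2)[OF elim(6,5)] .
      also have "cmod (\<psi> (w n) / u - \<psi> (z n) / u) = cmod (a - b)"
        using u(1) by (simp add: a_def b_def diff_divide_distrib[symmetric] norm_divide norm_minus_commute)
      finally show ?thesis .
    qed
    define t where "t = cmod (Moebius_function 0 a b)"
    have t1: "0 \<le> t" "t < 1"
      using Moebius_function_norm_lt_1[OF ab] by (auto simp: t_def)
    have nz': "1 - cnj a * b \<noteq> 0"
    proof
      assume "1 - cnj a * b = 0"
      then have "cmod (cnj a * b) = 1"
        by (metis eq_iff_diff_eq_0 norm_one)
      then show False
        using norm_mult_less[of "cnj a" 1 b 1] ab by simp
    qed
    have t2: "1 - t\<^sup>2 = p * q / (cmod (1 - cnj a * b))\<^sup>2"
      using one_minus_Moebius_norm_square[OF ab] by (simp add: t_def p_def q_def)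
    have "t\<^sup>2 = (cmod (a - b))\<^sup>2 / (cmod (1 - cnj a * b))\<^sup>2"
      by (simp add: t_def Moebius_function_simple norm_divide power_divide norm_minus_commute)
    then have quot: "t\<^sup>2 / (1 - t\<^sup>2) = (cmod (a - b))\<^sup>2 / (p * q)"
      unfolding t2 using nz' by simp
    define K where "K = (1 + s) / (1 - s)"
    have K1: "1 \<le> K"
      using s by (simp add: K_def)
    have "artanh (cmod \<alpha>) \<le> K * artanh t"
    proof (rule artanh_le_scaled[OF _ _ t1 K1])
      have "(cmod \<alpha>)\<^sup>2 / (1 - (cmod \<alpha>)\<^sup>2) = (cmod (?t2 - ?t1))\<^sup>2 / (4 * Im ?t1 * Im ?t2)"
      proof -
        have "(cmod \<alpha>)\<^sup>2 / (1 - (cmod \<alpha>)\<^sup>2) = ((cmod (?t2 - ?t1))\<^sup>2 / (cmod (?t2 - cnj ?t1))\<^sup>2)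
            / (4 * Im ?t1 * Im ?t2 / (cmod (?t2 - cnj ?t1))\<^sup>2)"
          by (rule arg_cong2[where f = "(/)", OF \<phi>(6) \<phi>(5)])
        then show ?thesis
          using den by simp
      qed
      also have "\<dots> \<le> ((1 + s) * k * cmod (a - b))\<^sup>2 / (4 * ((c * p) * (c * q)))"
      proof (rule frac_le)
        show "(cmod (?t2 - ?t1))\<^sup>2 \<le> ((1 + s) * k * cmod (a - b))\<^sup>2"
          using lip by (intro power_mono) auto
        have "(c * p) * (c * q) \<le> Im ?t1 * Im ?t2"
          using i ipos by (intro mult_mono) auto
        then show "4 * ((c * p) * (c * q)) \<le> 4 * Im ?t1 * Im ?t2"
          by simp
        show "0 < 4 * ((c * p) * (c * q))"
          using mult_pos_pos[OF ipos] by simp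
      qed auto
      also have "\<dots> = K\<^sup>2 * (t\<^sup>2 / (1 - t\<^sup>2))"
      proof -
        have eq: "4 * ((c * p) * (c * q)) = ((1 - s) * k)\<^sup>2 * (p * q)"
          by (simp add: c_def power2_eq_square)
        show ?thesis
          unfolding eq quot K_def using k s by (simp add: power_mult_distrib power_divide)
      qed
      finally show "(cmod \<alpha>)\<^sup>2 / (1 - (cmod \<alpha>)\<^sup>2) \<le> K\<^sup>2 * (t\<^sup>2 / (1 - t\<^sup>2))" .
    qed (use \<phi>(4) in auto)
    then have "(1 - e) * artanh (cmod \<alpha>) \<le> (1 - e) * (K * artanh t)"
      using e by (intro mult_left_mono) auto
    also have "\<dots> \<le> 1 * artanh t"
    proof -
      have "(1 - e) * (1 + s) \<le> 1 - s"
        using e by (simp add: s_def algebra_simps)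
      then have "(1 - e) * K \<le> 1"
        using s by (simp add: K_def pos_divide_le_eq)
      then have "((1 - e) * K) * artanh t \<le> 1 * artanh t"
        using artanh_mono[of 0 t] t1 by (intro mult_right_mono) auto
      then show ?thesis
        by (simp only: mult.assoc)
    qed
    finally have main: "(1 - e) * artanh (cmod \<alpha>) \<le> artanh t"
      by simp
    have "0 < t"
      using \<open>a \<noteq> b\<close> nz' by (simp add: t_def Moebius_function_simple)
    then have "1 < (1 + t) / (1 - t)"
      using t1 by simp
    then have "0 < artanh t"
      by (simp add: artanh_def)
    then show ?case
      unfolding almost_extremal_def
      using main \<phi>(1-4) Moebius_competitor[OF zw(1), of n] by (intro exI[of _ "Moebius_function 0 (\<psi> (z n)) \<circ> \<psi>"] exI[of _ \<phi>] exI[of _ \<alpha>]) (simp add: t_def a_def b_def)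
  qed
qed

text \<open>\<open>near_C\<close> forces the moduli to 1, but the directions need not converge;
  compactness of the disc selects a subsequence.\<close>

lemma unit_limit_subsequence:
  assumes x: "\<And>n. x n \<in> D" "x \<longlonglongrightarrow> q" "q \<in> C"
  obtains s u where "strict_mono (s :: nat \<Rightarrow> nat)" "cmod u = 1" "(\<lambda>n. \<psi> (x (s n))) \<longlonglongrightarrow> u"
proof -
  have m: "(\<lambda>n. cmod (\<psi> (x n))) \<longlonglongrightarrow> 1"
  proof (rule order_tendstoI)
    fix a :: real assume "a < 1"
    then obtain \<delta> where \<delta>: "\<delta> > 0" "\<forall>x \<in> D \<inter> ball q \<delta>. a < cmod (\<psi> x)"
      using near_C[OF x(3)] by blast
    show "\<forall>\<^sub>F n in sequentially. a < cmod (\<psi> (x n))"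
      using tendstoD[OF x(2) \<delta>(1)] by eventually_elim (use \<delta>(2) x(1) in \<open>simp add: dist_commute\<close>)
  next
    fix a :: real assume "1 < a"
    then show "\<forall>\<^sub>F n in sequentially. cmod (\<psi> (x n)) < a"
      using \<psi>_disc[OF x(1)] by (intro always_eventually allI) (meson less_trans)
  qed
  have "seq_compact (cball (0::complex) 1)"
    by (simp add: compact_imp_seq_compact)
  moreover have "\<forall>n. \<psi> (x n) \<in> cball 0 1"
    using \<psi>_disc[OF x(1)] by (simp add: less_imp_le)
  ultimately obtain u s where s: "strict_mono (s :: nat \<Rightarrow> nat)" "((\<lambda>n. \<psi> (x n)) \<circ> s) \<longlonglongrightarrow> u"
    unfolding seq_compact_def by metis
  have "(\<lambda>n. cmod (((\<lambda>n. \<psi> (x n)) \<circ> s) n)) \<longlonglongrightarrow> cmod u"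
    using s(2) by (rule tendsto_norm)
  moreover have "(\<lambda>n. cmod (((\<lambda>n. \<psi> (x n)) \<circ> s) n)) \<longlonglongrightarrow> 1"
    using LIMSEQ_subseq_LIMSEQ[OF m s(1)] by (simp add: o_def)
  ultimately have "cmod u = 1"
    using LIMSEQ_unique by blast
  then show thesis
    using that[of s u] s by (simp add: o_def)
qed

end

section \<open>Uniformity by passing to subsequences\<close>

theorem proposition9:
  fixes D :: "complex set"
  assumes "open D" and "connected D" and "D \<noteq> {}"
    and "bounded D"
    and "finitely_connected D"
    and "\<forall>x \<in> frontier D. \<not> x isolated_in frontier D"
  shows "\<forall>\<epsilon>>0. \<exists>\<delta>>0. \<forall>z\<in>D. \<forall>w\<in>D. z \<noteq> w \<and> infdist w (frontier D) < \<delta> \<longrightarrow>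
           \<bar>caratheodory_dist D z w / lempert_function D z w - 1\<bar> < \<epsilon>"
proof (intro allI impI)
  fix \<epsilon> :: real assume "0 < \<epsilon>"
  \<comment> \<open>\<open>ratio_near_one\<close> yields only a weak inequality and requires
    \<open>e < 1\<close>, so \<open>e\<close> is taken strictly below both \<open>\<epsilon>\<close>
    and 1.\<close>
  define e where "e = min (\<epsilon> / 2) (1 / 2)"
  have e: "0 < e" "e < 1" "e < \<epsilon>"
    using \<open>0 < \<epsilon>\<close> by (auto simp: e_def)
  have fin: "finite (components (- D))"
    using finite_components_complement[OF assms(1,4,5)] .
  have chart: "\<exists>\<psi> h r. boundary_chart D C \<psi> h r" if "C \<in> components (- D)" for C
    using boundary_chart_exists[OF assms(1-4) fin that component_not_singleton[OF assms(1) fin assms(6) that]] by blast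
  have comp: "\<exists>C \<in> components (- D). p \<in> C" if "p \<notin> D" for p
    using that Union_components[of "- D"] by blast
  show "\<exists>\<delta>>0. \<forall>z\<in>D. \<forall>w\<in>D. z \<noteq> w \<and> infdist w (frontier D) < \<delta> \<longrightarrow>
           \<bar>caratheodory_dist D z w / lempert_function D z w - 1\<bar> < \<epsilon>"
  proof (rule ccontr)
    assume not: "\<not> ?thesis"
    have "\<exists>z w. z \<in> D \<and> w \<in> D \<and> z \<noteq> w \<and> infdist w (frontier D) < 1 / real (Suc n) \<and> \<not> almost_extremal D e z w" for n
    proof -
      have "0 < 1 / real (Suc n)"
        by simp
      then obtain z w where zw: "z \<in> D" "w \<in> D" "z \<noteq> w" "infdist w (frontier D) < 1 / real (Suc n)"
        "\<not> \<bar>caratheodory_dist D z w / lempert_function D z w - 1\<bar> < \<epsilon>"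
        using not by blast
      have "\<not> almost_extremal D e z w"
        unfolding almost_extremal_def using ratio_near_one[of _ D z _ _ w e] zw(5) e by fastforce
      then show ?thesis
        using zw by blast
    qed
    then obtain z w where zw: "\<And>n. z n \<in> D" "\<And>n. w n \<in> D" "\<And>n. z n \<noteq> w n"
      "\<And>n. infdist (w n) (frontier D) < 1 / real (Suc n)" "\<And>n. \<not> almost_extremal D e (z n) (w n)"
      by metis
    have sc: "seq_compact (closure D)"
      using assms(4) by (simp add: compact_imp_seq_compact)
    have sub: "\<exists>s q. strict_mono (s :: nat \<Rightarrow> nat) \<and> q \<in> closure D \<and> (\<lambda>n. x (s n)) \<longlonglongrightarrow> q" if x: "\<And>n. x n \<in> D" for x
    proof -
      have "\<forall>n. x n \<in> closure D"
        using x closure_subset by blast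
      then obtain q s where "q \<in> closure D" "strict_mono (s :: nat \<Rightarrow> nat)" "(x \<circ> s) \<longlonglongrightarrow> q"
        using sc unfolding seq_compact_def by metis
      then show ?thesis
        by (auto simp: o_def)
    qed
    obtain s1 p where s1: "strict_mono s1" "(\<lambda>n. w (s1 n)) \<longlonglongrightarrow> p"
      using sub[of w] zw(2) by blast
    have "(\<lambda>n. infdist (w n) (frontier D)) \<longlonglongrightarrow> 0"
    proof (rule tendsto_sandwich[OF _ _ tendsto_const LIMSEQ_Suc[OF lim_1_over_n]])
      show "\<forall>\<^sub>F n in sequentially. infdist (w n) (frontier D) \<le> 1 / real (Suc n)"
        using zw(4) by (intro always_eventually allI less_imp_le)
    qed (simp add: infdist_nonneg)
    then have "(\<lambda>n. infdist (w (s1 n)) (frontier D)) \<longlonglongrightarrow> 0"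
      using LIMSEQ_subseq_LIMSEQ[OF _ s1(1)] by (fastforce simp: o_def)
    moreover have "(\<lambda>n. infdist (w (s1 n)) (frontier D)) \<longlonglongrightarrow> infdist p (frontier D)"
      by (intro tendsto_infdist s1)
    ultimately have "infdist p (frontier D) = 0"
      using LIMSEQ_unique by blast
    \<comment> \<open>In HOL \<open>infdist\<close> to the empty set is 0, so without this the
      vanishing distance would say nothing.\<close>
    moreover have "frontier D \<noteq> {}"
      using assms(3,4) not_bounded_UNIV by (auto simp: frontier_eq_empty)
    ultimately have "p \<in> frontier D"
      using in_closed_iff_infdist_zero[OF frontier_closed] by blast
    then have "p \<notin> D"
      using assms(1) by (simp add: frontier_def interior_open)
    then obtain C0 where C0: "C0 \<in> components (- D)" "p \<in> C0"
      using comp by blast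
    obtain \<psi>0 h0 r0 where c0: "boundary_chart D C0 \<psi>0 h0 r0"
      using chart[OF C0(1)] by blast
    interpret c0: boundary_chart D C0 \<psi>0 h0 r0
      by (fact c0)
    obtain s2 u where s2: "strict_mono s2" "cmod u = 1" "(\<lambda>n. \<psi>0 (w (s1 (s2 n)))) \<longlonglongrightarrow> u"
      using c0.unit_limit_subsequence[of "\<lambda>n. w (s1 n)" p] zw(2) s1(2) C0(2) by blast
    obtain s3 q where s3: "strict_mono s3" "q \<in> closure D" "(\<lambda>n. z (s1 (s2 (s3 n)))) \<longlonglongrightarrow> q"
      using sub[of "\<lambda>n. z (s1 (s2 n))"] zw(1) by blast
    define z' w' where "z' n = z (s1 (s2 (s3 n)))" and "w' n = w (s1 (s2 (s3 n)))" for n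
    have zw': "z' n \<in> D" "w' n \<in> D" "z' n \<noteq> w' n" "\<not> almost_extremal D e (z' n) (w' n)" for n
      using zw by (auto simp: z'_def w'_def)
    have wu: "(\<lambda>n. \<psi>0 (w' n)) \<longlonglongrightarrow> u"
      using LIMSEQ_subseq_LIMSEQ[OF s2(3) s3(1)] by (simp add: w'_def o_def)
    have zq: "z' \<longlonglongrightarrow> q"
      using s3(3) by (simp add: z'_def[abs_def])
    \<comment> \<open>One reindexing is enough for the contradiction, since no pair of the sequence
      is almost extremal.\<close>
    have "\<exists>s. \<forall>\<^sub>F n in sequentially. almost_extremal D e (z' (s n)) (w' (s n))"
    proof (cases "q \<in> D")
      case True
      then show ?thesis
        using c0.almost_extremal_interior[OF assms(2) zw'(1,2) zq True wu s2(2) e(1,2)] by (intro exI[of _ "\<lambda>n. n"])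
    next
      case False
      then obtain C1 where C1: "C1 \<in> components (- D)" "q \<in> C1"
        using comp by blast
      \<comment> \<open>If \<open>C1 = C0\<close>, the limits of \<open>z\<close> and
        \<open>w\<close> on the circle must be compared in one and the same chart.\<close>
      obtain \<psi>1 h1 r1 where c1: "boundary_chart D C1 \<psi>1 h1 r1" and same: "C1 = C0 \<Longrightarrow> \<psi>1 = \<psi>0"
        using chart[OF C1(1)] c0 by (cases "C1 = C0") blast+
      interpret c1: boundary_chart D C1 \<psi>1 h1 r1
        by (fact c1)
      obtain s v where s: "strict_mono s" "cmod v = 1" "(\<lambda>n. \<psi>1 (z' (s n))) \<longlonglongrightarrow> v"
        using c1.unit_limit_subsequence[OF zw'(1) zq C1(2)] by blast
      have wu': "(\<lambda>n. \<psi>0 (w' (s n))) \<longlonglongrightarrow> u"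
        using LIMSEQ_subseq_LIMSEQ[OF wu s(1)] by (simp add: o_def)
      show ?thesis
      proof (cases "C1 = C0")
        case True
        then have zv: "(\<lambda>n. \<psi>0 (z' (s n))) \<longlonglongrightarrow> v"
          using s(3) same by simp
        show ?thesis
        proof (cases "u = v")
          case True
          then have "(\<lambda>n. \<psi>0 (z' (s n))) \<longlonglongrightarrow> u"
            using zv by simp
          then show ?thesis
            using c0.almost_extremal_same_limit[of "\<lambda>n. z' (s n)" "\<lambda>n. w' (s n)" u e] zw' s2(2) wu' e by blast
        next
          case False
          then show ?thesis
            using c0.almost_extremal_distinct_limits[of "\<lambda>n. z' (s n)" "\<lambda>n. w' (s n)" v u e] zw' zv s(2) s2(2) wu' e by blast
        qed
      next
        case False
        then have "C0 \<inter> C1 = {}"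
          using components_nonoverlap[OF C0(1) C1(1)] by blast
        then show ?thesis
          using almost_extremal_two_components[OF c0 c1 _ assms(2), of "\<lambda>n. z' (s n)" "\<lambda>n. w' (s n)" u v e]
            zw' s wu' s2(2) e by blast
      qed
    qed
    then have "\<exists>s. \<forall>\<^sub>F n in sequentially. False"
      using zw'(4) by simp
    then show False
      by simp
  qed
qed

end
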